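(* Let $B\#_{\sigma}H$ be a crossed product of an algebra $B$ and a Hopf algebra $H$ (with $H$ measuring $B$ via $\triangleright$ and with $\sigma:H\otimes H\to B$), where $H$ is cocommutative and the image of $\sigma$ belongs to the centre of $B$. Let $\mathcal{C}(B\#H,H)$ be the Ehresmann–Schauenburg bialgebroid of the Hopf Galois extension $B=(B\#H)^{coH}\subseteq B\#H$ associated with the smash product $B\#H$. Then the linear map $\tilde{\sigma}\in {}_{B}\mathrm{Hom}_{B}(\mathcal{C}(B\#H,H)\otimes_{B\otimes B^{op}}\mathcal{C}(B\#H,H),B)$ given by $$\tilde{\sigma}\big(b\#h_{(1)}\otimes b'\#S(h_{(2)}),\; c\#g_{(1)}\otimes c'\#S(g_{(2)})\big):=b\,(h_{(1)}\triangleright c)\,\sigma(h_{(2)},g_{(1)})\,\big((h_{(3)}g_{(2)})\triangleright c'\big)\,(h_{(4)}\triangleright b'),$$ for all $b,b',c,c'\in B$ and $h,g\in H$, is an invertible normalised 2-cocycle on the left $B$-bialgebroid $\mathcal{C}(B\#H,H)$.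
   Context: All algebras (unital, associative), modules and comodules are vector spaces over $\mathbb{C}$. $H$ is a Hopf algebra with coproduct $\Delta(h)=h_{(1)}\otimes h_{(2)}$ (sumless Sweedler notation), counit $\epsilon$, antipode $S$. Coactions are written $\delta(a)=a_{(0)}\otimes a_{(1)}$. Crossed product. $H$ measures an algebra $B$ if there is a linear map $H\otimes B\to B$, $h\otimes b\mapsto h\triangleright b$, with $h\triangleright 1=\epsilon(h)1$ and $h\triangleright(bb')=(h_{(1)}\triangleright b)(h_{(2)}\triangleright b')$. Let $\sigma:H\otimes H\to B$ be a convolution invertible linear map with convolution inverse $\sigma^{-1}$, such that for all $h,k,m\in H$, $b\in B$: (1) $1\triangleright b=b$; (2) $h\triangleright(k\triangleright b)=\sigma(h_{(1)},k_{(1)})(h_{(2)}k_{(2)}\triangleright b)\sigma^{-1}(h_{(3)},k_{(3)})$; (3) $\sigma(h,1)=\sigma(1,h)=\epsilon(h)1$; (4) $(h_{(1)}\triangleright\sigma(k_{(1)},m_{(1)}))\sigma(h_{(2)},k_{(2)}m_{(2)})=\sigma(h_{(1)},k_{(1)})\sigma(h_{(2)}k_{(2)},m)$. The crossed product $B\#_\sigma H$ is the vector space $B\otimes H$ (with $b\#_\sigma h:=b\otimes h$) with product $(b\#_\sigma h)(b'\#_\sigma h')=b(h_{(1)}\triangleright b')\sigma(h_{(2)},h'_{(1)})\#_\sigma h_{(3)}h'_{(2)}$ and unit $1\#_\sigma 1$. It is a right $H$-comodule algebra via $b\#_\sigma h\mapsto b\#_\sigma h_{(1)}\otimes h_{(2)}$,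 with coinvariant subalgebra $B$ (identified with $B\#_\sigma 1$). Under the hypotheses of the claim, $\triangleright$ makes $B$ a left $H$-module algebra, and the smash product $B\#H$ is the vector space $B\otimes H$ with product $(b\#h)(b'\#g)=b(h_{(1)}\triangleright b')\#h_{(2)}g$ for the same $\triangleright$ (i.e. the crossed product for the trivial cocycle $\epsilon\otimes\epsilon$). Hopf Galois extensions. For a right $H$-comodule algebra $A$ with $B=A^{coH}=\{b\in A:\delta(b)=b\otimes 1_H\}$, the extension $B\subseteq A$ is Hopf Galois if $\chi:A\otimes_BA\to A\otimes H$, $a\otimes_Ba'\mapsto aa'_{(0)}\otimes a'_{(1)}$ is bijective; $A$ is always assumed faithfully flat as a left $B$-module. The translation map is $\tau(h)=\chi^{-1}(1\otimes h)$. For $A=B\#H$ one has $\tau(h)=1\#S(h_{(1)})\otimes_B1\#h_{(2)}$. Ehresmann–Schauenburg bialgebroid. For a Hopf Galois extension $B=A^{coH}\subseteq A$, $\mathcal{C}(A,H)=\{a\otimes\tilde a\in A\otimes A: a_{(0)}\otimes\tau(a_{(1)})\tilde a=a\otimes\tilde a\otimes_B1\}$ (summation over simple tensors suppressed), equivalently the elements of $A\otimes A$ coinvariant for the diagonal coaction. It is a left $B$-bialgebroid with product $(a\otimes\tilde a)(a'\otimes\tilde a')=aa'\otimes\tilde a'\tilde a$, source $s(b)=b\otimes1$, target $t(b)=1\otimes b$, coproduct $\Delta(a\otimes\tilde a)=a_{(0)}\otimes\tau(a_{(1)})\otimes\tilde a$, counit $\epsilon(a\otimes\tilde a)=a\tilde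 a$. The space $\mathcal{C}(B\#H,H)$ is spanned by the elements $b\#h_{(1)}\otimes b'\#S(h_{(2)})$ with $b,b'\in B$, $h\in H$, and $\Delta(b\#h_{(1)}\otimes b'\#S(h_{(2)}))=b\#h_{(1)}\otimes1\#S(h_{(2)})\otimes_B1\#h_{(3)}\otimes b'\#S(h_{(4)})$. Left bialgebroids. A left $B$-bialgebroid $\mathcal{L}$ is an algebra with an algebra map $\eta:B\otimes B^{op}\to\mathcal{L}$, with source $s=\eta(\cdot\otimes1)$ and target $t=\eta(1\otimes\cdot)$ (having commuting ranges), together with a $B$-coring structure $(\Delta,\epsilon)$ for the bimodule structure $b\triangleright a\triangleleft b'=s(b)t(b')a$, such that $\Delta$ corestricts to an algebra map into $\mathcal{L}\times_B\mathcal{L}=\{\sum a_i\otimes_Ba_i':\sum a_it(b)\otimes_Ba_i'=\sum a_i\otimes_Ba_i's(b)\ \forall b\in B\}$ (with factorwise product), and $\epsilon(1)=1$, $\epsilon(s(b)a)=b\epsilon(a)$, $\epsilon(as(\epsilon(a')))=\epsilon(aa')=\epsilon(at(\epsilon(a')))$. Write $\Delta(a)=a_{(1)}\otimes_Ba_{(2)}$. 2-cocycles. $\mathcal{L}\otimes_{B\otimes B^{op}}\mathcal{L}$ is the tensor product balanced via $\eta$ (i.e. $a\eta(x)\otimes a'=a\otimes\eta(x)a'$), with $B$-bimodule structure $b\triangleright(a\otimes a')\triangleleft b'=s(b)t(b')a\otimes a'$. ${}_B\mathrm{Hom}_B(\mathcal{L}\otimes_{B\otimes B^{op}}\mathcal{L},B)$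 is an algebra under the convolution $(f\star g)(a,a')=f(a_{(1)},a'_{(1)})g(a_{(2)},a'_{(2)})$ with unit $a\otimes a'\mapsto\epsilon(aa')$. An invertible normalised 2-cocycle on $\mathcal{L}$ is a convolution invertible element $\tilde\sigma$ of this algebra such that for all $a,a',a''\in\mathcal{L}$, $b,b'\in B$: (1) $\tilde\sigma(s(b)t(b')a,a')=b\tilde\sigma(a,a')b'$; (2) $\tilde\sigma(a,s(\tilde\sigma(a'_{(1)},a''_{(1)}))a'_{(2)}a''_{(2)})=\tilde\sigma(s(\tilde\sigma(a_{(1)},a'_{(1)}))a_{(2)}a'_{(2)},a'')$; (3) $\tilde\sigma(1,a)=\epsilon(a)=\tilde\sigma(a,1)$. *)

theory Defs
  imports Complex_Main "HOL-Library.Poly_Mapping" "HOL-Library.FuncSet"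
begin

section \<open>Complex vector spaces and algebras\<close>

class scaleC =
  fixes scaleC :: "complex \<Rightarrow> 'a \<Rightarrow> 'a" (infixr "*\<^sub>C" 75)

class complex_vector = scaleC + ab_group_add +
  assumes scaleC_add_right: "c *\<^sub>C (x + y) = c *\<^sub>C x + c *\<^sub>C y"
    and scaleC_add_left: "(c + d) *\<^sub>C x = c *\<^sub>C x + d *\<^sub>C x"
    and scaleC_scaleC: "c *\<^sub>C (d *\<^sub>C x) = (c * d) *\<^sub>C x"
    and scaleC_one: "1 *\<^sub>C x = x"

interpretation complex_vector: vector_space "scaleC :: complex \<Rightarrow> 'a \<Rightarrow> 'a::complex_vector"
  by unfold_locales (simp_all add: scaleC_add_right scaleC_add_left scaleC_scaleC scaleC_one)

abbreviation cspan :: "'a::complex_vector set \<Rightarrow> 'a set" where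
  "cspan \<equiv> module.span scaleC"

abbreviation clinear :: "('a::complex_vector \<Rightarrow> 'b::complex_vector) \<Rightarrow> bool" where
  "clinear \<equiv> Vector_Spaces.linear scaleC scaleC"

definition cbilinear :: "('a::complex_vector \<Rightarrow> 'b::complex_vector \<Rightarrow> 'c::complex_vector) \<Rightarrow> bool" where
  "cbilinear F \<longleftrightarrow> (\<forall>a. clinear (F a)) \<and> (\<forall>b. clinear (\<lambda>a. F a b))"

lemma clinear_iff:
  "clinear f \<longleftrightarrow> (\<forall>x y. f (x + y) = f x + f y) \<and> (\<forall>c x. f (c *\<^sub>C x) = c *\<^sub>C f x)"
  by (simp add: Vector_Spaces.linear_iff complex_vector.vector_space_axioms)

instantiation complex :: complex_vector
begin
definition scaleC_complex :: "complex \<Rightarrow> complex \<Rightarrow> complex" where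
  "scaleC_complex = (*)"
instance by standard (simp_all add: scaleC_complex_def algebra_simps)
end

text \<open>The zero algebra is allowed (\<^class>\<open>ring_1\<close> would exclude it).\<close>

class complex_algebra_1 = complex_vector + ring + monoid_mult +
  assumes scaleC_mult_left: "(c *\<^sub>C x) * y = c *\<^sub>C (x * y)"
    and scaleC_mult_right: "x * (c *\<^sub>C y) = c *\<^sub>C (x * y)"

definition centre :: "'a::times set" where
  "centre = {z. \<forall>x. z * x = x * z}"


section \<open>The tensor product over the complex numbers\<close>

instantiation poly_mapping :: (type, complex_vector) complex_vector
begin

lift_definition scaleC_poly_mapping :: "complex \<Rightarrow> ('a \<Rightarrow>\<^sub>0 'b) \<Rightarrow> ('a \<Rightarrow>\<^sub>0 'b)"
  is "\<lambda>c f k. c *\<^sub>C f k"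
  by (erule rev_finite_subset) (auto simp: complex_vector.scale_zero_right)

instance
  by standard (transfer; simp add: fun_eq_iff scaleC_add_right scaleC_add_left scaleC_scaleC scaleC_one)+

end

text \<open>
  The vector space \<^typ>\<open>('a \<times> 'b) \<Rightarrow>\<^sub>0 complex\<close> is free on pairs; the tensor product is its
  quotient by the span of the bilinearity relations.
\<close>

abbreviation formal_pair :: "'a \<Rightarrow> 'b \<Rightarrow> ('a \<times> 'b) \<Rightarrow>\<^sub>0 complex" where
  "formal_pair a b \<equiv> Poly_Mapping.single (a, b) 1"

definition bilinearity_relations :: "(('a::complex_vector \<times> 'b::complex_vector) \<Rightarrow>\<^sub>0 complex) set" where
  "bilinearity_relations =
     {formal_pair (a + a') b - formal_pair a b - formal_pair a' b | a a' b. True} \<union>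
     {formal_pair a (b + b') - formal_pair a b - formal_pair a b' | a b b'. True} \<union>
     {formal_pair (c *\<^sub>C a) b - c *\<^sub>C formal_pair a b | c a b. True} \<union>
     {formal_pair a (c *\<^sub>C b) - c *\<^sub>C formal_pair a b | c a b. True}"

quotient_type (overloaded) ('a, 'b) tensor =
    "('a::complex_vector \<times> 'b::complex_vector) \<Rightarrow>\<^sub>0 complex" /
    "\<lambda>x y. x - y \<in> cspan bilinearity_relations"
proof (rule equivpI)
  show "reflp (\<lambda>x y :: ('a \<times> 'b) \<Rightarrow>\<^sub>0 complex. x - y \<in> cspan bilinearity_relations)"
    by (simp add: reflp_def complex_vector.span_zero)
  show "symp (\<lambda>x y :: ('a \<times> 'b) \<Rightarrow>\<^sub>0 complex. x - y \<in> cspan bilinearity_relations)"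
    using complex_vector.span_neg by (fastforce simp: symp_def)
  show "transp (\<lambda>x y :: ('a \<times> 'b) \<Rightarrow>\<^sub>0 complex. x - y \<in> cspan bilinearity_relations)"
    using complex_vector.span_add by (fastforce simp: transp_def)
qed

instantiation tensor :: (complex_vector, complex_vector) complex_vector
begin

lift_definition zero_tensor :: "('a, 'b) tensor" is 0 .

lift_definition plus_tensor :: "('a, 'b) tensor \<Rightarrow> ('a, 'b) tensor \<Rightarrow> ('a, 'b) tensor" is "(+)"
  by (metis add_diff_add complex_vector.span_add)

lift_definition minus_tensor :: "('a, 'b) tensor \<Rightarrow> ('a, 'b) tensor \<Rightarrow> ('a, 'b) tensor" is "(-)"
proof -
  fix x y z w :: "('a \<times> 'b) \<Rightarrow>\<^sub>0 complex"
  assume "x - y \<in> cspan bilinearity_relations" "z - w \<in> cspan bilinearity_relations"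
  then have "(x - y) - (z - w) \<in> cspan bilinearity_relations"
    by (rule complex_vector.span_diff)
  then show "x - z - (y - w) \<in> cspan bilinearity_relations"
    by (simp add: algebra_simps)
qed

lift_definition uminus_tensor :: "('a, 'b) tensor \<Rightarrow> ('a, 'b) tensor" is uminus
  by (metis complex_vector.span_neg minus_diff_minus)

lift_definition scaleC_tensor :: "complex \<Rightarrow> ('a, 'b) tensor \<Rightarrow> ('a, 'b) tensor" is scaleC
  by (metis complex_vector.scale_right_diff_distrib complex_vector.span_scale)

instance
  by standard
    (transfer; simp add: complex_vector.span_zero scaleC_add_right scaleC_add_left
        scaleC_scaleC scaleC_one algebra_simps)+

end

lift_definition tens :: "'a::complex_vector \<Rightarrow> 'b::complex_vector \<Rightarrow> ('a, 'b) tensor" (infixr "\<otimes>" 76)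
  is "\<lambda>a b. formal_pair a b" .

text \<open>
  The linear map on the tensor product induced by a bilinear map.  It renders sumless
  notation: \<open>tlift F x\<close> is \<open>\<Sum> F a b\<close> for \<open>x = \<Sum> a \<otimes> b\<close>.
\<close>

definition tlift ::
    "('a::complex_vector \<Rightarrow> 'b::complex_vector \<Rightarrow> 'c::complex_vector) \<Rightarrow> ('a, 'b) tensor \<Rightarrow> 'c" where
  "tlift F = (THE f. clinear f \<and> (\<forall>a b. f (a \<otimes> b) = F a b))"

lemma abs_tensor_eqI:
  "x - y \<in> bilinearity_relations \<Longrightarrow> abs_tensor x = abs_tensor y"
  by (simp add: tensor.abs_eq_iff complex_vector.span_base)

lemma tens_abs: "a \<otimes> b = abs_tensor (formal_pair a b)"
  by (simp add: tens.abs_eq)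

lemma tens_add_left: "(a + a') \<otimes> b = a \<otimes> b + a' \<otimes> b"
  unfolding tens_abs plus_tensor.abs_eq
  by (rule abs_tensor_eqI, unfold bilinearity_relations_def diff_diff_eq[symmetric]) blast

lemma tens_add_right: "a \<otimes> (b + b') = a \<otimes> b + a \<otimes> b'"
  unfolding tens_abs plus_tensor.abs_eq
  by (rule abs_tensor_eqI, unfold bilinearity_relations_def diff_diff_eq[symmetric]) blast

lemma tens_scaleC_left: "(c *\<^sub>C a) \<otimes> b = c *\<^sub>C (a \<otimes> b)"
  unfolding tens_abs scaleC_tensor.abs_eq
  by (rule abs_tensor_eqI, unfold bilinearity_relations_def) blast

lemma tens_scaleC_right: "a \<otimes> (c *\<^sub>C b) = c *\<^sub>C (a \<otimes> b)"
  unfolding tens_abs scaleC_tensor.abs_eq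
  by (rule abs_tensor_eqI, unfold bilinearity_relations_def) blast

lemma cbilinear_tens: "cbilinear (\<otimes>)"
  by (simp add: cbilinear_def clinear_iff tens_add_left tens_add_right
      tens_scaleC_left tens_scaleC_right)

definition free_lift ::
    "('a \<Rightarrow> 'b \<Rightarrow> 'c::complex_vector) \<Rightarrow> (('a \<times> 'b) \<Rightarrow>\<^sub>0 complex) \<Rightarrow> 'c" where
  "free_lift F p = (\<Sum>k\<in>Poly_Mapping.keys p. Poly_Mapping.lookup p k *\<^sub>C F (fst k) (snd k))"

lemma free_lift_superset:
  assumes "finite A" "Poly_Mapping.keys p \<subseteq> A"
  shows "free_lift F p = (\<Sum>k\<in>A. Poly_Mapping.lookup p k *\<^sub>C F (fst k) (snd k))"
  unfolding free_lift_def using assms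
  by (intro sum.mono_neutral_left) (auto simp: in_keys_iff)

lemma clinear_free_lift: "clinear (free_lift F)"
proof -
  have "free_lift F (p + q) = free_lift F p + free_lift F q" for p q
  proof -
    let ?A = "Poly_Mapping.keys p \<union> Poly_Mapping.keys q"
    have "Poly_Mapping.keys (p + q) \<subseteq> ?A" by (rule Poly_Mapping.keys_add)
    then show ?thesis
      by (simp add: free_lift_superset[of ?A] lookup_add scaleC_add_left sum.distrib)
  qed
  moreover have "free_lift F (c *\<^sub>C p) = c *\<^sub>C free_lift F p" for c p
  proof -
    have "Poly_Mapping.keys (c *\<^sub>C p) \<subseteq> Poly_Mapping.keys p"
      by (auto simp: in_keys_iff scaleC_poly_mapping.rep_eq scaleC_complex_def)
    then show ?thesis
      by (simp add: free_lift_superset[of "Poly_Mapping.keys p"] scaleC_poly_mapping.rep_eq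
          scaleC_scaleC complex_vector.scale_sum_right scaleC_complex_def)
  qed
  ultimately show ?thesis by (simp add: clinear_iff)
qed

lemma free_lift_formal_pair: "free_lift F (formal_pair a b) = F a b"
  by (simp add: free_lift_def scaleC_one)

lemma free_lift_relations:
  assumes "cbilinear F" and "p \<in> cspan bilinearity_relations"
  shows "free_lift F p = 0"
proof -
  interpret L: Vector_Spaces.linear scaleC scaleC "free_lift F" by (rule clinear_free_lift)
  have "free_lift F r = 0" if "r \<in> bilinearity_relations" for r
    using that assms(1)
    by (auto simp: bilinearity_relations_def L.diff L.scale free_lift_formal_pair
        cbilinear_def clinear_iff)
  then show ?thesis
    using assms(2) L.eq_0_on_span by blast
qed

lemma abs_tensor_free_lift: "abs_tensor p = free_lift (\<otimes>) p"
proof -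
  have "clinear abs_tensor"
    by (simp add: clinear_iff plus_tensor.abs_eq scaleC_tensor.abs_eq)
  then interpret A: Vector_Spaces.linear scaleC scaleC "abs_tensor :: _ \<Rightarrow> ('a, 'b) tensor" .
  have dec: "p = (\<Sum>k\<in>Poly_Mapping.keys p. Poly_Mapping.lookup p k *\<^sub>C formal_pair (fst k) (snd k))"
    by (rule poly_mapping_eqI)
      (simp add: lookup_sum scaleC_poly_mapping.rep_eq lookup_single when_def scaleC_complex_def
        if_distrib[of "\<lambda>x. _ * x"] sum.delta' in_keys_iff cong: if_cong)
  show ?thesis
    unfolding free_lift_def
    by (subst dec) (simp only: A.sum A.scale tens_abs)
qed

lemma tensor_span: "cspan {a \<otimes> b | a b. True} = UNIV"
proof -
  have "x \<in> cspan {a \<otimes> b | a b. True}" for x :: "('a, 'b) tensor"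
  proof (induct x)
    case (1 p)
    show ?case
      unfolding abs_tensor_free_lift free_lift_def
      by (intro complex_vector.span_sum complex_vector.span_scale complex_vector.span_base) blast
  qed
  then show ?thesis by blast
qed

lemma clinear_tensor_eqI:
  fixes f g :: "('a::complex_vector, 'b::complex_vector) tensor \<Rightarrow> 'c::complex_vector"
  assumes "clinear f" "clinear g" "\<And>a b. f (a \<otimes> b) = g (a \<otimes> b)"
  shows "f = g"
proof
  interpret P: vector_space_pair "scaleC :: complex \<Rightarrow> ('a, 'b) tensor \<Rightarrow> _" "scaleC :: complex \<Rightarrow> 'c \<Rightarrow> _"
    by (intro vector_space_pair.intro complex_vector.vector_space_axioms)
  fix x show "f x = g x"
  proof (rule P.linear_eq_on[OF assms(1,2)])
    show "x \<in> cspan {a \<otimes> b | a b. True}"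
      by (simp only: tensor_span UNIV_I)
  qed (use assms(3) in blast)
qed

lemma tlift_property:
  assumes "cbilinear F"
  shows "clinear (tlift F) \<and> (\<forall>a b. tlift F (a \<otimes> b) = F a b)"
proof -
  define f where "f x = free_lift F (rep_tensor x)" for x
  interpret L: Vector_Spaces.linear scaleC scaleC "free_lift F" by (rule clinear_free_lift)
  have f_abs: "f (abs_tensor p) = free_lift F p" for p
  proof -
    have "rep_tensor (abs_tensor p) - p \<in> cspan bilinearity_relations"
      using Quotient3_rep_abs[OF Quotient3_tensor, where r = p]
      by (simp add: complex_vector.span_zero)
    from free_lift_relations[OF assms this] show ?thesis
      by (simp add: f_def L.diff)
  qed
  have "clinear f"
  proof -
    have "f (x + y) = f x + f y" for x y
      by (induct x; induct y) (simp add: plus_tensor.abs_eq f_abs L.add)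
    moreover have "f (c *\<^sub>C x) = c *\<^sub>C f x" for c x
      by (induct x) (simp add: scaleC_tensor.abs_eq f_abs L.scale)
    ultimately show ?thesis by (simp add: clinear_iff)
  qed
  moreover have "\<forall>a b. f (a \<otimes> b) = F a b"
    by (simp add: tens_abs f_abs free_lift_formal_pair)
  ultimately have "\<exists>!f. clinear f \<and> (\<forall>a b. f (a \<otimes> b) = F a b)"
  proof (intro ex1I[of _ f] conjI)
    fix g assume "clinear f" "\<forall>a b. f (a \<otimes> b) = F a b"
      "clinear g \<and> (\<forall>a b. g (a \<otimes> b) = F a b)"
    then show "g = f"
      by (intro clinear_tensor_eqI) simp_all
  qed
  from theI'[OF this] show ?thesis by (simp add: tlift_def)
qed

lemma clinear_tlift: "cbilinear F \<Longrightarrow> clinear (tlift F)"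
  and tlift_tens: "cbilinear F \<Longrightarrow> tlift F (a \<otimes> b) = F a b"
  by (simp_all add: tlift_property)

text \<open>
  Balanced tensor products and other quotients \<open>V / N\<close> depend on term parameters, so their
  elements are represented as cosets of \<open>N\<close>.
\<close>

definition coset :: "'a::ab_group_add set \<Rightarrow> 'a \<Rightarrow> 'a set" where
  "coset N v = {w. w - v \<in> N}"

text \<open>The subspace \<open>U \<otimes> U\<close> of \<open>V \<otimes> V\<close> for a subspace \<open>U\<close> of \<open>V\<close>.\<close>

definition tensor_square :: "'a::complex_vector set \<Rightarrow> ('a, 'a) tensor set" where
  "tensor_square U = cspan {x \<otimes> y | x y. x \<in> U \<and> y \<in> U}"


section \<open>Hopf algebras and crossed product data\<close>

text \<open>
  Iterated Sweedler notation:
  \<open>sweedler3 \<Delta> F h\<close> is \<open>F h\<^sub>(\<^sub>1\<^sub>) h\<^sub>(\<^sub>2\<^sub>) h\<^sub>(\<^sub>3\<^sub>)\<close>, and so on.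
\<close>

definition sweedler2 ::
    "('h::complex_vector \<Rightarrow> ('h, 'h) tensor) \<Rightarrow> ('h \<Rightarrow> 'h \<Rightarrow> 'c::complex_vector) \<Rightarrow> 'h \<Rightarrow> 'c" where
  "sweedler2 \<Delta> F h = tlift F (\<Delta> h)"

definition sweedler3 ::
    "('h::complex_vector \<Rightarrow> ('h, 'h) tensor) \<Rightarrow> ('h \<Rightarrow> 'h \<Rightarrow> 'h \<Rightarrow> 'c::complex_vector) \<Rightarrow> 'h \<Rightarrow> 'c" where
  "sweedler3 \<Delta> F h = sweedler2 \<Delta> (\<lambda>h1 k. sweedler2 \<Delta> (\<lambda>h2 h3. F h1 h2 h3) k) h"

definition sweedler4 ::
    "('h::complex_vector \<Rightarrow> ('h, 'h) tensor) \<Rightarrow> ('h \<Rightarrow> 'h \<Rightarrow> 'h \<Rightarrow> 'h \<Rightarrow> 'c::complex_vector) \<Rightarrow> 'h \<Rightarrow> 'c" where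
  "sweedler4 \<Delta> F h = sweedler2 \<Delta> (\<lambda>h1 k. sweedler3 \<Delta> (\<lambda>h2 h3 h4. F h1 h2 h3 h4) k) h"

locale hopf_algebra =
  fixes \<Delta> :: "'h::complex_algebra_1 \<Rightarrow> ('h, 'h) tensor"
    and \<epsilon> :: "'h \<Rightarrow> complex"
    and S :: "'h \<Rightarrow> 'h"
  assumes linear_coproduct: "clinear \<Delta>"
    and linear_counit: "clinear \<epsilon>"
    and linear_antipode: "clinear S"
    and coassociative:
      "sweedler2 \<Delta> (\<lambda>h1 h2. h1 \<otimes> \<Delta> h2) h
        = sweedler2 \<Delta> (\<lambda>k h3. sweedler2 \<Delta> (\<lambda>h1 h2. h1 \<otimes> h2 \<otimes> h3) k) h"
    and counit_left: "sweedler2 \<Delta> (\<lambda>h1 h2. \<epsilon> h1 *\<^sub>C h2) h = h"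
    and counit_right: "sweedler2 \<Delta> (\<lambda>h1 h2. \<epsilon> h2 *\<^sub>C h1) h = h"
    and coproduct_mult:
      "\<Delta> (h * k) = sweedler2 \<Delta> (\<lambda>h1 h2. sweedler2 \<Delta> (\<lambda>k1 k2. (h1 * k1) \<otimes> (h2 * k2)) k) h"
    and coproduct_one: "\<Delta> 1 = 1 \<otimes> 1"
    and counit_mult: "\<epsilon> (h * k) = \<epsilon> h * \<epsilon> k"
    and counit_one: "\<epsilon> 1 = 1"
    and antipode_left: "sweedler2 \<Delta> (\<lambda>h1 h2. S h1 * h2) h = \<epsilon> h *\<^sub>C 1"
    and antipode_right: "sweedler2 \<Delta> (\<lambda>h1 h2. h1 * S h2) h = \<epsilon> h *\<^sub>C 1"

definition cocommutative :: "('h::complex_vector \<Rightarrow> ('h, 'h) tensor) \<Rightarrow> bool" where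
  "cocommutative \<Delta> \<longleftrightarrow> (\<forall>h. sweedler2 \<Delta> (\<lambda>h1 h2. h2 \<otimes> h1) h = \<Delta> h)"

text \<open>
  The data \<open>(\<triangleright>, \<sigma>)\<close> of a crossed product \<open>B #\<^sub>\<sigma> H\<close>; \<open>\<sigma>i\<close> is the convolution
  inverse of \<open>\<sigma>\<close>.
\<close>

locale crossed_product = hopf_algebra \<Delta> \<epsilon> S
  for \<Delta> :: "'h::complex_algebra_1 \<Rightarrow> ('h, 'h) tensor"
    and \<epsilon> :: "'h \<Rightarrow> complex"
    and S :: "'h \<Rightarrow> 'h" +
  fixes act :: "'h \<Rightarrow> 'b::complex_algebra_1 \<Rightarrow> 'b" (infixr "\<triangleright>" 74)
    and \<sigma> :: "('h, 'h) tensor \<Rightarrow> 'b"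
    and \<sigma>i :: "('h, 'h) tensor \<Rightarrow> 'b"
  assumes bilinear_act: "cbilinear (\<triangleright>)"
    and measures_one: "h \<triangleright> 1 = \<epsilon> h *\<^sub>C 1"
    and measures_mult: "h \<triangleright> (b * b') = sweedler2 \<Delta> (\<lambda>h1 h2. (h1 \<triangleright> b) * (h2 \<triangleright> b')) h"
    and linear_sigma: "clinear \<sigma>"
    and linear_sigma_inv: "clinear \<sigma>i"
    and sigma_sigma_inv:
      "sweedler2 \<Delta> (\<lambda>h1 h2. sweedler2 \<Delta> (\<lambda>k1 k2. \<sigma> (h1 \<otimes> k1) * \<sigma>i (h2 \<otimes> k2)) k) h
        = (\<epsilon> h * \<epsilon> k) *\<^sub>C 1"
    and sigma_inv_sigma:
      "sweedler2 \<Delta> (\<lambda>h1 h2. sweedler2 \<Delta> (\<lambda>k1 k2. \<sigma>i (h1 \<otimes> k1) * \<sigma> (h2 \<otimes> k2)) k) h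
        = (\<epsilon> h * \<epsilon> k) *\<^sub>C 1"
    and one_act: "1 \<triangleright> b = b"
    and twisted_action:
      "h \<triangleright> k \<triangleright> b
        = sweedler3 \<Delta> (\<lambda>h1 h2 h3. sweedler3 \<Delta> (\<lambda>k1 k2 k3.
            \<sigma> (h1 \<otimes> k1) * ((h2 * k2) \<triangleright> b) * \<sigma>i (h3 \<otimes> k3)) k) h"
    and sigma_one_right: "\<sigma> (h \<otimes> 1) = \<epsilon> h *\<^sub>C 1"
    and sigma_one_left: "\<sigma> (1 \<otimes> h) = \<epsilon> h *\<^sub>C 1"
    and sigma_cocycle:
      "sweedler2 \<Delta> (\<lambda>h1 h2. sweedler2 \<Delta> (\<lambda>k1 k2. sweedler2 \<Delta> (\<lambda>m1 m2.
          (h1 \<triangleright> \<sigma> (k1 \<otimes> m1)) * \<sigma> (h2 \<otimes> (k2 * m2))) m) k) h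
        = sweedler2 \<Delta> (\<lambda>h1 h2. sweedler2 \<Delta> (\<lambda>k1 k2.
          \<sigma> (h1 \<otimes> k1) * \<sigma> ((h2 * k2) \<otimes> m)) k) h"


section \<open>Comodule algebras and the smash product\<close>

text \<open>
  A right \<open>H\<close>-comodule algebra \<open>A\<close> on the whole type \<open>'a\<close>, with the inclusion of its coinvariant
  subalgebra, which is given as the type \<open>'b\<close>.
\<close>

record (overloaded) ('a, 'b, 'h) comodule_algebra =
  amult :: "'a \<Rightarrow> 'a \<Rightarrow> 'a"
  aone :: 'a
  acoact :: "'a \<Rightarrow> ('a, 'h) tensor"
  aincl :: "'b \<Rightarrow> 'a"

definition smash_product ::
    "('h::complex_algebra_1 \<Rightarrow> ('h, 'h) tensor) \<Rightarrow> ('h \<Rightarrow> 'b::complex_algebra_1 \<Rightarrow> 'b)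
      \<Rightarrow> (('b, 'h) tensor, 'b, 'h) comodule_algebra" where
  "smash_product \<Delta> act =
     \<lparr>amult = \<lambda>x y. tlift (\<lambda>b h. tlift (\<lambda>b' g.
        sweedler2 \<Delta> (\<lambda>h1 h2. (b * act h1 b') \<otimes> (h2 * g)) h) y) x,
      aone = 1 \<otimes> 1,
      acoact = tlift (\<lambda>b h. sweedler2 \<Delta> (\<lambda>h1 h2. (b \<otimes> h1) \<otimes> h2) h),
      aincl = \<lambda>b. b \<otimes> 1\<rparr>"


section \<open>The translation map of a Hopf Galois extension\<close>

text \<open>\<open>A \<otimes>\<^sub>B A\<close> is \<open>A \<otimes> A\<close> modulo this subspace.\<close>

definition ext_balance ::
    "('a::complex_vector, 'b, 'h) comodule_algebra \<Rightarrow> ('a, 'a) tensor set" where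
  "ext_balance A = cspan
     {amult A a (aincl A b) \<otimes> a' - a \<otimes> amult A (aincl A b) a' | a b a'. True}"

definition galois_map_lift ::
    "('a::complex_vector, 'b, 'h::complex_vector) comodule_algebra
      \<Rightarrow> ('a, 'a) tensor \<Rightarrow> ('a, 'h) tensor" where
  "galois_map_lift A = tlift (\<lambda>a a'. tlift (\<lambda>a0 h. amult A a a0 \<otimes> h) (acoact A a'))"

text \<open>
  The canonical map \<open>\<chi> : A \<otimes>\<^sub>B A \<rightarrow> A \<otimes> H\<close>; \<open>galois_map_lift\<close> is constant on cosets of
  \<open>ext_balance A\<close>.
\<close>

definition galois_map ::
    "('a::complex_vector, 'b, 'h::complex_vector) comodule_algebra
      \<Rightarrow> ('a, 'a) tensor set \<Rightarrow> ('a, 'h) tensor" where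
  "galois_map A X = the_elem (galois_map_lift A ` X)"

definition translation_map ::
    "('a::complex_vector, 'b, 'h::complex_vector) comodule_algebra
      \<Rightarrow> 'h \<Rightarrow> ('a, 'a) tensor set" where
  "translation_map A h =
     inv_into (range (coset (ext_balance A))) (galois_map A) (aone A \<otimes> h)"

text \<open>
  A linear map \<open>H \<rightarrow> A \<otimes> A\<close> lifting \<open>\<tau> : H \<rightarrow> A \<otimes>\<^sub>B A\<close>.  It is used only modulo
  \<open>ext_balance A\<close> in the middle tensor factors, where the choice of the lift is irrelevant.
\<close>

definition translation_lift ::
    "('a::complex_vector, 'b, 'h::complex_vector) comodule_algebra \<Rightarrow> 'h \<Rightarrow> ('a, 'a) tensor" where
  "translation_lift A = (SOME T. clinear T \<and> (\<forall>h. T h \<in> translation_map A h))"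


section \<open>Left bialgebroids and the Ehresmann--Schauenburg bialgebroid\<close>

text \<open>
  The structure maps of a left \<open>B\<close>-bialgebroid \<open>L\<close> whose underlying space is a subspace of the
  type \<open>'l\<close>.  The coproduct takes values in \<open>L \<otimes>\<^sub>B L\<close>, the quotient of \<open>L \<otimes> L\<close> by the
  span of all \<open>t(b) x \<otimes> y - x \<otimes> s(b) y\<close>; its values are cosets.
\<close>

record (overloaded) ('b, 'l) bialgebroid =
  lcarrier :: "'l set"
  lmult :: "'l \<Rightarrow> 'l \<Rightarrow> 'l"
  lone :: 'l
  lsource :: "'b \<Rightarrow> 'l"
  ltarget :: "'b \<Rightarrow> 'l"
  lcoprod :: "'l \<Rightarrow> ('l, 'l) tensor set"
  lcounit :: "'l \<Rightarrow> 'b"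

text \<open>
  The condition \<open>a\<^sub>(\<^sub>0\<^sub>) \<otimes> \<tau>(a\<^sub>(\<^sub>1\<^sub>)) c = a \<otimes> c \<otimes>\<^sub>B 1\<close> holds in \<open>A \<otimes> (A \<otimes>\<^sub>B A)\<close>,
  the quotient of \<open>A \<otimes> (A \<otimes> A)\<close> by \<open>A \<otimes> ext_balance A\<close>.
\<close>

definition es_carrier ::
    "('a::complex_vector, 'b, 'h::complex_vector) comodule_algebra \<Rightarrow> ('a, 'a) tensor set" where
  "es_carrier A =
     {x. tlift (\<lambda>a c. tlift (\<lambda>a0 h.
           a0 \<otimes> tlift (\<lambda>u v. u \<otimes> amult A v c) (translation_lift A h)) (acoact A a)) x
         - tlift (\<lambda>a c. a \<otimes> (c \<otimes> aone A)) x
       \<in> cspan {a \<otimes> n | a n. n \<in> ext_balance A}}"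

text \<open>
  The element \<open>a\<^sub>(\<^sub>0\<^sub>) \<otimes> \<tau>(a\<^sub>(\<^sub>1\<^sub>)) \<otimes> c\<close> lies in \<open>A \<otimes> (A \<otimes>\<^sub>B A) \<otimes> A\<close>, the quotient of
  \<open>(A \<otimes> A) \<otimes> (A \<otimes> A)\<close> by \<open>es_middle_balance A\<close>.  As \<open>A\<close> is faithfully flat over \<open>B\<close>,
  \<open>C \<otimes>\<^sub>B C\<close> embeds into this space, and the coset in \<open>C \<otimes>\<^sub>B C\<close> which corresponds to
  that element consists of its representatives in \<open>C \<otimes> C\<close>.
\<close>

definition es_middle_balance ::
    "('a::complex_vector, 'b, 'h) comodule_algebra
      \<Rightarrow> (('a, 'a) tensor, ('a, 'a) tensor) tensor set" where
  "es_middle_balance A = cspan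
     {tlift (\<lambda>u v. (p \<otimes> u) \<otimes> (v \<otimes> q)) n | p q n. n \<in> ext_balance A}"

definition es_coprod ::
    "('a::complex_vector, 'b, 'h::complex_vector) comodule_algebra
      \<Rightarrow> ('a, 'a) tensor \<Rightarrow> (('a, 'a) tensor, ('a, 'a) tensor) tensor set" where
  "es_coprod A x =
     tensor_square (es_carrier A) \<inter>
     coset (es_middle_balance A)
       (tlift (\<lambda>a c. tlift (\<lambda>a0 h.
          tlift (\<lambda>u v. (a0 \<otimes> u) \<otimes> (v \<otimes> c)) (translation_lift A h)) (acoact A a)) x)"

definition ehresmann_schauenburg ::
    "('a::complex_vector, 'b, 'h::complex_vector) comodule_algebra
      \<Rightarrow> ('b, ('a, 'a) tensor) bialgebroid" where
  "ehresmann_schauenburg A =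
     \<lparr>lcarrier = es_carrier A,
      lmult = \<lambda>x y. tlift (\<lambda>a c. tlift (\<lambda>a' c'. amult A a a' \<otimes> amult A c' c) y) x,
      lone = aone A \<otimes> aone A,
      lsource = \<lambda>b. aincl A b \<otimes> aone A,
      ltarget = \<lambda>b. aone A \<otimes> aincl A b,
      lcoprod = es_coprod A,
      lcounit = \<lambda>x. inv (aincl A) (tlift (amult A) x)\<rparr>"


section \<open>Two-cocycles on a left bialgebroid\<close>

text \<open>
  \<open>L \<otimes>\<^bsub>B \<otimes> B\<^sup>o\<^sup>p\<^esub> L\<close> is \<open>L \<otimes> L\<close> modulo this subspace; the map
  \<open>\<eta>\<close> sends \<open>b \<otimes> b'\<close> to \<open>s(b) t(b')\<close>.
\<close>

definition env_balance :: "('b, 'l::complex_vector) bialgebroid \<Rightarrow> ('l, 'l) tensor set" where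
  "env_balance L = cspan
     {lmult L x (lmult L (lsource L b) (ltarget L b')) \<otimes> y
        - x \<otimes> lmult L (lmult L (lsource L b) (ltarget L b')) y
      | x y b b'. x \<in> lcarrier L \<and> y \<in> lcarrier L}"

definition env_tensor :: "('b, 'l::complex_vector) bialgebroid \<Rightarrow> ('l, 'l) tensor set set" where
  "env_tensor L = coset (env_balance L) ` tensor_square (lcarrier L)"

text \<open>\<open>env_eval L f x y\<close> is \<open>f(x, y)\<close>, the value of \<open>f\<close> at the class of \<open>x \<otimes> y\<close>.\<close>

definition env_eval ::
    "('b, 'l::complex_vector) bialgebroid \<Rightarrow> (('l, 'l) tensor set \<Rightarrow> 'b) \<Rightarrow> 'l \<Rightarrow> 'l \<Rightarrow> 'b" where
  "env_eval L f x y = f (coset (env_balance L) (x \<otimes> y))"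

text \<open>\<open>\<^sub>BHom\<^sub>B(L \<otimes>\<^bsub>B \<otimes> B\<^sup>o\<^sup>p\<^esub> L, B)\<close>\<close>

definition bimodule_homs ::
    "('b::complex_algebra_1, 'l::complex_vector) bialgebroid
      \<Rightarrow> (('l, 'l) tensor set \<Rightarrow> 'b) set" where
  "bimodule_homs L = {f \<in> extensional (env_tensor L).
     (\<forall>v\<in>tensor_square (lcarrier L). \<forall>w\<in>tensor_square (lcarrier L).
        f (coset (env_balance L) (v + w))
          = f (coset (env_balance L) v) + f (coset (env_balance L) w)) \<and>
     (\<forall>c. \<forall>v\<in>tensor_square (lcarrier L).
        f (coset (env_balance L) (c *\<^sub>C v)) = c *\<^sub>C f (coset (env_balance L) v)) \<and>
     (\<forall>x\<in>lcarrier L. \<forall>y\<in>lcarrier L. \<forall>b b'.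
        env_eval L f (lmult L (lmult L (lsource L b) (ltarget L b')) x) y
          = b * env_eval L f x y * b')}"

text \<open>
  Sweedler notation for the coproduct of \<open>L\<close>: \<open>lsweedler L F x y\<close> is
  \<open>F x\<^sub>(\<^sub>1\<^sub>) x\<^sub>(\<^sub>2\<^sub>) y\<^sub>(\<^sub>1\<^sub>) y\<^sub>(\<^sub>2\<^sub>)\<close>, computed from any finite sums of simple tensors in
  \<open>L \<otimes> L\<close> that represent \<open>\<Delta>(x)\<close> and \<open>\<Delta>(y)\<close>.
\<close>

definition represents_coprod ::
    "('b, 'l::complex_vector) bialgebroid \<Rightarrow> 'l \<Rightarrow> ('l \<times> 'l) list \<Rightarrow> bool" where
  "represents_coprod L x ps \<longleftrightarrow>
     set ps \<subseteq> lcarrier L \<times> lcarrier L \<and> (\<Sum>(x1, x2)\<leftarrow>ps. x1 \<otimes> x2) \<in> lcoprod L x"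

definition lsweedler ::
    "('b, 'l::complex_vector) bialgebroid \<Rightarrow> ('l \<Rightarrow> 'l \<Rightarrow> 'l \<Rightarrow> 'l \<Rightarrow> 'c::comm_monoid_add)
      \<Rightarrow> 'l \<Rightarrow> 'l \<Rightarrow> 'c" where
  "lsweedler L F x y = (THE v. \<exists>ps qs. represents_coprod L x ps \<and> represents_coprod L y qs \<and>
     v = (\<Sum>(x1, x2)\<leftarrow>ps. \<Sum>(y1, y2)\<leftarrow>qs. F x1 x2 y1 y2))"

definition convolution ::
    "('b::complex_algebra_1, 'l::complex_vector) bialgebroid \<Rightarrow> (('l, 'l) tensor set \<Rightarrow> 'b)
      \<Rightarrow> (('l, 'l) tensor set \<Rightarrow> 'b) \<Rightarrow> 'l \<Rightarrow> 'l \<Rightarrow> 'b" where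
  "convolution L f g =
     lsweedler L (\<lambda>x1 x2 y1 y2. env_eval L f x1 y1 * env_eval L g x2 y2)"

definition convolution_invertible ::
    "('b::complex_algebra_1, 'l::complex_vector) bialgebroid
      \<Rightarrow> (('l, 'l) tensor set \<Rightarrow> 'b) \<Rightarrow> bool" where
  "convolution_invertible L f \<longleftrightarrow> f \<in> bimodule_homs L \<and>
     (\<exists>g\<in>bimodule_homs L. \<forall>x\<in>lcarrier L. \<forall>y\<in>lcarrier L.
        convolution L f g x y = lcounit L (lmult L x y) \<and>
        convolution L g f x y = lcounit L (lmult L x y))"

text \<open>\<open>s(f(x\<^sub>(\<^sub>1\<^sub>), y\<^sub>(\<^sub>1\<^sub>))) x\<^sub>(\<^sub>2\<^sub>) y\<^sub>(\<^sub>2\<^sub>)\<close>\<close>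

definition left_twist ::
    "('b, 'l::complex_vector) bialgebroid \<Rightarrow> (('l, 'l) tensor set \<Rightarrow> 'b) \<Rightarrow> 'l \<Rightarrow> 'l \<Rightarrow> 'l" where
  "left_twist L f =
     lsweedler L (\<lambda>x1 x2 y1 y2. lmult L (lmult L (lsource L (env_eval L f x1 y1)) x2) y2)"

definition invertible_normalised_2cocycle ::
    "('b::complex_algebra_1, 'l::complex_vector) bialgebroid
      \<Rightarrow> (('l, 'l) tensor set \<Rightarrow> 'b) \<Rightarrow> bool" where
  "invertible_normalised_2cocycle L f \<longleftrightarrow>
     convolution_invertible L f \<and>
     (\<forall>x\<in>lcarrier L. \<forall>y\<in>lcarrier L. \<forall>b b'.
        env_eval L f (lmult L (lmult L (lsource L b) (ltarget L b')) x) y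
          = b * env_eval L f x y * b') \<and>
     (\<forall>x\<in>lcarrier L. \<forall>y\<in>lcarrier L. \<forall>z\<in>lcarrier L.
        env_eval L f x (left_twist L f y z) = env_eval L f (left_twist L f x y) z) \<and>
     (\<forall>x\<in>lcarrier L. env_eval L f (lone L) x = lcounit L x \<and>
        env_eval L f x (lone L) = lcounit L x)"


section \<open>Spanning elements for the smash product\<close>

text \<open>The element \<open>b # h\<^sub>(\<^sub>1\<^sub>) \<otimes> b' # S(h\<^sub>(\<^sub>2\<^sub>))\<close> of \<open>C(B # H, H)\<close>\<close>

definition smash_elem ::
    "('h::complex_algebra_1 \<Rightarrow> ('h, 'h) tensor) \<Rightarrow> ('h \<Rightarrow> 'h) \<Rightarrow> 'b::complex_algebra_1 \<Rightarrow> 'b \<Rightarrow> 'h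
      \<Rightarrow> (('b, 'h) tensor, ('b, 'h) tensor) tensor" where
  "smash_elem \<Delta> S b b' h = sweedler2 \<Delta> (\<lambda>h1 h2. (b \<otimes> h1) \<otimes> (b' \<otimes> S h2)) h"

end

theory Submission
  imports Defs
begin

text \<open>
  Let \<open>K\<close> be a cocommutative coalgebra.  A bilinear map \<open>f\<close> acts on linear maps \<open>F\<close>, \<open>G\<close> on \<open>K\<close> by
  convolution, \<open>k \<mapsto> f(F k\<^sub>(\<^sub>1\<^sub>), G k\<^sub>(\<^sub>2\<^sub>))\<close>, and every multilinear identity between bilinear maps carries
  over, whatever the order of its arguments.  For these products a coalgebra map \<open>\<gamma> : K \<rightarrow> H\<close> (a \<open>K\<close>-point
  of \<open>H\<close>) behaves like an invertible group-like element with inverse \<open>S \<circ> \<gamma>\<close>.  So all computations are done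
  as in the case of a group \<open>H\<close> acting on \<open>B\<close> by automorphisms, where
  \<open>(b # \<gamma> \<otimes> b' # \<gamma>\<^sup>-\<^sup>1) (c # \<eta> \<otimes> c' # \<eta>\<^sup>-\<^sup>1) = b (\<gamma> \<triangleright> c) # \<gamma>\<eta> \<otimes> c' (\<eta>\<^sup>-\<^sup>1 \<triangleright> b') # (\<gamma>\<eta>)\<^sup>-\<^sup>1\<close> and the map of the
  theorem is the trivial cocycle \<open>\<epsilon>(x y)\<close> multiplied by \<open>\<sigma>(\<gamma>, \<eta>)\<close>.  Identities in \<open>n\<close> elements of \<open>H\<close> are
  recovered from the \<open>n\<close> projections \<open>H \<otimes> \<dots> \<otimes> H \<rightarrow> H\<close>.

  The action is a module structure because \<open>\<sigma>\<close> is central.  Contracting the coinvariance condition shows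
  that \<open>C(B # H, H)\<close> is the image of an explicit projection, hence spanned by the given elements.  Values
  that are computed from representatives of the coproduct do not depend on their choice because
  \<open>C \<otimes>\<^sub>B C\<close> has a normal form which can be read off in \<open>A \<otimes> (A \<otimes>\<^sub>B A) \<otimes> A\<close>.
\<close>

section \<open>Multilinear maps\<close>

text \<open>Two obstacles shape the proof. The identities involve several Sweedler indices for each
  of up to three elements of H. Convolution over a coalgebra of parameters hides all indices;
  cocommutativity enters through \<open>sweedler_comm\<close> and gives the interchange law
  \<open>conv_interchange\<close>, by which products and inverses of points are points again. The
  other obstacle is that convolution and left twist of forms are definite descriptions over all
  lists representing a coproduct, so nothing can be computed before existence and independence are
  known. Here \<open>reduce\<close> vanishes on the relations of the larger space with four legs,
  while a balanced form takes the same value on an element and on its normal form: a concrete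
  version of the embedding of the tensor square of C over B into that space. Replacing
  representatives in the second argument uses the Takeuchi condition as well. Centrality lets the
  value of \<sigma> at two points pass every coefficient. Hence the inverse of the form is the same
  form built from the inverse of \<sigma>, and the cocycle identity comes down to the one for
  \<sigma>.\<close>

named_theorems lin

text \<open>The rules collected in \<open>lin\<close> reduce linearity of a term in one variable to
  linearity of its subterms, so that \<open>intro lin\<close> settles the side conditions of
  \<open>tlift\<close>.\<close>

lemma cbilinearI [lin]:
  "(\<And>a. clinear (F a)) \<Longrightarrow> (\<And>b. clinear (\<lambda>a. F a b)) \<Longrightarrow> cbilinear F"
  by (simp add: cbilinear_def)

lemma clinearI:
  "(\<And>x y. f (x + y) = f x + f y) \<Longrightarrow> (\<And>c x. f (c *\<^sub>C x) = c *\<^sub>C f x) \<Longrightarrow> clinear f"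
  by (simp add: clinear_iff)

lemma clinear_add: "clinear f \<Longrightarrow> f (x + y) = f x + f y"
  and clinear_scaleC: "clinear f \<Longrightarrow> f (c *\<^sub>C x) = c *\<^sub>C f x"
  by (simp_all add: clinear_iff)

lemma clinear_zero: "clinear f \<Longrightarrow> f 0 = 0"
  using clinear_scaleC[of f 0 0] by simp

lemma clinear_diff: "clinear f \<Longrightarrow> f (x - y) = f x - f y"
  using clinear_add[of f x "- 1 *\<^sub>C y"] clinear_scaleC[of f "-1" y] by simp

lemma clinear_compose:
  assumes "clinear f" "clinear g"
  shows "clinear (\<lambda>x. f (g x))"
  using assms by (simp add: clinear_iff)

lemma clinear_o [lin, simp]: "clinear f \<Longrightarrow> clinear g \<Longrightarrow> clinear (f \<circ> g)"
  using clinear_compose by (simp add: comp_def)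

lemma clinear_ident [lin, simp]: "clinear (\<lambda>x. x)"
  by (simp add: clinear_iff)

lemma cbilinear_left: "cbilinear f \<Longrightarrow> clinear g \<Longrightarrow> clinear (\<lambda>x. f (g x) y)"
  using clinear_compose[of "\<lambda>u. f u y" g] by (simp add: cbilinear_def)

lemma cbilinear_right: "cbilinear f \<Longrightarrow> clinear g \<Longrightarrow> clinear (\<lambda>x. f y (g x))"
  using clinear_compose[of "f y" g] by (simp add: cbilinear_def)

lemma cbilinear_compose: "clinear L \<Longrightarrow> cbilinear f \<Longrightarrow> cbilinear (\<lambda>a b. L (f a b))"
  by (rule cbilinearI; rule clinear_compose[of L]) (simp_all add: cbilinear_def)

lemma cbilinear_compose2:
  "cbilinear f \<Longrightarrow> clinear F \<Longrightarrow> clinear G \<Longrightarrow> cbilinear (\<lambda>a b. f (F a) (G b))"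
  by (rule cbilinearI, rule cbilinear_right, assumption+, rule cbilinear_left)

lemma clinear_plus [lin]: "clinear f \<Longrightarrow> clinear g \<Longrightarrow> clinear (\<lambda>x. f x + g x)"
  by (simp add: clinear_iff scaleC_add_right algebra_simps)

lemma clinear_minus [lin]: "clinear f \<Longrightarrow> clinear g \<Longrightarrow> clinear (\<lambda>x. f x - g x)"
  by (simp add: clinear_iff complex_vector.scale_right_diff_distrib algebra_simps)

lemma cbilinear_scaleC: "cbilinear (\<lambda>c x. c *\<^sub>C x)"
  by (intro cbilinearI clinearI)
    (simp_all add: scaleC_add_right scaleC_add_left scaleC_scaleC scaleC_complex_def mult.commute)

lemma cbilinear_mult [simp]: "cbilinear ((*) :: 'a::complex_algebra_1 \<Rightarrow> 'a \<Rightarrow> 'a)"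
  by (intro cbilinearI clinearI) (simp_all add: scaleC_mult_left scaleC_mult_right algebra_simps)

declare cbilinear_tens [simp]

instance complex :: complex_algebra_1
  by standard (simp_all add: scaleC_complex_def)

lemmas clinear_scaleC_intros [lin] =
  cbilinear_left[OF cbilinear_scaleC] cbilinear_right[OF cbilinear_scaleC]
lemmas clinear_mult_intros [lin] =
  cbilinear_left[OF cbilinear_mult] cbilinear_right[OF cbilinear_mult]
lemmas clinear_tens_intros [lin] =
  cbilinear_left[OF cbilinear_tens] cbilinear_right[OF cbilinear_tens]

lemma clinear_tlift_right [lin]: "clinear g \<Longrightarrow> cbilinear F \<Longrightarrow> clinear (\<lambda>x. tlift F (g x))"
  by (rule clinear_compose[OF clinear_tlift])

lemma clinear_tens_left [simp]: "clinear (\<lambda>u. u \<otimes> b)" and clinear_tens_right [simp]: "clinear ((\<otimes>) a)"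
  by (intro lin)+

lemma bilinear_scaleC_left: "cbilinear f \<Longrightarrow> f (c *\<^sub>C x) y = c *\<^sub>C f x y"
  and bilinear_scaleC_right: "cbilinear f \<Longrightarrow> f x (c *\<^sub>C y) = c *\<^sub>C f x y"
  unfolding cbilinear_def using clinear_scaleC[of "\<lambda>u. f u y"] clinear_scaleC[of "f x"] by blast+

lemma tensor_induct [case_names tens add scale]:
  fixes w :: "('a::complex_vector, 'b::complex_vector) tensor"
  assumes "\<And>a b. P (a \<otimes> b)" "\<And>x y. P x \<Longrightarrow> P y \<Longrightarrow> P (x + y)" "\<And>c x. P x \<Longrightarrow> P (c *\<^sub>C x)"
  shows "P w"
proof -
  have "w \<in> cspan {a \<otimes> b | a b. True}"
    by (simp only: tensor_span UNIV_I)
  then show ?thesis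
  proof (induction rule: complex_vector.span_induct_alt)
    case base
    show ?case using assms(3)[of "0 \<otimes> 0" 0] assms(1) by simp
  next
    case (step c x y)
    then show ?case using assms by blast
  qed
qed

lemma tlift_add: "cbilinear F \<Longrightarrow> tlift F (x + y) = tlift F x + tlift F y"
  and tlift_scaleC: "cbilinear F \<Longrightarrow> tlift F (c *\<^sub>C x) = c *\<^sub>C tlift F x"
  using clinear_tlift[of F] by (simp_all add: clinear_iff)

text \<open>The tensor is fixed and the bilinear map varies linearly with a parameter. Since
  \<open>tlift\<close> is a definite description, the claim is checked by tensor induction, after
  \<open>F (x + y)\<close> has been rewritten as a pointwise sum.\<close>

lemma clinear_tlift_left [lin]:
  assumes "\<And>a b. clinear (\<lambda>x. F x a b)" "\<And>x. cbilinear (F x)"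
  shows "clinear (\<lambda>x. tlift (F x) w)"
proof (intro clinearI)
  note simps = tlift_tens tlift_add tlift_scaleC assms(2)
  show "tlift (F (x + y)) w = tlift (F x) w + tlift (F y) w" for x y
  proof -
    have *: "F (x + y) = (\<lambda>a b. F x a b + F y a b)"
      by (simp add: fun_eq_iff clinear_add[OF assms(1)])
    have "cbilinear (\<lambda>a b. F x a b + F y a b)"
      using assms(2)[of "x + y"] unfolding * .
    then show ?thesis
      unfolding * by (induction w rule: tensor_induct) (simp_all add: simps scaleC_add_right)
  qed
  show "tlift (F (c *\<^sub>C x)) w = c *\<^sub>C tlift (F x) w" for c x
  proof -
    have *: "F (c *\<^sub>C x) = (\<lambda>a b. c *\<^sub>C F x a b)"
      by (simp add: fun_eq_iff clinear_scaleC[OF assms(1)])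
    have "cbilinear (\<lambda>a b. c *\<^sub>C F x a b)"
      using assms(2)[of "c *\<^sub>C x"] unfolding * .
    then show ?thesis
      unfolding * by (induction w rule: tensor_induct)
        (simp_all add: simps scaleC_add_right scaleC_scaleC mult.commute)
  qed
qed

lemma tlift_compose:
  assumes "clinear L" "cbilinear F"
  shows "L (tlift F w) = tlift (\<lambda>a b. L (F a b)) w"
  using assms cbilinear_compose[OF assms]
  by (induction w rule: tensor_induct)
    (simp_all add: tlift_tens tlift_add tlift_scaleC clinear_add clinear_scaleC)

text \<open>Fubini for two independent sums.\<close>

lemma tlift_swap:
  assumes "\<And>a b. cbilinear (\<lambda>c d. F a b c d)" "\<And>c d. cbilinear (\<lambda>a b. F a b c d)"
  shows "tlift (\<lambda>a b. tlift (\<lambda>c d. F a b c d) w) v = tlift (\<lambda>c d. tlift (\<lambda>a b. F a b c d) v) w"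
proof -
  have l: "clinear (\<lambda>b. F a b c d)" "clinear (\<lambda>a. F a b c d)"
    "clinear (\<lambda>d. F a b c d)" "clinear (\<lambda>c. F a b c d)" for a b c d
    using assms by (simp_all add: cbilinear_def)
  have b1: "cbilinear (\<lambda>a b. tlift (\<lambda>c d. F a b c d) w)"
    by (intro lin l)
  have b2: "cbilinear (\<lambda>c d. tlift (\<lambda>a b. F a b c d) x)" for x
    by (intro lin l)
  show ?thesis
  proof (induction v rule: tensor_induct)
    case (tens a b)
    then show ?case by (simp add: tlift_tens assms b1)
  next
    case (add x y)
    have "tlift (\<lambda>c d. tlift (\<lambda>a b. F a b c d) (x + y)) w
        = tlift (\<lambda>c d. tlift (\<lambda>a b. F a b c d) x + tlift (\<lambda>a b. F a b c d) y) w"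
      by (simp add: tlift_add assms)
    also have "\<dots> = tlift (\<lambda>c d. tlift (\<lambda>a b. F a b c d) x) w + tlift (\<lambda>c d. tlift (\<lambda>a b. F a b c d) y) w"
    proof (induction w rule: tensor_induct)
      case (tens a b)
      show ?case by (subst (1 2 3) tlift_tens) (intro refl lin l)+
    qed (subst (1 2 3) tlift_add tlift_scaleC, (intro lin l)+, simp add: algebra_simps scaleC_add_right)+
    finally show ?case using add by (simp add: tlift_add b1)
  next
    case (scale c x)
    have "tlift (\<lambda>c' d. tlift (\<lambda>a b. F a b c' d) (c *\<^sub>C x)) w = tlift (\<lambda>c' d. c *\<^sub>C tlift (\<lambda>a b. F a b c' d) x) w"
      by (simp add: tlift_scaleC assms)
    also have "\<dots> = c *\<^sub>C tlift (\<lambda>c' d. tlift (\<lambda>a b. F a b c' d) x) w"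
      by (rule tlift_compose[symmetric]) (intro lin l)+
    finally show ?case using scale by (simp add: tlift_scaleC b1)
  qed
qed

section \<open>Spans of relations, cosets, and the tensor square of a subspace\<close>

lemma clinear_image_span:
  assumes "clinear L" "\<And>x. x \<in> X \<Longrightarrow> L x \<in> cspan Y" "x \<in> cspan X"
  shows "L x \<in> cspan Y"
  using assms(3)
proof (induction rule: complex_vector.span_induct_alt)
  case base
  show ?case by (simp add: clinear_zero[OF assms(1)] complex_vector.span_zero)
next
  case (step c x y)
  then show ?case
    by (simp add: clinear_add[OF assms(1)] clinear_scaleC[OF assms(1)] assms(2)
        complex_vector.span_add complex_vector.span_scale)
qed

lemma clinear_tensor_in_span:
  assumes "clinear L" "\<And>a b. L (a \<otimes> b) \<in> cspan Y"
  shows "L w \<in> cspan Y"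
  using assms by (induction w rule: tensor_induct)
    (simp_all add: clinear_iff complex_vector.span_add complex_vector.span_scale)

lemma tlift_in_span:
  assumes "cbilinear F" "\<And>a b. F a b \<in> cspan Y"
  shows "tlift F w \<in> cspan Y"
  using assms by (induction w rule: tensor_induct)
    (simp_all add: tlift_tens tlift_add tlift_scaleC complex_vector.span_add complex_vector.span_scale)

lemma cbilinear_minus: "cbilinear F \<Longrightarrow> cbilinear G \<Longrightarrow> cbilinear (\<lambda>a b. F a b - G a b)"
  by (intro cbilinearI clinear_minus) (simp_all add: cbilinear_def)

lemma tlift_diff:
  assumes "cbilinear F" "cbilinear G"
  shows "tlift F w - tlift G w = tlift (\<lambda>a b. F a b - G a b) w"
proof -
  have b: "cbilinear (\<lambda>a b. F a b - G a b)"
    using assms by (rule cbilinear_minus)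
  show ?thesis
    by (induction w rule: tensor_induct)
      (simp_all add: tlift_tens tlift_add tlift_scaleC assms b
        complex_vector.scale_right_diff_distrib algebra_simps flip: add_diff_add)
qed

text \<open>Termwise congruence of two sums modulo a subspace; used to exchange one lift of the
  translation map for another.\<close>

lemma tlift_diff_in_span:
  assumes "cbilinear F" "cbilinear G" "\<And>a b. F a b - G a b \<in> cspan Y"
  shows "tlift F w - tlift G w \<in> cspan Y"
proof -
  have b: "cbilinear (\<lambda>a b. F a b - G a b)"
    using assms(1,2) by (rule cbilinear_minus)
  show ?thesis
    unfolding tlift_diff[OF assms(1,2)] by (rule tlift_in_span[OF b assms(3)])
qed

lemma coset_eq_iff: "coset (cspan X) v = coset (cspan X) w \<longleftrightarrow> v - w \<in> cspan X"
proof
  assume "coset (cspan X) v = coset (cspan X) w"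
  moreover have "v \<in> coset (cspan X) v" by (simp add: coset_def complex_vector.span_zero)
  ultimately show "v - w \<in> cspan X" by (simp add: coset_def)
next
  assume "v - w \<in> cspan X"
  then have "u - v \<in> cspan X \<longleftrightarrow> u - w \<in> cspan X" for u
    using complex_vector.span_add[of "u - v" X "v - w"] complex_vector.span_diff[of "u - w" X "v - w"]
    by auto
  then show "coset (cspan X) v = coset (cspan X) w" by (simp add: coset_def)
qed

lemma tensor_square_tens: "x \<in> U \<Longrightarrow> y \<in> U \<Longrightarrow> x \<otimes> y \<in> tensor_square U"
  unfolding tensor_square_def by (rule complex_vector.span_base) blast

lemma clinear_eq_on_span:
  assumes "clinear f" "clinear g" "\<And>x. x \<in> X \<Longrightarrow> f x = g x" "x \<in> cspan X"
  shows "f x = g x"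
  using assms(4)
  by (induction rule: complex_vector.span_induct_alt)
    (simp_all add: clinear_zero[OF assms(1)] clinear_zero[OF assms(2)] clinear_add[OF assms(1)]
      clinear_add[OF assms(2)] clinear_scaleC[OF assms(1)] clinear_scaleC[OF assms(2)] assms(3))

lemma cbilinear_eq_on_span:
  assumes "cbilinear f" "cbilinear g" "\<And>x y. x \<in> X \<Longrightarrow> y \<in> Y \<Longrightarrow> f x y = g x y"
    and "x \<in> cspan X" "y \<in> cspan Y"
  shows "f x y = g x y"
proof -
  have l: "clinear (f x)" "clinear (g x)" "clinear (\<lambda>x. f x y)" "clinear (\<lambda>x. g x y)" for x y
    using assms(1,2) by (simp_all add: cbilinear_def)
  show ?thesis
    by (rule clinear_eq_on_span[OF l(3,4) clinear_eq_on_span[OF l(1,2) assms(3) assms(5)] assms(4)])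
qed

lemma tlift_eq_on_tensor_square:
  assumes "cbilinear f" "cbilinear g" "\<And>x y. x \<in> U \<Longrightarrow> y \<in> U \<Longrightarrow> f x y = g x y" "w \<in> tensor_square U"
  shows "tlift f w = tlift g w"
  by (rule clinear_eq_on_span[OF clinear_tlift[OF assms(1)] clinear_tlift[OF assms(2)]
        _ assms(4)[unfolded tensor_square_def]]) (auto simp: tlift_tens assms)

text \<open>Coproducts are represented by lists of pairs without coefficients, so scalars are
  absorbed in the left factor; for this \<open>U\<close> must be closed under scaling.\<close>

lemma tensor_square_list:
  fixes U :: "'a::complex_vector set"
  assumes U: "\<And>c x. x \<in> U \<Longrightarrow> c *\<^sub>C x \<in> U" and w: "w \<in> tensor_square U"
  obtains ps where "set ps \<subseteq> U \<times> U" "(\<Sum>(x, y)\<leftarrow>ps. x \<otimes> y) = w"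
proof -
  have "\<exists>ps. set ps \<subseteq> U \<times> U \<and> (\<Sum>(x, y)\<leftarrow>ps. x \<otimes> y) = w"
    using w unfolding tensor_square_def
  proof (induction rule: complex_vector.span_induct_alt)
    case base
    have "set [] \<subseteq> U \<times> U \<and> (\<Sum>(x, y)\<leftarrow>[]. x \<otimes> y) = 0" by simp
    then show ?case by blast
  next
    case (step c z w)
    then obtain x y ps where "z = x \<otimes> y" "x \<in> U" "y \<in> U" "set ps \<subseteq> U \<times> U" "(\<Sum>(x, y)\<leftarrow>ps. x \<otimes> y) = w"
      by blast
    then have "set ((c *\<^sub>C x, y) # ps) \<subseteq> U \<times> U \<and> (\<Sum>(x, y)\<leftarrow>(c *\<^sub>C x, y) # ps. x \<otimes> y) = c *\<^sub>C z + w"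
      using U by (simp add: tens_scaleC_left)
    then show ?case by blast
  qed
  then show ?thesis using that by blast
qed

lemma tlift_sum_list:
  "cbilinear F \<Longrightarrow> tlift F (\<Sum>(x, y)\<leftarrow>ps. x \<otimes> y) = (\<Sum>(x, y)\<leftarrow>ps. F x y)"
  by (induction ps) (auto simp: clinear_zero[OF clinear_tlift] tlift_add tlift_tens)

section \<open>Cocommutative coalgebras\<close>

text \<open>According to \<open>f\<close>, this is the product of maps into an algebra, the action
  of maps on maps, or the tensor product of maps composed with the coproduct. All spaces may
  differ.\<close>

definition conv ::
    "('k::complex_vector \<Rightarrow> ('k, 'k) tensor) \<Rightarrow> ('u \<Rightarrow> 'v \<Rightarrow> 'w::complex_vector)
      \<Rightarrow> ('k \<Rightarrow> 'u) \<Rightarrow> ('k \<Rightarrow> 'v) \<Rightarrow> 'k \<Rightarrow> 'w" where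
  "conv \<Delta> f F G = sweedler2 \<Delta> (\<lambda>a b. f (F a) (G b))"

text \<open>The constant with value \<open>x\<close>: by the counit law it acts in every convolution
  like the fixed argument \<open>x\<close>, and for \<open>x = 1\<close> it is the unit of the
  convolution algebra.\<close>

definition cst :: "('k \<Rightarrow> complex) \<Rightarrow> 'v::complex_vector \<Rightarrow> 'k \<Rightarrow> 'v" where
  "cst \<epsilon> x = (\<lambda>k. \<epsilon> k *\<^sub>C x)"

definition tswap :: "('a::complex_vector, 'b::complex_vector) tensor \<Rightarrow> ('b, 'a) tensor" where
  "tswap = tlift (\<lambda>a b. b \<otimes> a)"

lemma clinear_tswap [simp]: "clinear tswap" and tswap_tens [simp]: "tswap (a \<otimes> b) = b \<otimes> a"
  unfolding tswap_def by (intro lin, subst tlift_tens, intro lin, rule refl)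

lemma clinear_sweedler2:
  "clinear \<Delta> \<Longrightarrow> cbilinear F \<Longrightarrow> clinear (sweedler2 \<Delta> F)"
  unfolding sweedler2_def by (rule clinear_tlift_right)

lemma clinear_conv:
  assumes "clinear \<Delta>" "cbilinear f" "clinear F" "clinear G"
  shows "clinear (conv \<Delta> f F G)"
  unfolding conv_def
  by (rule clinear_sweedler2[OF _ cbilinear_compose2]) (rule assms)+

lemma conv_compose:
  assumes "clinear L" "cbilinear f" "clinear F" "clinear G"
  shows "L \<circ> conv \<Delta> f F G = conv \<Delta> (\<lambda>x y. L (f x y)) F G"
  using tlift_compose[OF assms(1) cbilinear_compose2[OF assms(2-4)]]
  by (simp add: conv_def sweedler2_def fun_eq_iff)

text \<open>The tensor product of maps is universal among convolutions. Read from right to left, a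
  linear map given by \<open>tlift f\<close> on a tensor product turns into a convolution of the two
  legs.\<close>

lemma conv_tens:
  assumes "cbilinear f" "clinear F" "clinear G"
  shows "conv \<Delta> f F G = tlift f \<circ> conv \<Delta> (\<otimes>) F G"
  by (subst conv_compose) (simp_all add: assms clinear_tlift tlift_tens)

lemma conv_diff_in_span:
  assumes "cbilinear f" "clinear F" "clinear G" "cbilinear f'" "clinear F'" "clinear G'"
    and "\<And>a b. f (F a) (G b) - f' (F' a) (G' b) \<in> cspan Y"
  shows "conv \<Delta> f F G k - conv \<Delta> f' F' G' k \<in> cspan Y"
  unfolding conv_def sweedler2_def
  by (rule tlift_diff_in_span) (simp_all add: assms cbilinear_compose2)

definition coalgebra_hom ::
    "('k::complex_vector \<Rightarrow> ('k, 'k) tensor) \<Rightarrow> ('k \<Rightarrow> complex)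
      \<Rightarrow> ('h::complex_vector \<Rightarrow> ('h, 'h) tensor) \<Rightarrow> ('h \<Rightarrow> complex) \<Rightarrow> ('k \<Rightarrow> 'h) \<Rightarrow> bool" where
  "coalgebra_hom \<Delta>\<^sub>K \<epsilon>\<^sub>K \<Delta> \<epsilon> \<gamma> \<longleftrightarrow>
     clinear \<gamma> \<and> \<Delta> \<circ> \<gamma> = conv \<Delta>\<^sub>K (\<otimes>) \<gamma> \<gamma> \<and> \<epsilon> \<circ> \<gamma> = \<epsilon>\<^sub>K"

lemma coalgebra_hom_clinear: "coalgebra_hom \<Delta>\<^sub>K \<epsilon>\<^sub>K \<Delta> \<epsilon> \<gamma> \<Longrightarrow> clinear \<gamma>"
  by (simp add: coalgebra_hom_def)

lemma sweedler2_hom: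
  assumes "coalgebra_hom \<Delta>\<^sub>K \<epsilon>\<^sub>K \<Delta> \<epsilon> \<gamma>" "cbilinear Q"
  shows "sweedler2 \<Delta> Q (\<gamma> k) = sweedler2 \<Delta>\<^sub>K (\<lambda>a b. Q (\<gamma> a) (\<gamma> b)) k"
proof -
  have "\<Delta> (\<gamma> k) = conv \<Delta>\<^sub>K (\<otimes>) \<gamma> \<gamma> k"
    using assms(1) by (simp add: coalgebra_hom_def fun_eq_iff)
  then show ?thesis
    using conv_tens[OF assms(2), of \<gamma> \<gamma> \<Delta>\<^sub>K] coalgebra_hom_clinear[OF assms(1)]
    by (simp add: sweedler2_def conv_def fun_eq_iff)
qed

text \<open>Naturality in the coalgebra of parameters: convolution identities can be pulled back
  along coalgebra maps.\<close>

lemma conv_hom: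
  assumes "coalgebra_hom \<Delta>\<^sub>K \<epsilon>\<^sub>K \<Delta> \<epsilon> \<gamma>" "cbilinear f" "clinear F" "clinear G"
  shows "conv \<Delta>\<^sub>K f (F \<circ> \<gamma>) (G \<circ> \<gamma>) = conv \<Delta> f F G \<circ> \<gamma>"
  using sweedler2_hom[OF assms(1) cbilinear_compose2[OF assms(2-4)]]
  by (simp add: conv_def fun_eq_iff)

lemma coalgebra_hom_comp:
  assumes "coalgebra_hom \<Delta>\<^sub>K \<epsilon>\<^sub>K \<Delta>\<^sub>L \<epsilon>\<^sub>L \<gamma>" "coalgebra_hom \<Delta>\<^sub>L \<epsilon>\<^sub>L \<Delta> \<epsilon> \<eta>"
  shows "coalgebra_hom \<Delta>\<^sub>K \<epsilon>\<^sub>K \<Delta> \<epsilon> (\<eta> \<circ> \<gamma>)"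
proof -
  have "\<Delta> \<circ> (\<eta> \<circ> \<gamma>) = conv \<Delta>\<^sub>L (\<otimes>) \<eta> \<eta> \<circ> \<gamma>" "\<epsilon> \<circ> (\<eta> \<circ> \<gamma>) = \<epsilon>\<^sub>K"
    using assms by (simp_all add: coalgebra_hom_def flip: comp_assoc)
  then show ?thesis
    using assms conv_hom[OF assms(1) cbilinear_tens, of \<eta> \<eta>]
    by (simp add: coalgebra_hom_def)
qed

lemma coalgebra_hom_id: "coalgebra_hom \<Delta> \<epsilon> \<Delta> \<epsilon> (\<lambda>x. x)" if "clinear \<Delta>"
proof -
  have "tlift (\<otimes>) w = w" for w :: "('a, 'a) tensor"
    by (induction w rule: tensor_induct) (simp_all add: tlift_tens tlift_add tlift_scaleC)
  then show ?thesis
    by (simp add: coalgebra_hom_def fun_eq_iff conv_def sweedler2_def)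
qed

text \<open>The coalgebra only supplies the parameters of an identity and therefore carries no
  product. The counit law on the other side follows from cocommutativity.\<close>

locale cocommutative_coalgebra =
  fixes \<Delta> :: "'k::complex_vector \<Rightarrow> ('k, 'k) tensor"
    and \<epsilon> :: "'k \<Rightarrow> complex"
  assumes clinear_coproduct [simp, lin]: "clinear \<Delta>"
    and clinear_counit [simp]: "clinear \<epsilon>"
    and coassoc:
      "sweedler2 \<Delta> (\<lambda>h1 h2. h1 \<otimes> \<Delta> h2) h
        = sweedler2 \<Delta> (\<lambda>k h3. sweedler2 \<Delta> (\<lambda>h1 h2. h1 \<otimes> h2 \<otimes> h3) k) h"
    and counit_left: "sweedler2 \<Delta> (\<lambda>h1 h2. \<epsilon> h1 *\<^sub>C h2) h = h"
    and cocommutative: "cocommutative \<Delta>"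
begin

abbreviation kconv where "kconv \<equiv> conv \<Delta>"
abbreviation kcst where "kcst \<equiv> cst \<epsilon>"

lemma clinear_cop [lin]: "clinear f \<Longrightarrow> clinear (\<lambda>x. \<Delta> (f x))"
  by (rule clinear_compose[OF clinear_coproduct])

lemma clinear_eps [lin]: "clinear f \<Longrightarrow> clinear (\<lambda>x. \<epsilon> (f x))"
  by (rule clinear_compose[OF clinear_counit])

lemma clinear_kconv [simp]: "cbilinear f \<Longrightarrow> clinear F \<Longrightarrow> clinear G \<Longrightarrow> clinear (kconv f F G)"
  by (simp add: clinear_conv)

lemma clinear_kcst [simp]: "clinear (kcst x)"
  unfolding cst_def by (intro lin)

text \<open>The trilinear \<open>Q\<close> induces a linear map on the triple tensor product;
  applied to both sides of \<open>coassoc\<close> it gives coassociativity for arbitrary trilinear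
  summands.\<close>

lemma sweedler_assoc:
  assumes "\<And>a b. clinear (Q a b)" "\<And>a c. clinear (\<lambda>b. Q a b c)" "\<And>b c. clinear (\<lambda>a. Q a b c)"
  shows "sweedler2 \<Delta> (\<lambda>k c. sweedler2 \<Delta> (\<lambda>a b. Q a b c) k) h
    = sweedler2 \<Delta> (\<lambda>a k. sweedler2 \<Delta> (\<lambda>b c. Q a b c) k) h"
proof -
  let ?L = "tlift (\<lambda>a. tlift (Q a))"
  have b: "cbilinear (\<lambda>a. tlift (Q a))" by (intro lin assms)
  have b': "cbilinear (Q a)" for a by (intro lin assms)
  have "?L (sweedler2 \<Delta> (\<lambda>h1 h2. h1 \<otimes> \<Delta> h2) h) = sweedler2 \<Delta> (\<lambda>h1 h2. ?L (h1 \<otimes> \<Delta> h2)) h"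
    unfolding sweedler2_def by (rule tlift_compose) (intro lin assms)+
  moreover have "?L (sweedler2 \<Delta> (\<lambda>k h3. sweedler2 \<Delta> (\<lambda>h1 h2. h1 \<otimes> h2 \<otimes> h3) k) h)
      = sweedler2 \<Delta> (\<lambda>k h3. ?L (sweedler2 \<Delta> (\<lambda>h1 h2. h1 \<otimes> h2 \<otimes> h3) k)) h"
    unfolding sweedler2_def by (rule tlift_compose) (intro lin assms)+
  moreover have "?L (sweedler2 \<Delta> (\<lambda>h1 h2. h1 \<otimes> h2 \<otimes> h3) k)
      = sweedler2 \<Delta> (\<lambda>h1 h2. ?L (h1 \<otimes> h2 \<otimes> h3)) k" for h3 k
    unfolding sweedler2_def by (rule tlift_compose) (intro lin assms)+
  ultimately show ?thesis
    using coassoc[of h] by (simp add: tlift_tens b b' sweedler2_def)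
qed

lemma sweedler_comm:
  assumes "cbilinear Q"
  shows "sweedler2 \<Delta> Q h = sweedler2 \<Delta> (\<lambda>a b. Q b a) h"
proof -
  have "tlift Q (\<Delta> h) = tlift Q (sweedler2 \<Delta> (\<lambda>h1 h2. h2 \<otimes> h1) h)"
    using cocommutative by (simp add: cocommutative_def)
  also have "\<dots> = sweedler2 \<Delta> (\<lambda>h1 h2. tlift Q (h2 \<otimes> h1)) h"
    unfolding sweedler2_def by (rule tlift_compose) (intro lin clinear_tlift assms)+
  finally show ?thesis by (simp add: sweedler2_def tlift_tens assms)
qed

text \<open>The mixed associative law is required only at the values of \<open>F\<close>,
  \<open>G\<close> and \<open>H\<close>. It can thus be used with maps that obey such a law on a
  subspace, for instance forms that are balanced on the carrier.\<close>

lemma conv_assoc: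
  assumes "\<And>a b c. f (F a) (g (G b) (H c)) = f' (g' (F a) (G b)) (H c)"
    and "cbilinear f" "cbilinear g" "cbilinear f'" "cbilinear g'" "clinear F" "clinear G" "clinear H"
  shows "kconv f F (kconv g G H) = kconv f' (kconv g' F G) H"
proof
  fix k
  note l = assms(2-5)[THEN cbilinear_left] assms(2-5)[THEN cbilinear_right]
    assms(6-8)[THEN clinear_compose] assms(6-8) clinear_ident
  have "kconv f F (kconv g G H) k = sweedler2 \<Delta> (\<lambda>a k. sweedler2 \<Delta> (\<lambda>b c. f (F a) (g (G b) (H c))) k) k"
    unfolding conv_def sweedler2_def
    by (subst tlift_compose[where L = "f _"]) (intro lin l | rule refl)+
  also have "\<dots> = sweedler2 \<Delta> (\<lambda>k c. sweedler2 \<Delta> (\<lambda>a b. f (F a) (g (G b) (H c))) k) k"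
    by (rule sweedler_assoc[symmetric]) (intro l)+
  also have "\<dots> = kconv f' (kconv g' F G) H k"
    unfolding conv_def sweedler2_def assms(1)
    by (subst tlift_compose[where L = "\<lambda>x. f' x _"]) (intro lin l | rule refl)+
  finally show "kconv f F (kconv g G H) k = kconv f' (kconv g' F G) H k" .
qed

text \<open>Cocommutativity swaps the Sweedler factors and \<open>f'\<close> absorbs the swap of the
  arguments. Again only values matter, so a map with central values commutes with every other
  one.\<close>

lemma conv_comm:
  assumes "\<And>a b. f (F a) (G b) = f' (G b) (F a)" "cbilinear f" "clinear F" "clinear G"
  shows "kconv f F G = kconv f' G F"
  unfolding conv_def fun_eq_iff
  by (subst sweedler_comm[OF cbilinear_compose2[OF assms(2-)]]) (simp add: assms)

lemma conv_kcst_left: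
  assumes "cbilinear f" "clinear G"
  shows "kconv f (kcst x) G = f x \<circ> G"
proof
  fix k
  have l: "clinear (f x \<circ> G)" using assms by (simp add: cbilinear_def)
  have "(f x \<circ> G) (sweedler2 \<Delta> (\<lambda>h1 h2. \<epsilon> h1 *\<^sub>C h2) k) = sweedler2 \<Delta> (\<lambda>h1 h2. (f x \<circ> G) (\<epsilon> h1 *\<^sub>C h2)) k"
    unfolding sweedler2_def by (rule tlift_compose) (intro lin l)+
  then show "kconv f (kcst x) G k = (f x \<circ> G) k"
    using assms clinear_scaleC[OF l]
    by (simp add: counit_left conv_def cst_def cbilinear_def clinear_iff)
qed

lemma conv_kcst_right:
  assumes "cbilinear f" "clinear F"
  shows "kconv f F (kcst y) = (\<lambda>u. f u y) \<circ> F"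
proof -
  have "kconv f F (kcst y) = kconv (\<lambda>x y. f y x) (kcst y) F"
    using assms by (intro conv_comm) simp_all
  also have "\<dots> = (\<lambda>u. f u y) \<circ> F"
    using assms by (intro conv_kcst_left) (simp_all add: cbilinear_def)
  finally show ?thesis .
qed

text \<open>The middle-four interchange. Coassociativity isolates the two inner Sweedler factors and
  cocommutativity swaps them. The bilinear maps on the right may be unrelated to those on the left,
  since only the fourfold summands are compared.\<close>

lemma conv_interchange:
  assumes "\<And>a b c d. f (g (F a) (G b)) (g' (F' c) (G' d)) = f' (h (F a) (F' c)) (h' (G b) (G' d))"
    and "cbilinear f" "cbilinear g" "cbilinear g'" "cbilinear f'" "cbilinear h" "cbilinear h'"
    and "clinear F" "clinear G" "clinear F'" "clinear G'"
  shows "kconv f (kconv g F G) (kconv g' F' G') = kconv f' (kconv h F F') (kconv h' G G')"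
proof
  fix k
  let ?Q = "\<lambda>a b c d. f (g (F a) (G b)) (g' (F' c) (G' d))"
  have Q: "clinear (\<lambda>x. f (g (F x) (G b)) (g' (F' c) (G' d)))" "clinear (\<lambda>x. f (g (F a) (G x)) (g' (F' c) (G' d)))"
    "clinear (\<lambda>x. f (g (F a) (G b)) (g' (F' x) (G' d)))" "clinear (\<lambda>x. f (g (F a) (G b)) (g' (F' c) (G' x)))"
    for a b c d
    by (intro assms(2-7)[THEN cbilinear_left] assms(2-7)[THEN cbilinear_right] assms(8-))+
  have Qt: "clinear (\<lambda>a. sweedler2 \<Delta> (\<lambda>c d. f (g (F a) (G b)) (g' (F' c) (G' d))) y)"
    "clinear (\<lambda>b. sweedler2 \<Delta> (\<lambda>c d. f (g (F a) (G b)) (g' (F' c) (G' d))) y)"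
    "clinear (\<lambda>y. sweedler2 \<Delta> (\<lambda>c d. f (g (F a) (G b)) (g' (F' c) (G' d))) y)"
    "clinear (\<lambda>a. sweedler2 \<Delta> (\<lambda>b d. f (g (F a) (G b)) (g' (F' c) (G' d))) y)"
    "clinear (\<lambda>c. sweedler2 \<Delta> (\<lambda>b d. f (g (F a) (G b)) (g' (F' c) (G' d))) y)"
    "clinear (\<lambda>y. sweedler2 \<Delta> (\<lambda>b d. f (g (F a) (G b)) (g' (F' c) (G' d))) y)" for a b c y
    unfolding sweedler2_def by (intro lin Q)+
  \<comment> \<open>Stated for arbitrary maps because it also unfolds the right-hand side at the
    end.\<close>
  have split: "kconv f (kconv g F G) (kconv g' F' G') k
      = sweedler2 \<Delta> (\<lambda>x y. sweedler2 \<Delta> (\<lambda>a b. sweedler2 \<Delta> (\<lambda>c d. f (g (F a) (G b)) (g' (F' c) (G' d))) y) x) k"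
    if "cbilinear f" "cbilinear g" "cbilinear g'" "clinear F" "clinear G" "clinear F'" "clinear G'"
    for f g g' F G F' G' k
  proof -
    note l = that(1-3)[THEN cbilinear_left] that(1-3)[THEN cbilinear_right] that(4-) clinear_ident
    have "f (sweedler2 \<Delta> (\<lambda>a b. g (F a) (G b)) x) (sweedler2 \<Delta> (\<lambda>c d. g' (F' c) (G' d)) y)
       = sweedler2 \<Delta> (\<lambda>a b. sweedler2 \<Delta> (\<lambda>c d. f (g (F a) (G b)) (g' (F' c) (G' d))) y) x" for x y
    proof -
      have "f (sweedler2 \<Delta> (\<lambda>a b. g (F a) (G b)) x) (sweedler2 \<Delta> (\<lambda>c d. g' (F' c) (G' d)) y)
        = sweedler2 \<Delta> (\<lambda>a b. f (g (F a) (G b)) (sweedler2 \<Delta> (\<lambda>c d. g' (F' c) (G' d)) y)) x"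
        unfolding sweedler2_def
        by (rule tlift_compose[where L = "\<lambda>u. f u _"]) (intro cbilinearI l)+
      also have "\<dots> = sweedler2 \<Delta> (\<lambda>a b. sweedler2 \<Delta> (\<lambda>c d. f (g (F a) (G b)) (g' (F' c) (G' d))) y) x"
        unfolding sweedler2_def
        by (subst tlift_compose[where L = "f _"]) (intro cbilinearI l refl)+
      finally show ?thesis .
    qed
    then show ?thesis by (simp add: conv_def)
  qed
  \<comment> \<open>This is the place where the two inner arguments are exchanged.\<close>
  have mid: "sweedler2 \<Delta> (\<lambda>b z. sweedler2 \<Delta> (\<lambda>c d. ?Q a b c d) z) y
      = sweedler2 \<Delta> (\<lambda>c z. sweedler2 \<Delta> (\<lambda>b d. ?Q a b c d) z) y" for a y
  proof -
    have "sweedler2 \<Delta> (\<lambda>b z. sweedler2 \<Delta> (\<lambda>c d. ?Q a b c d) z) y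
        = sweedler2 \<Delta> (\<lambda>z d. sweedler2 \<Delta> (\<lambda>b c. ?Q a b c d) z) y"
      by (rule sweedler_assoc[symmetric]) (rule Q)+
    also have "\<dots> = sweedler2 \<Delta> (\<lambda>z d. sweedler2 \<Delta> (\<lambda>c b. ?Q a b c d) z) y"
      by (subst sweedler_comm, intro lin Q, rule refl)
    also have "\<dots> = sweedler2 \<Delta> (\<lambda>c z. sweedler2 \<Delta> (\<lambda>b d. ?Q a b c d) z) y"
      by (rule sweedler_assoc) (rule Q)+
    finally show ?thesis .
  qed
  have "kconv f (kconv g F G) (kconv g' F' G') k
      = sweedler2 \<Delta> (\<lambda>x y. sweedler2 \<Delta> (\<lambda>a b. sweedler2 \<Delta> (\<lambda>c d. ?Q a b c d) y) x) k"
    by (rule split) (rule assms)+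
  also have "\<dots> = sweedler2 \<Delta> (\<lambda>a y. sweedler2 \<Delta> (\<lambda>b z. sweedler2 \<Delta> (\<lambda>c d. ?Q a b c d) z) y) k"
    by (rule sweedler_assoc) (rule Qt)+
  also have "\<dots> = sweedler2 \<Delta> (\<lambda>a y. sweedler2 \<Delta> (\<lambda>c z. sweedler2 \<Delta> (\<lambda>b d. ?Q a b c d) z) y) k"
    by (simp only: mid)
  also have "\<dots> = sweedler2 \<Delta> (\<lambda>x y. sweedler2 \<Delta> (\<lambda>a c. sweedler2 \<Delta> (\<lambda>b d. ?Q a b c d) y) x) k"
    by (rule sweedler_assoc[symmetric]) (rule Qt)+
  also have "\<dots> = kconv f' (kconv h F F') (kconv h' G G') k"
    by (subst split) (rule assms | simp only: assms(1))+
  finally show "kconv f (kconv g F G) (kconv g' F' G') k = kconv f' (kconv h F F') (kconv h' G G') k" .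
qed

lemma sweedler_counit_left:
  assumes "clinear f" shows "sweedler2 \<Delta> (\<lambda>h1 h2. \<epsilon> h1 *\<^sub>C f h2) h = f h"
proof -
  have "f (sweedler2 \<Delta> (\<lambda>h1 h2. \<epsilon> h1 *\<^sub>C h2) h) = sweedler2 \<Delta> (\<lambda>h1 h2. f (\<epsilon> h1 *\<^sub>C h2)) h"
    unfolding sweedler2_def by (rule tlift_compose[OF assms]) (intro lin clinear_eps)
  then show ?thesis by (simp add: counit_left clinear_scaleC assms)
qed

lemma kmult_assoc:
  fixes F G H :: "'k \<Rightarrow> 'a::complex_algebra_1"
  assumes "clinear F" "clinear G" "clinear H"
  shows "kconv (*) (kconv (*) F G) H = kconv (*) F (kconv (*) G H)"
  by (rule conv_assoc[symmetric]) (simp_all add: assms mult.assoc)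

lemma kmult_one_left: "clinear F \<Longrightarrow> kconv (*) (kcst 1) F = (F :: 'k \<Rightarrow> 'a::complex_algebra_1)"
  and kmult_one_right: "clinear F \<Longrightarrow> kconv (*) F (kcst 1) = (F :: 'k \<Rightarrow> 'a::complex_algebra_1)"
  by (simp_all add: conv_kcst_left conv_kcst_right comp_def)

lemma kmult_central:
  fixes F G :: "'k \<Rightarrow> 'a::complex_algebra_1"
  assumes "range F \<subseteq> centre" "clinear F" "clinear G"
  shows "kconv (*) F G = kconv (*) G F"
  by (rule conv_comm) (use assms in \<open>auto simp: centre_def\<close>)

lemma conv_kcst_comp:
  "clinear f \<Longrightarrow> f \<circ> kcst x = kcst (f x)"
  by (simp add: cst_def fun_eq_iff clinear_scaleC)

lemma conv_kcst_kcst: "cbilinear f \<Longrightarrow> kconv f (kcst x) (kcst y) = kcst (f x y)"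
  by (simp add: conv_kcst_left conv_kcst_comp cbilinear_def)

text \<open>The coproduct of a point is \<open>\<gamma>\<close> in both places, so a rule with
  \<open>h1\<close> and \<open>h2\<close> on its right-hand side becomes one with
  \<open>\<gamma>\<close> twice. The measuring condition thus says that points act by algebra
  endomorphisms.\<close>

lemma conv_diag:
  fixes f :: "'h::complex_vector \<Rightarrow> 'v::complex_vector \<Rightarrow> 'w::complex_vector" and F :: "'k \<Rightarrow> 'x::complex_vector"
    and G :: "'k \<Rightarrow> 'y::complex_vector"
  assumes "\<And>h y z. f h (g y z) = sweedler2 \<Delta>' (\<lambda>h1 h2. f' (p h1 y) (q h2 z)) h"
    and "coalgebra_hom \<Delta> \<epsilon> \<Delta>' \<epsilon>' \<gamma>" "clinear \<Delta>'"
    and "cbilinear f" "cbilinear g" "cbilinear f'" "cbilinear p" "cbilinear q" "clinear F" "clinear G"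
  shows "kconv f \<gamma> (kconv g F G) = kconv f' (kconv p \<gamma> F) (kconv q \<gamma> G)"
proof -
  \<comment> \<open>The right-hand side of the rule as a bilinear map of the coproduct of
    \<open>h\<close> and the pair \<open>y \<otimes> z\<close>; in this shape the claim is an
    instance of the interchange law.\<close>
  define M where "M = (\<lambda>u w. tlift (\<lambda>h1 h2. tlift (\<lambda>y z. f' (p h1 y) (q h2 z)) w) u)"
  note l = assms(4-8)[THEN cbilinear_left] assms(4-8)[THEN cbilinear_right] clinear_ident
  have \<gamma>: "clinear \<gamma>" using assms(2) by (rule coalgebra_hom_clinear)
  have M: "cbilinear M" unfolding M_def by (intro lin l)
  have M_tens: "M (h1 \<otimes> h2) (y \<otimes> z) = f' (p h1 y) (q h2 z)" for h1 h2 y z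
    unfolding M_def by (subst tlift_tens, (intro lin l)+)+ (rule refl)
  have "(\<lambda>w. f h (tlift g w)) = M (\<Delta>' h)" for h
  proof (rule clinear_tensor_eqI)
    show "clinear (\<lambda>w. f h (tlift g w))" by (intro lin l)
    show "clinear (M (\<Delta>' h))" using M by (simp add: cbilinear_def)
    show "f h (tlift g (a \<otimes> b)) = M (\<Delta>' h) (a \<otimes> b)" for a b
      unfolding M_def
      by (subst (2) tlift_tens, (intro lin l)+) (simp add: tlift_tens assms(1,5) sweedler2_def)
  qed
  then have "kconv f \<gamma> (kconv g F G) = kconv M (\<Delta>' \<circ> \<gamma>) (kconv (\<otimes>) F G)"
    by (subst conv_tens[OF assms(5,9,10)]) (simp add: conv_def fun_eq_iff)
  also have "\<dots> = kconv M (kconv (\<otimes>) \<gamma> \<gamma>) (kconv (\<otimes>) F G)"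
    using assms(2) by (simp add: coalgebra_hom_def)
  also have "\<dots> = kconv f' (kconv p \<gamma> F) (kconv q \<gamma> G)"
    by (rule conv_interchange) (simp_all add: M_tens M assms \<gamma>)
  finally show ?thesis .
qed

lemma coalgebra_hom_kcst:
  assumes "clinear \<Delta>'" "\<Delta>' x = x \<otimes> x" "clinear \<epsilon>'" "\<epsilon>' x = 1"
  shows "coalgebra_hom \<Delta> \<epsilon> \<Delta>' \<epsilon>' (kcst x)"
  unfolding coalgebra_hom_def using assms
  by (simp add: conv_kcst_comp conv_kcst_kcst) (simp add: cst_def scaleC_complex_def)

text \<open>If the coaction on \<open>X\<close> is given by the point \<open>\<gamma>\<close>, a sum
  over this coaction is one more convolution factor \<open>\<gamma>\<close>.\<close>

lemma conv_coact:
  assumes "\<delta> \<circ> X = kconv (\<otimes>) X \<gamma>" "clinear \<delta>" "cbilinear f1" "cbilinear f2"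
    and "clinear X" "clinear \<gamma>" "clinear Y"
  shows "kconv (\<lambda>u v. tlift (\<lambda>u0 h. f1 u0 (f2 h v)) (\<delta> u)) X Y = kconv f1 X (kconv f2 \<gamma> Y)"
proof -
  note l = assms(3,4)[THEN cbilinear_left] assms(3,4)[THEN cbilinear_right] clinear_ident
  have "kconv (\<lambda>u v. tlift (\<lambda>u0 h. f1 u0 (f2 h v)) (\<delta> u)) X Y
      = kconv (\<lambda>w v. tlift (\<lambda>u0 h. f1 u0 (f2 h v)) w) (\<delta> \<circ> X) Y"
    by (simp add: conv_def)
  also have "\<dots> = kconv f1 X (kconv f2 \<gamma> Y)"
    unfolding assms(1)
  proof (rule conv_assoc[symmetric])
    show "f1 (X a) (f2 (\<gamma> b) (Y c)) = tlift (\<lambda>u0 h. f1 u0 (f2 h (Y c))) (X a \<otimes> \<gamma> b)" for a b c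
      by (subst tlift_tens) (intro lin l refl)+
    show "cbilinear (\<lambda>w v. tlift (\<lambda>u0 h. f1 u0 (f2 h v)) w)"
      by (intro lin l)
  qed (simp_all add: assms)
  finally show ?thesis .
qed

lemma conv_coact':
  assumes "\<delta> \<circ> X = kconv (\<otimes>) X \<gamma>" "clinear \<delta>" "cbilinear f1" "cbilinear f2"
    and "clinear X" "clinear \<gamma>" "clinear Y"
  shows "kconv (\<lambda>u v. tlift (\<lambda>u0 h. f1 h (f2 u0 v)) (\<delta> u)) X Y = kconv f1 \<gamma> (kconv f2 X Y)"
proof -
  note l = assms(3,4)[THEN cbilinear_left] assms(3,4)[THEN cbilinear_right] clinear_ident
  have "tlift (\<lambda>u0 h. f1 h (f2 u0 v)) w = tlift (\<lambda>h u0. f1 h (f2 u0 v)) (tswap w)" for v w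
  proof (induction w rule: tensor_induct)
    case (tens a b)
    show ?case unfolding tswap_tens by (subst (1 2) tlift_tens) (intro lin l refl)+
  qed (simp_all add: clinear_add[OF clinear_tswap] clinear_scaleC[OF clinear_tswap],
      (subst (1 2) tlift_add tlift_scaleC, (intro lin l)+, simp)+)
  then have "kconv (\<lambda>u v. tlift (\<lambda>u0 h. f1 h (f2 u0 v)) (\<delta> u)) X Y
      = kconv (\<lambda>w v. tlift (\<lambda>h u0. f1 h (f2 u0 v)) w) (tswap \<circ> (\<delta> \<circ> X)) Y"
    by (simp add: conv_def)
  also have "tswap \<circ> (\<delta> \<circ> X) = kconv (\<otimes>) \<gamma> X"
    unfolding assms(1) by (subst conv_compose) (simp_all add: assms, rule conv_comm, simp_all add: assms, intro lin)
  also have "kconv (\<lambda>w v. tlift (\<lambda>h u0. f1 h (f2 u0 v)) w) (kconv (\<otimes>) \<gamma> X) Y = kconv f1 \<gamma> (kconv f2 X Y)"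
  proof (rule conv_assoc[symmetric])
    show "f1 (\<gamma> a) (f2 (X b) (Y c)) = tlift (\<lambda>h u0. f1 h (f2 u0 (Y c))) (\<gamma> a \<otimes> X b)" for a b c
      by (subst tlift_tens) (intro lin l refl)+
    show "cbilinear (\<lambda>w v. tlift (\<lambda>h u0. f1 h (f2 u0 v)) w)"
      by (intro lin l)
  qed (simp_all add: assms)
  finally show ?thesis .
qed

end

section \<open>Tensor products of coalgebras\<close>

definition tensor_coproduct ::
    "('k::complex_vector \<Rightarrow> ('k, 'k) tensor) \<Rightarrow> ('l::complex_vector \<Rightarrow> ('l, 'l) tensor)
      \<Rightarrow> ('k, 'l) tensor \<Rightarrow> (('k, 'l) tensor, ('k, 'l) tensor) tensor" where
  "tensor_coproduct \<Delta> \<Delta>' = tlift (\<lambda>h g.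
     sweedler2 \<Delta> (\<lambda>h1 h2. sweedler2 \<Delta>' (\<lambda>g1 g2. (h1 \<otimes> g1) \<otimes> (h2 \<otimes> g2)) g) h)"

definition tensor_counit ::
    "('k::complex_vector \<Rightarrow> complex) \<Rightarrow> ('l::complex_vector \<Rightarrow> complex) \<Rightarrow> ('k, 'l) tensor \<Rightarrow> complex" where
  "tensor_counit \<epsilon> \<epsilon>' = tlift (\<lambda>h g. \<epsilon> h * \<epsilon>' g)"

definition tensor_fst :: "('l::complex_vector \<Rightarrow> complex) \<Rightarrow> ('k::complex_vector, 'l) tensor \<Rightarrow> 'k" where
  "tensor_fst \<epsilon>' = tlift (\<lambda>h g. \<epsilon>' g *\<^sub>C h)"

definition tensor_snd :: "('k::complex_vector \<Rightarrow> complex) \<Rightarrow> ('k, 'l::complex_vector) tensor \<Rightarrow> 'l" where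
  "tensor_snd \<epsilon> = tlift (\<lambda>h g. \<epsilon> h *\<^sub>C g)"

locale coalgebra_pair =
  K: cocommutative_coalgebra \<Delta> \<epsilon> + L: cocommutative_coalgebra \<Delta>' \<epsilon>'
  for \<Delta> :: "'k::complex_vector \<Rightarrow> ('k, 'k) tensor" and \<epsilon> :: "'k \<Rightarrow> complex"
    and \<Delta>' :: "'l::complex_vector \<Rightarrow> ('l, 'l) tensor" and \<epsilon>' :: "'l \<Rightarrow> complex"
begin

abbreviation \<Delta>\<Delta> where "\<Delta>\<Delta> \<equiv> tensor_coproduct \<Delta> \<Delta>'"
abbreviation \<epsilon>\<epsilon> where "\<epsilon>\<epsilon> \<equiv> tensor_counit \<epsilon> \<epsilon>'"
abbreviation p1 where "p1 \<equiv> tensor_fst \<epsilon>'"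
abbreviation p2 where "p2 \<equiv> tensor_snd \<epsilon>"

lemma cbilinear_coproduct_tens: "cbilinear (\<lambda>h g.
     sweedler2 \<Delta> (\<lambda>h1 h2. sweedler2 \<Delta>' (\<lambda>g1 g2. (h1 \<otimes> g1) \<otimes> (h2 \<otimes> g2)) g) h)"
  unfolding sweedler2_def by (intro lin K.clinear_cop L.clinear_cop)

lemma clinear_tensor_coproduct: "clinear \<Delta>\<Delta>"
  unfolding tensor_coproduct_def by (rule clinear_tlift[OF cbilinear_coproduct_tens])

lemma clinear_tensor_counit: "clinear \<epsilon>\<epsilon>"
  unfolding tensor_counit_def by (intro lin K.clinear_eps L.clinear_eps)

lemma tensor_counit_tens: "\<epsilon>\<epsilon> (h \<otimes> g) = \<epsilon> h * \<epsilon>' g"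
  unfolding tensor_counit_def by (subst tlift_tens) (intro lin K.clinear_eps L.clinear_eps refl)+

lemma clinear_fst: "clinear p1" and fst_tens: "p1 (h \<otimes> g) = \<epsilon>' g *\<^sub>C h"
  unfolding tensor_fst_def by (intro lin L.clinear_eps, subst tlift_tens, intro lin L.clinear_eps, rule refl)

lemma clinear_snd: "clinear p2" and snd_tens: "p2 (h \<otimes> g) = \<epsilon> h *\<^sub>C g"
  unfolding tensor_snd_def by (intro lin K.clinear_eps, subst tlift_tens, intro lin K.clinear_eps, rule refl)

text \<open>Conditions on two elements of H, written as double sums, become conditions on
  convolutions over the product coalgebra.\<close>

lemma sweedler2_tens:
  assumes "cbilinear F"
  shows "sweedler2 \<Delta>\<Delta> F (h \<otimes> g)
    = sweedler2 \<Delta> (\<lambda>h1 h2. sweedler2 \<Delta>' (\<lambda>g1 g2. F (h1 \<otimes> g1) (h2 \<otimes> g2)) g) h"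
proof -
  have "sweedler2 \<Delta>\<Delta> F (h \<otimes> g) = tlift F (sweedler2 \<Delta> (\<lambda>h1 h2. sweedler2 \<Delta>' (\<lambda>g1 g2. (h1 \<otimes> g1) \<otimes> (h2 \<otimes> g2)) g) h)"
    by (simp add: sweedler2_def tensor_coproduct_def tlift_tens[OF cbilinear_coproduct_tens[unfolded sweedler2_def]])
  also have "\<dots> = sweedler2 \<Delta> (\<lambda>h1 h2. tlift F (sweedler2 \<Delta>' (\<lambda>g1 g2. (h1 \<otimes> g1) \<otimes> (h2 \<otimes> g2)) g)) h"
    unfolding sweedler2_def by (rule tlift_compose[OF clinear_tlift[OF assms]]) (intro lin)
  also have "\<dots> = sweedler2 \<Delta> (\<lambda>h1 h2. sweedler2 \<Delta>' (\<lambda>g1 g2. tlift F ((h1 \<otimes> g1) \<otimes> (h2 \<otimes> g2))) g) h"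
    unfolding sweedler2_def by (subst tlift_compose[OF clinear_tlift[OF assms]]) (intro lin refl)+
  finally show ?thesis by (simp add: tlift_tens assms)
qed

lemma sweedler_swap:
  assumes "\<And>a b. cbilinear (\<lambda>c d. F a b c d)" "\<And>c d. cbilinear (\<lambda>a b. F a b c d)"
  shows "sweedler2 \<Delta>' (\<lambda>c d. sweedler2 \<Delta> (\<lambda>a b. F a b c d) h) g
    = sweedler2 \<Delta> (\<lambda>a b. sweedler2 \<Delta>' (\<lambda>c d. F a b c d) g) h"
  unfolding sweedler2_def by (rule tlift_swap) (rule assms)+

text \<open>The sums over the two factors are separated by exchanging independent sums, reassociated
  one after the other, and merged again.\<close>

lemma tensor_coassoc:
  "sweedler2 \<Delta>\<Delta> (\<lambda>h1 h2. h1 \<otimes> \<Delta>\<Delta> h2) w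
    = sweedler2 \<Delta>\<Delta> (\<lambda>k h3. sweedler2 \<Delta>\<Delta> (\<lambda>h1 h2. h1 \<otimes> h2 \<otimes> h3) k) w"
proof -
  note cop = K.clinear_cop L.clinear_cop clinear_compose[OF clinear_tensor_coproduct]
  let ?T = "\<lambda>h1 h2 h3 g1 g2 g3. (h1 \<otimes> g1) \<otimes> (h2 \<otimes> g2) \<otimes> (h3 \<otimes> g3)"
  have "sweedler2 \<Delta>\<Delta> (\<lambda>h1 h2. h1 \<otimes> \<Delta>\<Delta> h2) = sweedler2 \<Delta>\<Delta> (\<lambda>k h3. sweedler2 \<Delta>\<Delta> (\<lambda>h1 h2. h1 \<otimes> h2 \<otimes> h3) k)"
  proof (rule clinear_tensor_eqI)
    show "clinear (sweedler2 \<Delta>\<Delta> (\<lambda>h1 h2. h1 \<otimes> \<Delta>\<Delta> h2))"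
      unfolding sweedler2_def by (intro lin cop)
    show "clinear (sweedler2 \<Delta>\<Delta> (\<lambda>k h3. sweedler2 \<Delta>\<Delta> (\<lambda>h1 h2. h1 \<otimes> h2 \<otimes> h3) k))"
      unfolding sweedler2_def by (intro lin cop)
    fix h g
    have "sweedler2 \<Delta>\<Delta> (\<lambda>h1 h2. h1 \<otimes> \<Delta>\<Delta> h2) (h \<otimes> g)
      = sweedler2 \<Delta> (\<lambda>h1 k. sweedler2 \<Delta>' (\<lambda>g1 l. (h1 \<otimes> g1) \<otimes> \<Delta>\<Delta> (k \<otimes> l)) g) h"
      by (rule sweedler2_tens) (intro lin cop)
    also have "(\<lambda>h1 k g1 l. (h1 \<otimes> g1) \<otimes> \<Delta>\<Delta> (k \<otimes> l)) = (\<lambda>h1 k g1 l.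
        sweedler2 \<Delta> (\<lambda>h2 h3. sweedler2 \<Delta>' (\<lambda>g2 g3. ?T h1 h2 h3 g1 g2 g3) l) k)"
      unfolding sweedler2_def fun_eq_iff tensor_coproduct_def
      apply (subst tlift_tens, intro lin cop)
      apply (subst tlift_compose[where L = "\<lambda>x. _ \<otimes> x"], (intro lin cop)+)
      apply (subst tlift_compose[where L = "\<lambda>x. _ \<otimes> x"], (intro lin cop)+)
      apply simp
      done
    also have "sweedler2 \<Delta> (\<lambda>h1 k. sweedler2 \<Delta>' (\<lambda>g1 l. 
        sweedler2 \<Delta> (\<lambda>h2 h3. sweedler2 \<Delta>' (\<lambda>g2 g3. ?T h1 h2 h3 g1 g2 g3) l) k) g) h
      = sweedler2 \<Delta> (\<lambda>h1 k. sweedler2 \<Delta> (\<lambda>h2 h3.  sweedler2 \<Delta>' (\<lambda>g1 l. 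
         sweedler2 \<Delta>' (\<lambda>g2 g3. ?T h1 h2 h3 g1 g2 g3) l) g) k) h"
      by (subst sweedler_swap) (unfold sweedler2_def, (intro lin cop refl)+)
    also have "\<dots> = sweedler2 \<Delta> (\<lambda>h1 k. sweedler2 \<Delta> (\<lambda>h2 h3.  sweedler2 \<Delta>' (\<lambda>l g3. 
         sweedler2 \<Delta>' (\<lambda>g1 g2. ?T h1 h2 h3 g1 g2 g3) l) g) k) h"
      by (subst L.sweedler_assoc) (unfold sweedler2_def, (intro lin cop refl)+)
    also have "\<dots> = sweedler2 \<Delta> (\<lambda>k h3. sweedler2 \<Delta> (\<lambda>h1 h2.  sweedler2 \<Delta>' (\<lambda>l g3. 
         sweedler2 \<Delta>' (\<lambda>g1 g2. ?T h1 h2 h3 g1 g2 g3) l) g) k) h"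
      by (rule K.sweedler_assoc[symmetric]) (unfold sweedler2_def, (intro lin cop)+)
    also have "\<dots> = sweedler2 \<Delta> (\<lambda>k h3. sweedler2 \<Delta>' (\<lambda>l g3. sweedler2 \<Delta> (\<lambda>h1 h2. 
         sweedler2 \<Delta>' (\<lambda>g1 g2. ?T h1 h2 h3 g1 g2 g3) l) k) g) h"
      by (subst sweedler_swap) (unfold sweedler2_def, (intro lin cop refl)+)
    also have "\<dots> = sweedler2 \<Delta> (\<lambda>k h3. sweedler2 \<Delta>' (\<lambda>l g3. sweedler2 \<Delta>\<Delta> (\<lambda>x y. x \<otimes> y \<otimes> (h3 \<otimes> g3)) (k \<otimes> l)) g) h"
      by (subst sweedler2_tens) (intro lin refl)+
    also have "\<dots> = sweedler2 \<Delta>\<Delta> (\<lambda>k h3. sweedler2 \<Delta>\<Delta> (\<lambda>h1 h2. h1 \<otimes> h2 \<otimes> h3) k) (h \<otimes> g)"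
      by (rule sweedler2_tens[symmetric]) (unfold sweedler2_def, intro lin cop)
    finally show "sweedler2 \<Delta>\<Delta> (\<lambda>h1 h2. h1 \<otimes> \<Delta>\<Delta> h2) (h \<otimes> g)
      = sweedler2 \<Delta>\<Delta> (\<lambda>k h3. sweedler2 \<Delta>\<Delta> (\<lambda>h1 h2. h1 \<otimes> h2 \<otimes> h3) k) (h \<otimes> g)" .
  qed
  then show ?thesis by (simp add: fun_eq_iff)
qed

lemma tensor_coalgebra: "cocommutative_coalgebra \<Delta>\<Delta> \<epsilon>\<epsilon>"
proof (rule cocommutative_coalgebra.intro)
  note cop = K.clinear_cop L.clinear_cop clinear_compose[OF clinear_tensor_coproduct]
    clinear_compose[OF clinear_tensor_counit]
  have "sweedler2 \<Delta>\<Delta> (\<lambda>h1 h2. \<epsilon>\<epsilon> h1 *\<^sub>C h2) = (\<lambda>x. x)"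
  proof (rule clinear_tensor_eqI)
    show "clinear (sweedler2 \<Delta>\<Delta> (\<lambda>h1 h2. \<epsilon>\<epsilon> h1 *\<^sub>C h2))"
      unfolding sweedler2_def by (intro lin cop)
    fix h g
    have "sweedler2 \<Delta>\<Delta> (\<lambda>h1 h2. \<epsilon>\<epsilon> h1 *\<^sub>C h2) (h \<otimes> g)
      = sweedler2 \<Delta> (\<lambda>h1 h2. sweedler2 \<Delta>' (\<lambda>g1 g2. \<epsilon>\<epsilon> (h1 \<otimes> g1) *\<^sub>C (h2 \<otimes> g2)) g) h"
      by (rule sweedler2_tens) (intro lin cop)
    also have "\<dots> = sweedler2 \<Delta> (\<lambda>h1 h2. sweedler2 \<Delta>' (\<lambda>g1 g2. (\<epsilon> h1 *\<^sub>C h2) \<otimes> (\<epsilon>' g1 *\<^sub>C g2)) g) h"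
      by (simp add: tensor_counit_tens tens_scaleC_left tens_scaleC_right scaleC_scaleC mult.commute)
    also have "\<dots> = sweedler2 \<Delta> (\<lambda>h1 h2. (\<epsilon> h1 *\<^sub>C h2) \<otimes> sweedler2 \<Delta>' (\<lambda>g1 g2. \<epsilon>' g1 *\<^sub>C g2) g) h"
      unfolding sweedler2_def
      by (subst tlift_compose[where L = "\<lambda>x. _ \<otimes> x"]) (intro lin L.clinear_eps refl)+
    also have "\<dots> = sweedler2 \<Delta> (\<lambda>h1 h2. \<epsilon> h1 *\<^sub>C h2) h \<otimes> g"
      unfolding L.counit_left unfolding sweedler2_def
      by (rule tlift_compose[where L = "\<lambda>x. x \<otimes> _", symmetric]) (intro lin K.clinear_eps)+
    finally show "sweedler2 \<Delta>\<Delta> (\<lambda>h1 h2. \<epsilon>\<epsilon> h1 *\<^sub>C h2) (h \<otimes> g) = h \<otimes> g"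
      by (simp add: K.counit_left)
  qed simp
  then show "sweedler2 \<Delta>\<Delta> (\<lambda>h1 h2. \<epsilon>\<epsilon> h1 *\<^sub>C h2) w = w" for w
    by (simp add: fun_eq_iff)
  have "sweedler2 \<Delta>\<Delta> (\<lambda>h1 h2. h2 \<otimes> h1) = \<Delta>\<Delta>"
  proof (rule clinear_tensor_eqI[OF _ clinear_tensor_coproduct])
    show "clinear (sweedler2 \<Delta>\<Delta> (\<lambda>h1 h2. h2 \<otimes> h1))"
      unfolding sweedler2_def by (intro lin cop)
    fix h g
    have "sweedler2 \<Delta>\<Delta> (\<lambda>h1 h2. h2 \<otimes> h1) (h \<otimes> g)
      = sweedler2 \<Delta> (\<lambda>h1 h2. sweedler2 \<Delta>' (\<lambda>g1 g2. (h2 \<otimes> g2) \<otimes> (h1 \<otimes> g1)) g) h"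
      by (rule sweedler2_tens) (intro lin cop)
    also have "\<dots> = sweedler2 \<Delta> (\<lambda>h1 h2. sweedler2 \<Delta>' (\<lambda>g1 g2. (h2 \<otimes> g1) \<otimes> (h1 \<otimes> g2)) g) h"
      by (subst L.sweedler_comm) (intro lin refl)+
    also have "\<dots> = sweedler2 \<Delta> (\<lambda>h1 h2. sweedler2 \<Delta>' (\<lambda>g1 g2. (h1 \<otimes> g1) \<otimes> (h2 \<otimes> g2)) g) h"
      by (rule K.sweedler_comm) (unfold sweedler2_def, intro lin)
    finally show "sweedler2 \<Delta>\<Delta> (\<lambda>h1 h2. h2 \<otimes> h1) (h \<otimes> g) = \<Delta>\<Delta> (h \<otimes> g)"
      unfolding tensor_coproduct_def by (subst tlift_tens[OF cbilinear_coproduct_tens])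
  qed
  then show "cocommutative \<Delta>\<Delta>"
    by (simp add: cocommutative_def fun_eq_iff)
qed (fact clinear_tensor_coproduct clinear_tensor_counit tensor_coassoc)+

text \<open>In the second factor the projection contributes only a counit, so the sum over
  \<open>\<Delta>'\<close> disappears.\<close>

lemma conv_fst_right:
  assumes "cbilinear f" "clinear X" "clinear Y"
  shows "conv \<Delta>\<Delta> f X (Y \<circ> p1) (h \<otimes> g) = sweedler2 \<Delta> (\<lambda>h1 h2. f (X (h1 \<otimes> g)) (Y h2)) h"
proof -
  note l = assms(1)[THEN cbilinear_left] assms(1)[THEN cbilinear_right]
    assms(2,3)[THEN clinear_compose] clinear_compose[OF clinear_fst]
  have "conv \<Delta>\<Delta> f X (Y \<circ> p1) (h \<otimes> g)
      = sweedler2 \<Delta> (\<lambda>h1 h2. sweedler2 \<Delta>' (\<lambda>g1 g2. f (X (h1 \<otimes> g1)) (Y (p1 (h2 \<otimes> g2)))) g) h"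
    unfolding conv_def comp_def by (rule sweedler2_tens) (intro lin l)
  also have "\<dots> = sweedler2 \<Delta> (\<lambda>h1 h2. sweedler2 \<Delta>' (\<lambda>g1 g2. \<epsilon>' g2 *\<^sub>C f (X (h1 \<otimes> g1)) (Y h2)) g) h"
    by (simp add: fst_tens clinear_scaleC[OF assms(2)] clinear_scaleC[OF assms(3)] bilinear_scaleC_left[OF assms(1)]
        bilinear_scaleC_right[OF assms(1)])
  also have "\<dots> = sweedler2 \<Delta> (\<lambda>h1 h2. sweedler2 \<Delta>' (\<lambda>g1 g2. \<epsilon>' g1 *\<^sub>C f (X (h1 \<otimes> g2)) (Y h2)) g) h"
    by (subst L.sweedler_comm) (intro lin l L.clinear_eps refl)+
  also have "\<dots> = sweedler2 \<Delta> (\<lambda>h1 h2. f (X (h1 \<otimes> g)) (Y h2)) h"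
    by (subst L.sweedler_counit_left) (intro lin l refl)+
  finally show ?thesis .
qed

lemma conv_snd_right:
  assumes "cbilinear f" "clinear X" "clinear Y"
  shows "conv \<Delta>\<Delta> f X (Y \<circ> p2) (h \<otimes> g) = sweedler2 \<Delta>' (\<lambda>g1 g2. f (X (h \<otimes> g1)) (Y g2)) g"
proof -
  note l = assms(1)[THEN cbilinear_left] assms(1)[THEN cbilinear_right]
    assms(2,3)[THEN clinear_compose] clinear_compose[OF clinear_snd]
  have "conv \<Delta>\<Delta> f X (Y \<circ> p2) (h \<otimes> g)
      = sweedler2 \<Delta> (\<lambda>h1 h2. sweedler2 \<Delta>' (\<lambda>g1 g2. f (X (h1 \<otimes> g1)) (Y (p2 (h2 \<otimes> g2)))) g) h"
    unfolding conv_def comp_def by (rule sweedler2_tens) (intro lin l)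
  also have "\<dots> = sweedler2 \<Delta>' (\<lambda>g1 g2. sweedler2 \<Delta> (\<lambda>h1 h2. f (X (h1 \<otimes> g1)) (Y (p2 (h2 \<otimes> g2)))) h) g"
    by (rule sweedler_swap[symmetric]) (intro lin l)+
  also have "\<dots> = sweedler2 \<Delta>' (\<lambda>g1 g2. sweedler2 \<Delta> (\<lambda>h1 h2. \<epsilon> h2 *\<^sub>C f (X (h1 \<otimes> g1)) (Y g2)) h) g"
    by (simp add: snd_tens clinear_scaleC[OF assms(3)] bilinear_scaleC_right[OF assms(1)])
  also have "\<dots> = sweedler2 \<Delta>' (\<lambda>g1 g2. sweedler2 \<Delta> (\<lambda>h1 h2. \<epsilon> h1 *\<^sub>C f (X (h2 \<otimes> g1)) (Y g2)) h) g"
    by (subst K.sweedler_comm) (intro lin l K.clinear_eps refl)+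
  also have "\<dots> = sweedler2 \<Delta>' (\<lambda>g1 g2. f (X (h \<otimes> g1)) (Y g2)) g"
    by (subst K.sweedler_counit_left) (intro lin l refl)+
  finally show ?thesis .
qed

text \<open>Maps pulled back along the two projections have separated variables. This turns an
  identity between points back into an identity between elements.\<close>

lemma conv_fst_snd:
  assumes "cbilinear f" "clinear X" "clinear Y"
  shows "conv \<Delta>\<Delta> f (X \<circ> p1) (Y \<circ> p2) (h \<otimes> g) = f (X h) (Y g)"
proof -
  note l = assms(1)[THEN cbilinear_left] assms(1)[THEN cbilinear_right]
    assms(2,3)[THEN clinear_compose]
  have "conv \<Delta>\<Delta> f (X \<circ> p1) (Y \<circ> p2) (h \<otimes> g) = sweedler2 \<Delta>' (\<lambda>g1 g2. f ((X \<circ> p1) (h \<otimes> g1)) (Y g2)) g"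
    by (rule conv_snd_right) (simp_all add: assms clinear_fst)
  also have "\<dots> = sweedler2 \<Delta>' (\<lambda>g1 g2. \<epsilon>' g1 *\<^sub>C f (X h) (Y g2)) g"
    by (simp add: fst_tens clinear_scaleC[OF assms(2)] clinear_scaleC[OF assms(3)] bilinear_scaleC_left[OF assms(1)]
        bilinear_scaleC_right[OF assms(1)])
  also have "\<dots> = f (X h) (Y g)"
    by (rule L.sweedler_counit_left) (intro lin l)
  finally show ?thesis .
qed

lemma hom_fst: "coalgebra_hom \<Delta>\<Delta> \<epsilon>\<epsilon> \<Delta> \<epsilon> p1"
  unfolding coalgebra_hom_def
proof (intro conjI clinear_tensor_eqI)
  show "clinear p1" "clinear (\<Delta> \<circ> p1)" "clinear (\<epsilon> \<circ> p1)" "clinear \<epsilon>\<epsilon>"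
    "clinear (conv \<Delta>\<Delta> (\<otimes>) p1 p1)"
    by (simp_all add: clinear_conv clinear_tensor_coproduct clinear_fst clinear_tensor_counit)
  fix h g
  \<comment> \<open>The second \<open>p1\<close> is written as a composition with the identity to
    match \<open>conv_fst_right\<close>.\<close>
  have "conv \<Delta>\<Delta> (\<otimes>) p1 ((\<lambda>x. x) \<circ> p1) (h \<otimes> g) = sweedler2 \<Delta> (\<lambda>h1 h2. p1 (h1 \<otimes> g) \<otimes> h2) h"
    by (rule conv_fst_right) (simp_all add: clinear_fst)
  also have "\<dots> = \<epsilon>' g *\<^sub>C sweedler2 \<Delta> (\<lambda>h1 h2. h1 \<otimes> h2) h"
    unfolding fst_tens tens_scaleC_left unfolding sweedler2_def
    by (rule tlift_compose[symmetric]) (intro lin)+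
  also have "sweedler2 \<Delta> (\<lambda>h1 h2. h1 \<otimes> h2) h = \<Delta> h"
    using coalgebra_hom_id[OF K.clinear_coproduct, of \<epsilon>] by (simp add: coalgebra_hom_def conv_def fun_eq_iff)
  finally show "(\<Delta> \<circ> p1) (h \<otimes> g) = conv \<Delta>\<Delta> (\<otimes>) p1 p1 (h \<otimes> g)"
    by (simp add: comp_def fst_tens clinear_scaleC)
  show "(\<epsilon> \<circ> p1) (h \<otimes> g) = \<epsilon>\<epsilon> (h \<otimes> g)"
    by (simp add: tensor_counit_tens fst_tens clinear_scaleC[OF K.clinear_counit] scaleC_complex_def mult.commute)
qed

lemma hom_snd: "coalgebra_hom \<Delta>\<Delta> \<epsilon>\<epsilon> \<Delta>' \<epsilon>' p2"
  unfolding coalgebra_hom_def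
proof (intro conjI clinear_tensor_eqI)
  show "clinear p2" "clinear (\<Delta>' \<circ> p2)" "clinear (\<epsilon>' \<circ> p2)" "clinear \<epsilon>\<epsilon>"
    "clinear (conv \<Delta>\<Delta> (\<otimes>) p2 p2)"
    by (simp_all add: clinear_conv clinear_tensor_coproduct clinear_snd clinear_tensor_counit)
  fix h g
  have "conv \<Delta>\<Delta> (\<otimes>) p2 ((\<lambda>x. x) \<circ> p2) (h \<otimes> g) = sweedler2 \<Delta>' (\<lambda>h1 h2. p2 (h \<otimes> h1) \<otimes> h2) g"
    by (rule conv_snd_right) (simp_all add: clinear_snd)
  also have "\<dots> = \<epsilon> h *\<^sub>C sweedler2 \<Delta>' (\<lambda>h1 h2. h1 \<otimes> h2) g"
    unfolding snd_tens tens_scaleC_left unfolding sweedler2_def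
    by (rule tlift_compose[symmetric]) (intro lin)+
  also have "sweedler2 \<Delta>' (\<lambda>h1 h2. h1 \<otimes> h2) g = \<Delta>' g"
    using coalgebra_hom_id[OF L.clinear_coproduct, of \<epsilon>'] by (simp add: coalgebra_hom_def conv_def fun_eq_iff)
  finally show "(\<Delta>' \<circ> p2) (h \<otimes> g) = conv \<Delta>\<Delta> (\<otimes>) p2 p2 (h \<otimes> g)"
    by (simp add: comp_def snd_tens clinear_scaleC)
  show "(\<epsilon>' \<circ> p2) (h \<otimes> g) = \<epsilon>\<epsilon> (h \<otimes> g)"
    by (simp add: tensor_counit_tens snd_tens clinear_scaleC[OF L.clinear_counit] scaleC_complex_def)
qed

lemma conv_fst_left:
  assumes "cbilinear f" "clinear X" "clinear Y"
  shows "conv \<Delta>\<Delta> f (X \<circ> p1) Y (h \<otimes> g) = sweedler2 \<Delta> (\<lambda>h1 h2. f (X h1) (Y (h2 \<otimes> g))) h"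
proof -
  interpret T: cocommutative_coalgebra \<Delta>\<Delta> \<epsilon>\<epsilon> by (rule tensor_coalgebra)
  note l = assms(1)[THEN cbilinear_left] assms(1)[THEN cbilinear_right]
    assms(2,3)[THEN clinear_compose]
  have b: "cbilinear (\<lambda>y x. f x y)" by (intro lin l)
  have "conv \<Delta>\<Delta> f (X \<circ> p1) Y = conv \<Delta>\<Delta> (\<lambda>y x. f x y) Y (X \<circ> p1)"
    by (rule T.conv_comm) (simp_all add: assms clinear_fst)
  then have "conv \<Delta>\<Delta> f (X \<circ> p1) Y (h \<otimes> g) = sweedler2 \<Delta> (\<lambda>h1 h2. f (X h2) (Y (h1 \<otimes> g))) h"
    by (simp add: conv_fst_right b assms)
  also have "\<dots> = sweedler2 \<Delta> (\<lambda>h1 h2. f (X h1) (Y (h2 \<otimes> g))) h"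
    by (rule K.sweedler_comm) (intro lin l)
  finally show ?thesis .
qed

text \<open>The two projections together form the identity of the product coalgebra; so \<sigma>
  itself is the value of \<sigma> at this pair of points.\<close>

lemma tens_fst_snd: "conv \<Delta>\<Delta> (\<otimes>) p1 p2 = (\<lambda>x. x)"
proof (rule clinear_tensor_eqI)
  show "conv \<Delta>\<Delta> (\<otimes>) p1 p2 (h \<otimes> g) = h \<otimes> g" for h g
    using conv_fst_snd[of "(\<otimes>)" "\<lambda>x. x" "\<lambda>x. x" h g] by (simp add: comp_def)
qed (simp_all add: clinear_conv clinear_tensor_coproduct clinear_fst clinear_snd)

end

section \<open>Points of the Hopf algebra\<close>

type_synonym ('b, 'h) smash_pair = "(('b, 'h) tensor, ('b, 'h) tensor) tensor"

locale central_crossed_product = crossed_product \<Delta> \<epsilon> S act \<sigma> \<sigma>i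
  for \<Delta> :: "'h::complex_algebra_1 \<Rightarrow> ('h, 'h) tensor" and \<epsilon> S
    and act :: "'h \<Rightarrow> 'b::complex_algebra_1 \<Rightarrow> 'b" (infixr "\<triangleright>" 74)
    and \<sigma> \<sigma>i +
  assumes cocommutative: "cocommutative \<Delta>"
    and central_sigma: "range \<sigma> \<subseteq> centre"
begin

sublocale H: cocommutative_coalgebra \<Delta> \<epsilon>
  by (rule cocommutative_coalgebra.intro)
    (fact linear_coproduct linear_counit coassociative counit_left cocommutative)+

sublocale HH: coalgebra_pair \<Delta> \<epsilon> \<Delta> \<epsilon> ..

sublocale HHC: cocommutative_coalgebra HH.\<Delta>\<Delta> HH.\<epsilon>\<epsilon>
  by (rule HH.tensor_coalgebra)

declare linear_antipode [simp] bilinear_act [simp] linear_sigma [simp] linear_sigma_inv [simp]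

lemmas lin_act = bilinear_act[THEN cbilinear_left] bilinear_act[THEN cbilinear_right]
lemmas lin_maps [lin] = lin_act linear_antipode[THEN clinear_compose]
  linear_sigma[THEN clinear_compose] linear_sigma_inv[THEN clinear_compose]

text \<open>The two-variable Sweedler form of invertibility is invertibility of \<sigma> in the
  convolution algebra of linear maps from H \<otimes> H to B.\<close>

lemma sigma_conv_inv: "HHC.kconv (*) \<sigma> \<sigma>i = HHC.kcst 1"
  and sigma_inv_conv: "HHC.kconv (*) \<sigma>i \<sigma> = HHC.kcst 1"
proof -
  show "HHC.kconv (*) \<sigma> \<sigma>i = HHC.kcst 1"
  proof (rule clinear_tensor_eqI)
    show "HHC.kconv (*) \<sigma> \<sigma>i (h \<otimes> k) = HHC.kcst 1 (h \<otimes> k)" for h k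
      unfolding conv_def
      by (subst HH.sweedler2_tens, intro lin) (simp add: sigma_sigma_inv cst_def HH.tensor_counit_tens)
  qed simp_all
  show "HHC.kconv (*) \<sigma>i \<sigma> = HHC.kcst 1"
  proof (rule clinear_tensor_eqI)
    show "HHC.kconv (*) \<sigma>i \<sigma> (h \<otimes> k) = HHC.kcst 1 (h \<otimes> k)" for h k
      unfolding conv_def
      by (subst HH.sweedler2_tens, intro lin) (simp add: sigma_inv_sigma cst_def HH.tensor_counit_tens)
  qed simp_all
qed

text \<open>The inverse of a central element is central; \<open>b\<close> enters as a constant map,
  so that the usual computation takes place in the convolution algebra.\<close>

lemma central_sigma_inv: "range \<sigma>i \<subseteq> centre"
proof -
  have "\<sigma>i w * b = b * \<sigma>i w" for w b
  proof -
    let ?m = "HHC.kconv (*)"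
    have "?m \<sigma>i (HHC.kcst b) = ?m (?m \<sigma>i (HHC.kcst b)) (?m \<sigma> \<sigma>i)"
      by (simp add: sigma_conv_inv HHC.kmult_one_right)
    also have "\<dots> = ?m \<sigma>i (?m (?m (HHC.kcst b) \<sigma>) \<sigma>i)"
      by (simp add: HHC.kmult_assoc)
    also have "\<dots> = ?m \<sigma>i (?m (?m \<sigma> (HHC.kcst b)) \<sigma>i)"
      by (simp add: HHC.kmult_central[OF central_sigma, of "HHC.kcst b"])
    also have "\<dots> = ?m (?m \<sigma>i \<sigma>) (?m (HHC.kcst b) \<sigma>i)"
      by (simp add: HHC.kmult_assoc)
    also have "\<dots> = ?m (HHC.kcst b) \<sigma>i"
      by (simp add: sigma_inv_conv HHC.kmult_one_left)
    finally show ?thesis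
      by (simp add: HHC.conv_kcst_left HHC.conv_kcst_right fun_eq_iff)
  qed
  then show ?thesis by (auto simp: centre_def)
qed

text \<open>In the twisted module condition \<sigma> is central, hence passes the middle factor
  \<open>X\<close> and cancels against \<open>\<sigma>i\<close>. The sums over \<open>h\<close> and
  \<open>k\<close> are interleaved so that the triple sum becomes a convolution over H \<otimes>
  H.\<close>

lemma act_act: "h \<triangleright> k \<triangleright> b = (h * k) \<triangleright> b"
proof -
  let ?m = "HHC.kconv (*)"
  define X where "X = tlift (\<lambda>h k. (h * k) \<triangleright> b)"
  have X: "clinear X" and X_tens: "X (h \<otimes> k) = (h * k) \<triangleright> b" for h k
    unfolding X_def by (intro lin, subst tlift_tens, intro lin, rule refl)
  note lX = X[THEN clinear_compose]
  have "h \<triangleright> k \<triangleright> b = sweedler2 \<Delta> (\<lambda>h1 h'. sweedler2 \<Delta> (\<lambda>h2 h3. sweedler2 \<Delta> (\<lambda>k1 k'.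
      sweedler2 \<Delta> (\<lambda>k2 k3. \<sigma> (h1 \<otimes> k1) * (X (h2 \<otimes> k2) * \<sigma>i (h3 \<otimes> k3))) k') k) h') h"
    by (simp add: twisted_action sweedler3_def X_tens mult.assoc)
  also have "\<dots> = sweedler2 \<Delta> (\<lambda>h1 h'. sweedler2 \<Delta> (\<lambda>k1 k'. sweedler2 \<Delta> (\<lambda>h2 h3. 
      sweedler2 \<Delta> (\<lambda>k2 k3. \<sigma> (h1 \<otimes> k1) * (X (h2 \<otimes> k2) * \<sigma>i (h3 \<otimes> k3))) k') h') k) h"
    by (subst HH.sweedler_swap) (unfold sweedler2_def, (intro lin lX H.clinear_cop refl)+)
  also have "\<dots> = sweedler2 \<Delta> (\<lambda>h1 h'. sweedler2 \<Delta> (\<lambda>k1 k'. \<sigma> (h1 \<otimes> k1) * sweedler2 \<Delta> (\<lambda>h2 h3. 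
      sweedler2 \<Delta> (\<lambda>k2 k3. X (h2 \<otimes> k2) * \<sigma>i (h3 \<otimes> k3)) k') h') k) h"
    unfolding sweedler2_def
    by (subst tlift_compose[where L = "\<lambda>x. _ * x"], (intro lin lX H.clinear_cop)+,
       subst tlift_compose[where L = "\<lambda>x. _ * x"], (intro lin lX H.clinear_cop refl)+)
  also have "\<dots> = sweedler2 \<Delta> (\<lambda>h1 h'. sweedler2 \<Delta> (\<lambda>k1 k'. \<sigma> (h1 \<otimes> k1) * ?m X \<sigma>i (h' \<otimes> k')) k) h"
    unfolding conv_def by (subst HH.sweedler2_tens) (intro lin lX refl)+
  also have "\<dots> = ?m \<sigma> (?m X \<sigma>i) (h \<otimes> k)"
    unfolding conv_def[of _ _ \<sigma>]
    by (rule HH.sweedler2_tens[symmetric]) (intro lin HHC.clinear_kconv[THEN clinear_compose] X cbilinear_mult linear_sigma_inv)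
  also have "?m \<sigma> (?m X \<sigma>i) = ?m (?m X \<sigma>) \<sigma>i"
    by (simp add: HHC.kmult_central[OF central_sigma, of X] X flip: HHC.kmult_assoc)
  also have "\<dots> = X"
    by (simp add: HHC.kmult_assoc X sigma_conv_inv HHC.kmult_one_right)
  finally show ?thesis by (simp add: X_tens)
qed

declare linear_coproduct [simp] linear_counit [simp]

section \<open>The smash product algebra and its module B\<close>

abbreviation A where "A \<equiv> smash_product \<Delta> (\<triangleright>)"

lemma cbilinear_amult [simp]: "cbilinear (amult A)"
  unfolding smash_product_def sweedler2_def by simp (intro lin H.clinear_cop)

lemmas lin_amult [lin] = cbilinear_amult[THEN cbilinear_left] cbilinear_amult[THEN cbilinear_right]

lemma amult_tens:
  "amult A (b \<otimes> h) (b' \<otimes> g) = sweedler2 \<Delta> (\<lambda>h1 h2. (b * (h1 \<triangleright> b')) \<otimes> (h2 * g)) h"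
  unfolding smash_product_def sweedler2_def
  by (simp, subst tlift_tens, intro lin H.clinear_cop, subst tlift_tens, (intro lin H.clinear_cop refl)+)

lemma clinear_acoact [simp]: "clinear (acoact A)"
  unfolding smash_product_def sweedler2_def by simp (intro lin H.clinear_cop)

lemma acoact_tens: "acoact A (b \<otimes> h) = sweedler2 \<Delta> (\<lambda>h1 h2. (b \<otimes> h1) \<otimes> h2) h"
  unfolding smash_product_def sweedler2_def
  by (simp, subst tlift_tens, (intro lin H.clinear_cop refl)+)

lemma aone_eq [simp]: "aone A = 1 \<otimes> 1" and aincl_eq [simp]: "aincl A b = b \<otimes> 1"
  by (simp_all add: smash_product_def)

lemma antipode_one: "S 1 = 1"
proof -
  have "sweedler2 \<Delta> (\<lambda>h1 h2. S h1 * h2) 1 = S 1 * 1"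
    unfolding sweedler2_def coproduct_one by (subst tlift_tens) (intro lin refl)+
  then show ?thesis by (simp add: antipode_left counit_one scaleC_one)
qed

text \<open>The componentwise product of H \<otimes> H, for which the coproduct is
  multiplicative.\<close>

definition tmult ::
    "('h, 'h) tensor \<Rightarrow> ('h, 'h) tensor \<Rightarrow> ('h, 'h) tensor" where
  "tmult u w = tlift (\<lambda>a b. tlift (\<lambda>c d. (a * c) \<otimes> (b * d)) w) u"

lemma cbilinear_tmult: "cbilinear tmult"
  unfolding tmult_def by (intro lin)

lemma tmult_tens: "tmult (a \<otimes> b) (c \<otimes> d) = (a * c) \<otimes> (b * d)"
  unfolding tmult_def by (subst tlift_tens, (intro lin)+, subst tlift_tens, (intro lin refl)+)

lemma coproduct_tmult: "\<Delta> (h * k) = tmult (\<Delta> h) (\<Delta> k)"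
  by (simp add: coproduct_mult tmult_def sweedler2_def)

text \<open>The natural left module structure of the smash product on B.\<close>

definition twisted_act :: "('b, 'h) tensor \<Rightarrow> 'b \<Rightarrow> 'b" where
  "twisted_act u b = tlift (\<lambda>c h. c * (h \<triangleright> b)) u"

lemma cbilinear_twisted_act [simp]: "cbilinear twisted_act"
  unfolding twisted_act_def by (intro lin)

lemma twisted_act_tens: "twisted_act (c \<otimes> h) b = c * (h \<triangleright> b)"
  unfolding twisted_act_def by (subst tlift_tens) (intro lin refl)+

end

section \<open>Points of H as invertible group-like elements acting on maps into B\<close>

locale coalgebra_points =
  central_crossed_product \<Delta> \<epsilon> S act \<sigma> \<sigma>i + K: cocommutative_coalgebra \<Delta>\<^sub>K \<epsilon>\<^sub>K
  for \<Delta> :: "'h::complex_algebra_1 \<Rightarrow> ('h, 'h) tensor" and \<epsilon> S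
    and act :: "'h \<Rightarrow> 'b::complex_algebra_1 \<Rightarrow> 'b" (infixr "\<triangleright>" 74)
    and \<sigma> \<sigma>i
    and \<Delta>\<^sub>K :: "'k::complex_vector \<Rightarrow> ('k, 'k) tensor" and \<epsilon>\<^sub>K
begin

abbreviation ktens (infixr "\<boxtimes>" 76) where "F \<boxtimes> G \<equiv> conv \<Delta>\<^sub>K (\<otimes>) F G"
abbreviation kmult (infixl "\<odot>" 70) where "F \<odot> G \<equiv> conv \<Delta>\<^sub>K (*) F G"
abbreviation kact (infixr "\<unrhd>" 74) where "\<gamma> \<unrhd> F \<equiv> conv \<Delta>\<^sub>K (\<triangleright>) \<gamma> F"
abbreviation point where "point \<gamma> \<equiv> coalgebra_hom \<Delta>\<^sub>K \<epsilon>\<^sub>K \<Delta> \<epsilon> \<gamma>"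
abbreviation kone ("\<one>") where "\<one> \<equiv> cst \<epsilon>\<^sub>K 1"

declare K.clinear_coproduct [simp] K.clinear_counit [simp]

lemma point_clinear [simp]: "point \<gamma> \<Longrightarrow> clinear \<gamma>"
  by (rule coalgebra_hom_clinear)

lemma point_coproduct: "point \<gamma> \<Longrightarrow> \<Delta> \<circ> \<gamma> = \<gamma> \<boxtimes> \<gamma>"
  and point_counit: "point \<gamma> \<Longrightarrow> \<epsilon> \<circ> \<gamma> = \<epsilon>\<^sub>K"
  by (simp_all add: coalgebra_hom_def)

lemma counit_kcst: "\<epsilon>\<^sub>K = K.kcst 1"
  by (simp add: cst_def scaleC_complex_def)

lemma kact_kact: "clinear \<gamma> \<Longrightarrow> clinear \<eta> \<Longrightarrow> clinear F \<Longrightarrow> \<gamma> \<unrhd> \<eta> \<unrhd> F = (\<gamma> \<odot> \<eta>) \<unrhd> F"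
  by (rule K.conv_assoc) (simp_all add: act_act)

lemma kact_mult: "point \<gamma> \<Longrightarrow> clinear F \<Longrightarrow> clinear G \<Longrightarrow> \<gamma> \<unrhd> (F \<odot> G) = (\<gamma> \<unrhd> F) \<odot> (\<gamma> \<unrhd> G)"
  by (rule K.conv_diag[where \<Delta>' = \<Delta> and \<epsilon>' = \<epsilon>]) (simp_all add: measures_mult)

lemma kact_one: "point \<gamma> \<Longrightarrow> \<gamma> \<unrhd> \<one> = \<one>"
  using point_counit[of \<gamma>]
  by (simp add: K.conv_kcst_right measures_one comp_def fun_eq_iff) (simp add: cst_def)

lemma one_kact: "clinear F \<Longrightarrow> \<one> \<unrhd> F = F"
  by (simp add: K.conv_kcst_left one_act comp_def)

lemma point_one: "point \<one>"
  by (rule K.coalgebra_hom_kcst) (simp_all add: coproduct_one counit_one)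

text \<open>Compatibility with the coproduct amounts to swapping the inner factors in the product of
  \<open>\<gamma> \<boxtimes> \<gamma>\<close> and \<open>\<eta> \<boxtimes> \<eta>\<close>, so it
  rests on the interchange law.\<close>

lemma point_mult:
  assumes "point \<gamma>" "point \<eta>"
  shows "point (\<gamma> \<odot> \<eta>)"
  unfolding coalgebra_hom_def
proof (intro conjI)
  show "clinear (\<gamma> \<odot> \<eta>)" using assms by simp
  have "\<Delta> \<circ> (\<gamma> \<odot> \<eta>) = K.kconv tmult (\<Delta> \<circ> \<gamma>) (\<Delta> \<circ> \<eta>)"
    using assms by (subst conv_compose) (simp_all add: coproduct_tmult conv_def)
  also have "\<dots> = (\<gamma> \<odot> \<eta>) \<boxtimes> (\<gamma> \<odot> \<eta>)"
    unfolding point_coproduct[OF assms(1)] point_coproduct[OF assms(2)]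
    by (rule K.conv_interchange) (simp_all add: tmult_tens cbilinear_tmult assms)
  finally show "\<Delta> \<circ> (\<gamma> \<odot> \<eta>) = (\<gamma> \<odot> \<eta>) \<boxtimes> (\<gamma> \<odot> \<eta>)" .
  have "\<epsilon> \<circ> (\<gamma> \<odot> \<eta>) = K.kconv (*) (\<epsilon> \<circ> \<gamma>) (\<epsilon> \<circ> \<eta>)"
    using assms by (subst conv_compose) (simp_all add: counit_mult conv_def)
  also have "\<dots> = \<epsilon>\<^sub>K"
    unfolding point_counit[OF assms(1)] point_counit[OF assms(2)]
    by (subst counit_kcst) (simp add: K.kmult_one_left)
  finally show "\<epsilon> \<circ> (\<gamma> \<odot> \<eta>) = \<epsilon>\<^sub>K" .
qed

lemma point_antipode_right: "point \<gamma> \<Longrightarrow> \<gamma> \<odot> (S \<circ> \<gamma>) = \<one>"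
  and point_antipode_left: "point \<gamma> \<Longrightarrow> (S \<circ> \<gamma>) \<odot> \<gamma> = \<one>"
proof -
  assume \<gamma>: "point \<gamma>"
  have e: "\<epsilon> (\<gamma> k) = \<epsilon>\<^sub>K k" for k using point_counit[OF \<gamma>] by (simp add: fun_eq_iff)
  show "\<gamma> \<odot> (S \<circ> \<gamma>) = \<one>"
    using sweedler2_hom[OF \<gamma>, of "\<lambda>h1 h2. h1 * S h2"] cbilinear_compose2[OF cbilinear_mult clinear_ident linear_antipode]
    by (simp add: conv_def fun_eq_iff antipode_right cst_def e)
  show "(S \<circ> \<gamma>) \<odot> \<gamma> = \<one>"
    using sweedler2_hom[OF \<gamma>, of "\<lambda>h1 h2. S h1 * h2"] cbilinear_compose2[OF cbilinear_mult linear_antipode clinear_ident]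
    by (simp add: conv_def fun_eq_iff antipode_left cst_def e)
qed

lemmas kmult_one = K.kmult_one_left K.kmult_one_right

lemma kmult_cancel_left:
  fixes F :: "'k \<Rightarrow> 'h"
  assumes "point \<gamma>" "clinear F"
  shows "\<gamma> \<odot> ((S \<circ> \<gamma>) \<odot> F) = F" "(S \<circ> \<gamma>) \<odot> (\<gamma> \<odot> F) = F"
  using assms by (simp_all add: point_antipode_right point_antipode_left kmult_one flip: K.kmult_assoc)

text \<open>Both sides are inverse to \<open>\<gamma> \<odot> \<eta>\<close> in the convolution
  algebra.\<close>

lemma antipode_mult:
  assumes "point \<gamma>" "point \<eta>"
  shows "S \<circ> (\<gamma> \<odot> \<eta>) = (S \<circ> \<eta>) \<odot> (S \<circ> \<gamma>)"
proof -
  have "S \<circ> (\<gamma> \<odot> \<eta>) = (S \<circ> (\<gamma> \<odot> \<eta>)) \<odot> (\<gamma> \<odot> \<eta> \<odot> ((S \<circ> \<eta>) \<odot> (S \<circ> \<gamma>)))"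
    using assms by (simp add: K.kmult_assoc kmult_cancel_left point_antipode_right kmult_one)
  also have "\<dots> = (S \<circ> \<eta>) \<odot> (S \<circ> \<gamma>)"
    using assms by (simp add: point_mult kmult_cancel_left)
  finally show ?thesis .
qed

lemma antipode_kone: "S \<circ> \<one> = \<one>"
  by (simp add: K.conv_kcst_comp antipode_one)

text \<open>Uniqueness of inverses: \<open>\<Delta> \<circ> (S \<circ> \<gamma>)\<close> and
  \<open>(S \<circ> \<gamma>) \<boxtimes> (S \<circ> \<gamma>)\<close> are both inverse to
  \<open>\<gamma> \<boxtimes> \<gamma>\<close> for the convolution product formed with
  \<open>tmult\<close>.\<close>

lemma point_antipode:
  assumes "point \<gamma>"
  shows "point (S \<circ> \<gamma>)"
  unfolding coalgebra_hom_def
proof (intro conjI)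
  have [simp]: "clinear \<gamma>" using assms by simp
  show "clinear (S \<circ> \<gamma>)" by simp
  let ?m = "K.kconv tmult" and ?D = "\<Delta> \<circ> (S \<circ> \<gamma>)"
  have tens_mult: "?m (F \<boxtimes> G) (F' \<boxtimes> G') = (F \<odot> F') \<boxtimes> (G \<odot> G')"
    if "clinear F" "clinear G" "clinear F'" "clinear G'" for F G F' G'
    by (rule K.conv_interchange) (simp_all add: tmult_tens cbilinear_tmult that)
  have tmult_one: "tmult (1 \<otimes> 1) w = w" "tmult w (1 \<otimes> 1) = w" for w
    using cbilinear_tmult
    by (induction w rule: tensor_induct) (simp_all add: tmult_tens clinear_iff cbilinear_def)
  have tmult_assoc: "tmult x (tmult y z) = tmult (tmult x y) z" for x y z
  proof -
    have *: "tmult (a \<otimes> a') (tmult (b \<otimes> b') z) = tmult (tmult (a \<otimes> a') (b \<otimes> b')) z" for a a' b b'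
      using cbilinear_tmult
      by (induction z rule: tensor_induct) (simp_all add: tmult_tens clinear_iff cbilinear_def mult.assoc)
    have **: "tmult (a \<otimes> a') (tmult y z) = tmult (tmult (a \<otimes> a') y) z" for a a'
      using cbilinear_tmult by (induction y rule: tensor_induct) (simp_all add: * clinear_iff cbilinear_def)
    show ?thesis
      using cbilinear_tmult by (induction x rule: tensor_induct) (simp_all add: ** clinear_iff cbilinear_def)
  qed
  have "?m (\<gamma> \<boxtimes> \<gamma>) ?D = \<Delta> \<circ> (\<gamma> \<odot> (S \<circ> \<gamma>))"
    unfolding point_coproduct[OF assms, symmetric]
    by (subst conv_compose) (simp_all add: coproduct_tmult conv_def)
  also have "\<dots> = K.kcst (1 \<otimes> 1)"
    using assms by (simp add: point_antipode_right K.conv_kcst_comp coproduct_one)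
  finally have inv: "?m (\<gamma> \<boxtimes> \<gamma>) ?D = K.kcst (1 \<otimes> 1)" .
  have "?m ((S \<circ> \<gamma>) \<boxtimes> (S \<circ> \<gamma>)) (?m (\<gamma> \<boxtimes> \<gamma>) ?D) = (S \<circ> \<gamma>) \<boxtimes> (S \<circ> \<gamma>)"
    unfolding inv by (simp add: K.conv_kcst_right cbilinear_tmult tmult_one fun_eq_iff)
  moreover have "?m ((S \<circ> \<gamma>) \<boxtimes> (S \<circ> \<gamma>)) (?m (\<gamma> \<boxtimes> \<gamma>) ?D) = ?m (?m ((S \<circ> \<gamma>) \<boxtimes> (S \<circ> \<gamma>)) (\<gamma> \<boxtimes> \<gamma>)) ?D"
    by (rule K.conv_assoc) (simp_all add: cbilinear_tmult tmult_assoc)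
  moreover have "\<dots> = ?D"
    using assms by (simp add: tens_mult point_antipode_left K.conv_kcst_kcst)
      (simp add: K.conv_kcst_left cbilinear_tmult tmult_one fun_eq_iff)
  ultimately show "\<Delta> \<circ> (S \<circ> \<gamma>) = (S \<circ> \<gamma>) \<boxtimes> (S \<circ> \<gamma>)" by simp
  \<comment> \<open>Multiplying by the unit \<open>\<epsilon> \<circ> \<gamma>\<close> replaces
    \<open>S \<circ> \<gamma>\<close> by \<open>\<gamma> \<odot> (S \<circ> \<gamma>)\<close> under
    the counit.\<close>
  have "\<epsilon> \<circ> (S \<circ> \<gamma>) = K.kconv (*) (\<epsilon> \<circ> \<gamma>) (\<epsilon> \<circ> (S \<circ> \<gamma>))"
    unfolding point_counit[OF assms] by (subst counit_kcst) (simp add: K.kmult_one_left)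
  also have "\<dots> = \<epsilon> \<circ> (\<gamma> \<odot> (S \<circ> \<gamma>))"
    by (subst conv_compose) (simp_all add: counit_mult conv_def)
  also have "\<dots> = \<epsilon>\<^sub>K"
    using assms by (simp add: point_antipode_right K.conv_kcst_comp counit_one flip: counit_kcst)
  finally show "\<epsilon> \<circ> (S \<circ> \<gamma>) = \<epsilon>\<^sub>K" .
qed

lemma acoact_point:
  assumes "clinear F" "point \<gamma>"
  shows "acoact A \<circ> (F \<boxtimes> \<gamma>) = (F \<boxtimes> \<gamma>) \<boxtimes> \<gamma>"
proof -
  let ?f = "\<lambda>b. tlift (\<lambda>h1 h2. (b \<otimes> h1) \<otimes> h2)"
  have b: "cbilinear ?f" by (intro lin)
  have "acoact A \<circ> (F \<boxtimes> \<gamma>) = K.kconv ?f F (\<Delta> \<circ> \<gamma>)"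
    using assms by (subst conv_compose) (simp_all add: acoact_tens sweedler2_def conv_def)
  also have "\<dots> = (F \<boxtimes> \<gamma>) \<boxtimes> \<gamma>"
    unfolding point_coproduct[OF assms(2)]
    by (rule K.conv_assoc) (use assms b in \<open>simp_all add: tlift_tens cbilinear_compose2\<close>,
      subst tlift_tens, (intro lin refl)+)
  finally show ?thesis .
qed

text \<open>The product of A factors through the coaction of its left argument:
  \<open>b \<otimes> h1\<close> acts on the first leg of the right argument while \<open>h2\<close>
  multiplies the second leg. This is the shape of the interchange law.\<close>

lemma amult_point:
  assumes "clinear F" "clinear G" "point \<gamma>" "clinear \<eta>"
  shows "K.kconv (amult A) (F \<boxtimes> \<gamma>) (G \<boxtimes> \<eta>) = (F \<odot> (\<gamma> \<unrhd> G)) \<boxtimes> (\<gamma> \<odot> \<eta>)"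
proof -
  define M where "M = (\<lambda>w y. tlift (\<lambda>u (h2 :: 'h). tlift (\<lambda>b' g. twisted_act u b' \<otimes> (h2 * g)) y) w)"
  note l = cbilinear_twisted_act[THEN cbilinear_left] cbilinear_twisted_act[THEN cbilinear_right]
  have M: "cbilinear M" unfolding M_def by (intro lin l)
  have M_tens: "M (u \<otimes> h2) (b' \<otimes> g) = twisted_act u b' \<otimes> (h2 * g)" for u h2 b' g
    unfolding M_def by (subst tlift_tens, (intro lin l)+, subst tlift_tens, (intro lin l refl)+)
  have M_coact: "amult A u v = M (acoact A u) v" for u v
  proof -
    have "amult A (b \<otimes> h) (b' \<otimes> g) = M (acoact A (b \<otimes> h)) (b' \<otimes> g)" for b h b' g
      unfolding acoact_tens amult_tens sweedler2_def
      by (subst tlift_compose[where L = "\<lambda>w. M w _"], (intro lin M[THEN cbilinear_left])+)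
        (simp add: M_tens twisted_act_tens)
    then have "amult A (b \<otimes> h) v = M (acoact A (b \<otimes> h)) v" for b h
      using M cbilinear_amult
      by (induction v rule: tensor_induct) (simp_all add: clinear_iff cbilinear_def)
    then show ?thesis
      using M cbilinear_amult clinear_acoact
      by (induction u rule: tensor_induct) (simp_all add: clinear_iff cbilinear_def)
  qed
  have "K.kconv (amult A) (F \<boxtimes> \<gamma>) (G \<boxtimes> \<eta>) = K.kconv M (acoact A \<circ> (F \<boxtimes> \<gamma>)) (G \<boxtimes> \<eta>)"
    by (simp add: conv_def M_coact)
  also have "\<dots> = K.kconv twisted_act (F \<boxtimes> \<gamma>) G \<boxtimes> (\<gamma> \<odot> \<eta>)"
    unfolding acoact_point[OF assms(1,3)]
    by (rule K.conv_interchange) (simp_all add: assms M M_tens)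
  also have "K.kconv twisted_act (F \<boxtimes> \<gamma>) G = F \<odot> (\<gamma> \<unrhd> G)"
    by (rule K.conv_assoc[symmetric]) (simp_all add: assms twisted_act_tens)
  finally show ?thesis .
qed

end

section \<open>The smash product and its pairs\<close>

context central_crossed_product
begin

abbreviation C where "C \<equiv> ehresmann_schauenburg A"

text \<open>A linear left inverse of the inclusion of B, defined on all of A.\<close>

definition base_part :: "('b, 'h) tensor \<Rightarrow> 'b" where
  "base_part = tlift (\<lambda>b k. \<epsilon> k *\<^sub>C b)"

lemma clinear_base_part [simp]: "clinear base_part"
  unfolding base_part_def by (intro lin H.clinear_eps)

lemmas lin_base_part [lin] = clinear_base_part[THEN clinear_compose]

lemma base_part_tens: "base_part (b \<otimes> k) = \<epsilon> k *\<^sub>C b"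
  unfolding base_part_def by (subst tlift_tens) (intro lin H.clinear_eps refl)+

lemma lmult_eq: "lmult C = (\<lambda>x y. tlift (\<lambda>a c. tlift (\<lambda>a' c'. amult A a a' \<otimes> amult A c' c) y) x)"
  by (simp add: ehresmann_schauenburg_def)

lemma cbilinear_lmult [simp]: "cbilinear (lmult C)"
  unfolding lmult_eq by (intro lin)

lemmas lin_lmult [lin] = cbilinear_lmult[THEN cbilinear_left] cbilinear_lmult[THEN cbilinear_right]

lemma lmult_tens: "lmult C (a \<otimes> c) (a' \<otimes> c') = amult A a a' \<otimes> amult A c' c"
  unfolding lmult_eq by (subst tlift_tens, (intro lin)+, subst tlift_tens, (intro lin refl)+)

lemma lsource_eq [simp]: "lsource C b = (b \<otimes> 1) \<otimes> (1 \<otimes> 1)"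
  and ltarget_eq [simp]: "ltarget C b = (1 \<otimes> 1) \<otimes> (b \<otimes> 1)"
  and lone_eq [simp]: "lone C = (1 \<otimes> 1) \<otimes> (1 \<otimes> 1)"
  by (simp_all add: ehresmann_schauenburg_def)

text \<open>\<open>lcounit\<close> uses \<open>inv (aincl A)\<close>, which is meaningful only on
  the image of B. This version is linear everywhere and agrees with it on the carrier by
  \<open>lcounit_eq\<close>.\<close>

definition counit_lin :: "('b, 'h) smash_pair \<Rightarrow> 'b" where
  "counit_lin x = base_part (tlift (amult A) x)"

lemma clinear_counit_lin [simp]: "clinear counit_lin"
  unfolding counit_lin_def by (intro lin)

lemmas lin_counit_lin [lin] = clinear_counit_lin[THEN clinear_compose]

text \<open>
  For \<open>u = b # h\<close> and \<open>v = b' # k\<close> this is \<open>\<epsilon>(k) (b # h\<^sub>(\<^sub>1\<^sub>) \<otimes> b' # S(h\<^sub>(\<^sub>2\<^sub>)))\<close>; the induced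
  endomorphism of \<open>A \<otimes> A\<close> is a projection onto the carrier of \<open>C(A, H)\<close>.
\<close>

definition proj2 :: "('b, 'h) tensor \<Rightarrow> ('b, 'h) tensor \<Rightarrow> ('b, 'h) smash_pair" where
  "proj2 u v = tlift (\<lambda>u0 h. u0 \<otimes> (base_part v \<otimes> S h)) (acoact A u)"

definition proj where "proj = tlift proj2"

lemma cbilinear_proj2 [simp]: "cbilinear proj2"
  unfolding proj2_def by (intro lin clinear_acoact)

lemma clinear_proj [simp]: "clinear proj" and proj_tens: "proj (u \<otimes> v) = proj2 u v"
  by (simp_all add: proj_def clinear_tlift tlift_tens)

lemmas lin_proj [lin] = clinear_proj[THEN clinear_compose]

text \<open>Exposes the Hopf component of a pair in front, so that it can be fed to a map on H
  \<otimes> H while the pair itself is kept.\<close>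

definition hcoact :: "('b, 'h) smash_pair \<Rightarrow> ('h, ('b, 'h) smash_pair) tensor" where
  "hcoact = tlift (\<lambda>u v. tlift (\<lambda>u0 h. h \<otimes> (u0 \<otimes> v)) (acoact A u))"

lemma clinear_hcoact [simp]: "clinear hcoact"
  unfolding hcoact_def by (intro lin clinear_acoact)

text \<open>
  The form \<open>\<tau>(h\<^sub>(\<^sub>1\<^sub>), g\<^sub>(\<^sub>1\<^sub>)) \<epsilon>(x y)\<close> for \<open>x = b # h\<^sub>(\<^sub>2\<^sub>) \<otimes> b' # S(h\<^sub>(\<^sub>3\<^sub>))\<close> and
  \<open>y = c # g\<^sub>(\<^sub>2\<^sub>) \<otimes> c' # S(g\<^sub>(\<^sub>3\<^sub>))\<close>; for central \<open>\<tau> = \<sigma>\<close> it is the map of the theorem.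
\<close>

definition twist_form ::
    "(('h, 'h) tensor \<Rightarrow> 'b) \<Rightarrow> ('b, 'h) smash_pair \<Rightarrow>
      ('b, 'h) smash_pair \<Rightarrow> 'b" where
  "twist_form \<tau> x y = tlift (\<lambda>h x'. tlift (\<lambda>g y'. \<tau> (h \<otimes> g) * counit_lin (lmult C x' y')) (hcoact y)) (hcoact x)"

lemma cbilinear_twist_form [simp]:
  assumes "clinear \<tau>"
  shows "cbilinear (twist_form \<tau>)"
  unfolding twist_form_def by (intro lin assms[THEN clinear_compose] clinear_hcoact)

end

context coalgebra_points
begin

text \<open>The coefficients are maps on the coalgebra rather than constants, because products
  create coefficients such as \<open>\<gamma> \<unrhd> F'\<close>.\<close>

abbreviation kelem where "kelem F G \<gamma> \<equiv> (F \<boxtimes> \<gamma>) \<boxtimes> (G \<boxtimes> (S \<circ> \<gamma>))"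

lemma kelem_smash_elem:
  assumes "point \<gamma>"
  shows "smash_elem \<Delta> S b b' \<circ> \<gamma> = kelem (K.kcst b) (K.kcst b') \<gamma>"
proof -
  have b: "cbilinear (\<lambda>h1 h2. (b \<otimes> h1) \<otimes> (b' \<otimes> S h2))" by (intro lin)
  show ?thesis
    using sweedler2_hom[OF assms b] assms
    by (simp add: smash_elem_def K.conv_kcst_left fun_eq_iff) (simp add: conv_def)
qed

lemma base_part_tens_conv:
  assumes "clinear F" "clinear \<kappa>" "\<epsilon> \<circ> \<kappa> = \<epsilon>\<^sub>K"
  shows "base_part \<circ> (F \<boxtimes> \<kappa>) = F"
proof -
  have s: "cbilinear (\<lambda>b c. c *\<^sub>C b)" by (intro lin)
  have "base_part \<circ> (F \<boxtimes> \<kappa>) = K.kconv (\<lambda>b c. c *\<^sub>C b) F (\<epsilon> \<circ> \<kappa>)"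
    using assms(1,2) by (subst conv_compose) (simp_all add: base_part_tens conv_def)
  also have "\<dots> = F"
    unfolding assms(3) by (subst counit_kcst) (simp add: K.conv_kcst_right[OF s] assms scaleC_one fun_eq_iff)
  finally show ?thesis .
qed

text \<open>The Hopf component of the right leg is discarded by the counit and replaced by the
  inverse of the left one. Hence every \<open>\<kappa>\<close> with trivial counit gives the same
  result.\<close>

lemma proj_conv:
  assumes "clinear F" "clinear G" "clinear \<kappa>" "\<epsilon> \<circ> \<kappa> = \<epsilon>\<^sub>K" "point \<gamma>"
  shows "K.kconv proj2 (F \<boxtimes> \<gamma>) (G \<boxtimes> \<kappa>) = kelem F G \<gamma>"
proof -
  have b: "cbilinear (\<lambda>h v. base_part v \<otimes> S h)" by (intro lin)
  have "K.kconv proj2 (F \<boxtimes> \<gamma>) (G \<boxtimes> \<kappa>)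
      = (F \<boxtimes> \<gamma>) \<boxtimes> K.kconv (\<lambda>h v. base_part v \<otimes> S h) \<gamma> (G \<boxtimes> \<kappa>)"
    unfolding proj2_def by (rule K.conv_coact) (simp_all add: assms b acoact_point)
  also have "K.kconv (\<lambda>h v. base_part v \<otimes> S h) \<gamma> (G \<boxtimes> \<kappa>) = K.kconv (\<lambda>h b. b \<otimes> S h) \<gamma> (base_part \<circ> (G \<boxtimes> \<kappa>))"
    by (simp add: conv_def)
  also have "\<dots> = K.kconv (\<lambda>b h. b \<otimes> S h) G \<gamma>"
    unfolding base_part_tens_conv[OF assms(2-4)] by (rule K.conv_comm) (simp_all add: assms, intro lin)
  also have "\<dots> = G \<boxtimes> (S \<circ> \<gamma>)"
    by (simp add: conv_def)
  finally show ?thesis .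
qed

lemma lmult_conv:
  assumes "clinear X" "clinear Y" "clinear X'" "clinear Y'"
  shows "K.kconv (lmult C) (X \<boxtimes> Y) (X' \<boxtimes> Y') = K.kconv (amult A) X X' \<boxtimes> K.kconv (amult A) Y' Y"
proof -
  have b: "cbilinear (\<lambda>y y'. amult A y' y)" by (intro lin)
  have "K.kconv (lmult C) (X \<boxtimes> Y) (X' \<boxtimes> Y') = K.kconv (amult A) X X' \<boxtimes> K.kconv (\<lambda>y y'. amult A y' y) Y Y'"
    by (rule K.conv_interchange) (simp_all add: assms lmult_tens b)
  also have "K.kconv (\<lambda>y y'. amult A y' y) Y Y' = K.kconv (amult A) Y' Y"
    by (rule K.conv_comm) (simp_all add: assms b)
  finally show ?thesis .
qed

lemma lmult_kelem:
  assumes "clinear F" "clinear G" "clinear F'" "clinear G'" "point \<gamma>" "point \<eta>"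
  shows "K.kconv (lmult C) (kelem F G \<gamma>) (kelem F' G' \<eta>)
    = kelem (F \<odot> (\<gamma> \<unrhd> F')) (G' \<odot> ((S \<circ> \<eta>) \<unrhd> G)) (\<gamma> \<odot> \<eta>)"
  using assms by (simp add: lmult_conv amult_point point_antipode antipode_mult)

lemma source_kelem: "clinear L \<Longrightarrow> lsource C \<circ> L = kelem L \<one> \<one>"
  and target_kelem: "clinear L \<Longrightarrow> ltarget C \<circ> L = kelem \<one> L \<one>"
  unfolding antipode_kone
  by (simp_all add: K.conv_kcst_right K.conv_kcst_comp K.conv_kcst_left fun_eq_iff)

text \<open>In the product of the two legs the Hopf components \<open>\<gamma>\<close> and
  \<open>S \<circ> \<gamma>\<close> cancel, and the left one acts on \<open>G\<close> on the
  way.\<close>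

lemma counit_kelem:
  assumes "clinear F" "clinear G" "point \<gamma>"
  shows "counit_lin \<circ> kelem F G \<gamma> = F \<odot> (\<gamma> \<unrhd> G)"
proof -
  have "counit_lin \<circ> kelem F G \<gamma> = base_part \<circ> K.kconv (amult A) (F \<boxtimes> \<gamma>) (G \<boxtimes> (S \<circ> \<gamma>))"
    using assms by (subst conv_tens[of "amult A"]) (simp_all, simp add: counit_lin_def fun_eq_iff)
  also have "\<dots> = F \<odot> (\<gamma> \<unrhd> G)"
    using assms by (simp add: amult_point point_antipode_right base_part_tens_conv point_one point_counit)
  finally show ?thesis .
qed

lemma hcoact_kelem:
  assumes "clinear F" "clinear Y" "point \<gamma>"
  shows "hcoact \<circ> ((F \<boxtimes> \<gamma>) \<boxtimes> Y) = \<gamma> \<boxtimes> ((F \<boxtimes> \<gamma>) \<boxtimes> Y)"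
proof -
  have b: "cbilinear (\<lambda>u v. tlift (\<lambda>u0 h. h \<otimes> (u0 \<otimes> v)) (acoact A u))"
    by (intro lin clinear_acoact)
  have "hcoact \<circ> ((F \<boxtimes> \<gamma>) \<boxtimes> Y) = K.kconv (\<lambda>u v. tlift (\<lambda>u0 h. h \<otimes> (u0 \<otimes> v)) (acoact A u)) (F \<boxtimes> \<gamma>) Y"
    unfolding hcoact_def by (rule conv_tens[OF b, symmetric]) (simp_all add: assms)
  also have "\<dots> = \<gamma> \<boxtimes> ((F \<boxtimes> \<gamma>) \<boxtimes> Y)"
    by (rule K.conv_coact') (simp_all add: assms acoact_point)
  finally show ?thesis .
qed

lemma twist_form_conv:
  assumes "clinear \<tau>" "clinear X" "clinear Y" "clinear \<gamma>" "clinear \<eta>"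
    and "hcoact \<circ> X = \<gamma> \<boxtimes> X" "hcoact \<circ> Y = \<eta> \<boxtimes> Y"
  shows "K.kconv (twist_form \<tau>) X Y = (\<tau> \<circ> (\<gamma> \<boxtimes> \<eta>)) \<odot> (counit_lin \<circ> K.kconv (lmult C) X Y)"
proof -
  note l = assms(1)[THEN clinear_compose]
  let ?Q = "\<lambda>p q. tlift (\<lambda>h x'. tlift (\<lambda>g y'. \<tau> (h \<otimes> g) * counit_lin (lmult C x' y')) q) p"
  have t: "cbilinear (\<lambda>h g. \<tau> (h \<otimes> g))" and c: "cbilinear (\<lambda>x y. counit_lin (lmult C x y))"
    by (intro lin l)+
  have "K.kconv (twist_form \<tau>) X Y = K.kconv ?Q (hcoact \<circ> X) (hcoact \<circ> Y)"
    by (simp add: conv_def twist_form_def)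
  also have "\<dots> = K.kconv (\<lambda>h g. \<tau> (h \<otimes> g)) \<gamma> \<eta> \<odot> K.kconv (\<lambda>x y. counit_lin (lmult C x y)) X Y"
    unfolding assms(6,7)
  proof (rule K.conv_interchange)
    show "?Q (\<gamma> a \<otimes> X b) (\<eta> c \<otimes> Y d) = \<tau> (\<gamma> a \<otimes> \<eta> c) * counit_lin (lmult C (X b) (Y d))" for a b c d
      by (subst tlift_tens, (intro lin l)+, subst tlift_tens, (intro lin l refl)+)
    show "cbilinear ?Q" by (intro lin l)
  qed (simp_all add: assms t c)
  also have "\<dots> = (\<tau> \<circ> (\<gamma> \<boxtimes> \<eta>)) \<odot> (counit_lin \<circ> K.kconv (lmult C) X Y)"
    using assms by (simp add: conv_compose)
  finally show ?thesis .
qed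

text \<open>The counit of the product contributes all factors except \<tau>, where
  \<open>cancel\<close> makes the action on \<open>G\<close> one of \<open>\<gamma>\<close> alone.
  Centrality then carries the value of \<tau> to its place in the formula of the theorem.\<close>

lemma twist_form_kelem:
  assumes "clinear \<tau>" "range \<tau> \<subseteq> centre"
    and "clinear F" "clinear G" "clinear F'" "clinear G'" "point \<gamma>" "point \<eta>"
  shows "K.kconv (twist_form \<tau>) (kelem F G \<gamma>) (kelem F' G' \<eta>)
    = F \<odot> ((\<gamma> \<unrhd> F') \<odot> ((\<tau> \<circ> (\<gamma> \<boxtimes> \<eta>)) \<odot> (((\<gamma> \<odot> \<eta>) \<unrhd> G') \<odot> (\<gamma> \<unrhd> G))))"
proof -
  have \<tau>: "range (\<tau> \<circ> (\<gamma> \<boxtimes> \<eta>)) \<subseteq> centre" using assms(2) by auto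
  have swap: "(\<tau> \<circ> (\<gamma> \<boxtimes> \<eta>)) \<odot> (X \<odot> Y) = X \<odot> ((\<tau> \<circ> (\<gamma> \<boxtimes> \<eta>)) \<odot> Y)" if "clinear X" "clinear Y" for X Y
    using K.kmult_central[OF \<tau>, of X] assms that by (simp flip: K.kmult_assoc)
  have cancel: "(\<gamma> \<odot> \<eta>) \<odot> (S \<circ> \<eta>) = \<gamma>"
    using assms by (simp add: K.kmult_assoc point_antipode_right kmult_one)
  have "K.kconv (twist_form \<tau>) (kelem F G \<gamma>) (kelem F' G' \<eta>)
     = (\<tau> \<circ> (\<gamma> \<boxtimes> \<eta>)) \<odot> (counit_lin \<circ> K.kconv (lmult C) (kelem F G \<gamma>) (kelem F' G' \<eta>))"
    by (rule twist_form_conv) (simp_all add: assms hcoact_kelem)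
  also have "\<dots> = (\<tau> \<circ> (\<gamma> \<boxtimes> \<eta>)) \<odot> ((F \<odot> (\<gamma> \<unrhd> F')) \<odot> (((\<gamma> \<odot> \<eta>) \<unrhd> G') \<odot> (\<gamma> \<unrhd> G)))"
    using assms by (simp add: lmult_kelem counit_kelem point_mult kact_mult kact_kact cancel)
  finally show ?thesis
    using assms by (simp add: K.kmult_assoc swap)
qed

end

section \<open>The translation map\<close>

context central_crossed_product
begin

sublocale HHH: coalgebra_pair HH.\<Delta>\<Delta> HH.\<epsilon>\<epsilon> \<Delta> \<epsilon> ..

sublocale HHHC: cocommutative_coalgebra HHH.\<Delta>\<Delta> HHH.\<epsilon>\<epsilon>
  by (rule HHH.tensor_coalgebra)

lemma points_H: "coalgebra_points \<Delta> \<epsilon> S (\<triangleright>) \<sigma> \<sigma>i \<Delta> \<epsilon>"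
  and points_HH: "coalgebra_points \<Delta> \<epsilon> S (\<triangleright>) \<sigma> \<sigma>i HH.\<Delta>\<Delta> HH.\<epsilon>\<epsilon>"
  and points_HHH: "coalgebra_points \<Delta> \<epsilon> S (\<triangleright>) \<sigma> \<sigma>i HHH.\<Delta>\<Delta> HHH.\<epsilon>\<epsilon>"
  by (rule coalgebra_points.intro; unfold_locales)+

abbreviation q1 where "q1 \<equiv> HH.p1 \<circ> HHH.p1"
abbreviation q2 where "q2 \<equiv> HH.p2 \<circ> HHH.p1"
abbreviation q3 where "q3 \<equiv> HHH.p2"

lemma hom_q:
  "coalgebra_hom HHH.\<Delta>\<Delta> HHH.\<epsilon>\<epsilon> \<Delta> \<epsilon> q1" "coalgebra_hom HHH.\<Delta>\<Delta> HHH.\<epsilon>\<epsilon> \<Delta> \<epsilon> q2"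
  "coalgebra_hom HHH.\<Delta>\<Delta> HHH.\<epsilon>\<epsilon> \<Delta> \<epsilon> q3"
  by (rule coalgebra_hom_comp[OF HHH.hom_fst HH.hom_fst] coalgebra_hom_comp[OF HHH.hom_fst HH.hom_snd]
      HHH.hom_snd)+

lemma clinear_pq [simp]: "clinear HH.p1" "clinear HH.p2" "clinear HHH.p1" "clinear HHH.p2"
  by (rule HH.clinear_fst HH.clinear_snd HHH.clinear_fst HHH.clinear_snd)+

text \<open>Evaluation at simple triple tensors; with \<open>conv_q_right\<close> it recovers
  identities in three elements of H for both bracketings.\<close>

lemma conv_q_left:
  assumes "cbilinear f" "cbilinear g" "clinear F" "clinear G" "clinear H"
  shows "HHHC.kconv f (HHHC.kconv g (F \<circ> q1) (G \<circ> q2)) (H \<circ> q3) ((h \<otimes> k) \<otimes> m) = f (g (F h) (G k)) (H m)"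
proof -
  have "HHHC.kconv g (F \<circ> q1) (G \<circ> q2) = HHC.kconv g (F \<circ> HH.p1) (G \<circ> HH.p2) \<circ> HHH.p1"
    using conv_hom[OF HHH.hom_fst assms(2), of "F \<circ> HH.p1" "G \<circ> HH.p2"] assms by (simp add: comp_assoc)
  then show ?thesis
    by (simp add: HHH.conv_fst_snd HH.conv_fst_snd assms)
qed

lemma conv_q_right:
  assumes "cbilinear f" "cbilinear g" "clinear F" "clinear G" "clinear H"
  shows "HHHC.kconv f (F \<circ> q1) (HHHC.kconv g (G \<circ> q2) (H \<circ> q3)) ((h \<otimes> k) \<otimes> m) = f (F h) (g (G k) (H m))"
proof -
  note l = assms(1,2)[THEN cbilinear_left] assms(1,2)[THEN cbilinear_right] clinear_ident
  \<comment> \<open>Bracketing on the right is reduced to bracketing on the left by taking the pair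
    \<open>x \<otimes> y\<close> as first argument.\<close>
  let ?f = "\<lambda>w z. tlift (\<lambda>x y. f x (g y z)) w"
  have b: "cbilinear ?f" by (intro lin l)
  have t: "?f (x \<otimes> y) z = f x (g y z)" for x y z by (subst tlift_tens) (intro lin l refl)+
  have "HHHC.kconv f (F \<circ> q1) (HHHC.kconv g (G \<circ> q2) (H \<circ> q3))
      = HHHC.kconv ?f (HHHC.kconv (\<otimes>) (F \<circ> q1) (G \<circ> q2)) (H \<circ> q3)"
    by (rule HHHC.conv_assoc) (simp_all add: assms b t)
  then show ?thesis
    by (simp only: conv_q_left b cbilinear_tens assms t)
qed

text \<open>For points this is associativity of the crossed product of an algebra with a group
  acting by automorphisms; the three projections and linearity in each argument give it for all
  elements.\<close>

lemma amult_assoc: "amult A x (amult A y z) = amult A (amult A x y) z"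
proof -
  interpret P: coalgebra_points \<Delta> \<epsilon> S "(\<triangleright>)" \<sigma> \<sigma>i HHH.\<Delta>\<Delta> HHH.\<epsilon>\<epsilon> by (rule points_HHH)
  write P.ktens (infixr "\<boxtimes>" 76)
  note [simp] = hom_q
  let ?m = "HHHC.kconv (amult A)"
  have eq: "?m (HHHC.kcst b \<boxtimes> q1) (?m (HHHC.kcst b' \<boxtimes> q2) (HHHC.kcst b'' \<boxtimes> q3))
    = ?m (?m (HHHC.kcst b \<boxtimes> q1) (HHHC.kcst b' \<boxtimes> q2)) (HHHC.kcst b'' \<boxtimes> q3)" for b b' b''
    by (simp add: P.amult_point P.kact_mult P.kact_kact HHHC.kmult_assoc P.point_mult)
  have "amult A (b \<otimes> h) (amult A (b' \<otimes> k) (b'' \<otimes> m)) = amult A (amult A (b \<otimes> h) (b' \<otimes> k)) (b'' \<otimes> m)"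
    for b b' b'' h k m
    using fun_cong[OF eq[of b b' b''], of "(h \<otimes> k) \<otimes> m"]
    by (simp add: HHHC.conv_kcst_left conv_q_left conv_q_right del: comp_apply)
  then have "amult A (b \<otimes> h) (amult A (b' \<otimes> k) z) = amult A (amult A (b \<otimes> h) (b' \<otimes> k)) z"
    for b b' h k
    using cbilinear_amult by (induction z rule: tensor_induct) (simp_all add: clinear_iff cbilinear_def)
  then have "amult A (b \<otimes> h) (amult A y z) = amult A (amult A (b \<otimes> h) y) z" for b h
    using cbilinear_amult by (induction y rule: tensor_induct) (simp_all add: clinear_iff cbilinear_def)
  then show ?thesis
    using cbilinear_amult by (induction x rule: tensor_induct) (simp_all add: clinear_iff cbilinear_def)
qed

lemma amult_incl_left: "amult A (e \<otimes> 1) (c \<otimes> g) = (e * c) \<otimes> g"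
  unfolding amult_tens sweedler2_def coproduct_one by (subst tlift_tens, intro lin) (simp add: one_act)

lemma amult_one_right: "amult A u (1 \<otimes> 1) = u"
proof -
  interpret P: coalgebra_points \<Delta> \<epsilon> S "(\<triangleright>)" \<sigma> \<sigma>i \<Delta> \<epsilon> by (rule points_H)
  write P.ktens (infixr "\<boxtimes>" 76)
  have id: "P.point (\<lambda>x. x)" by (rule coalgebra_hom_id) simp
  have "H.kconv (amult A) (H.kcst b \<boxtimes> (\<lambda>x. x)) (H.kcst 1 \<boxtimes> H.kcst 1) = H.kcst b \<boxtimes> (\<lambda>x. x)" for b
    by (subst P.amult_point) (simp_all add: id P.kact_one H.kmult_one_right)
  then have "amult A (b \<otimes> h) (1 \<otimes> 1) = b \<otimes> h" for b h
    by (simp add: H.conv_kcst_kcst) (simp add: H.conv_kcst_left H.conv_kcst_right fun_eq_iff)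
  then show ?thesis
    using cbilinear_amult by (induction u rule: tensor_induct) (simp_all add: clinear_iff cbilinear_def)
qed

section \<open>The canonical map of the extension and its inverse\<close>

lemma ext_balance_gen: "amult A a (e \<otimes> 1) \<otimes> a' - a \<otimes> amult A (e \<otimes> 1) a' \<in> ext_balance A"
  unfolding ext_balance_def by (rule complex_vector.span_base) auto

lemma clinear_galois_map_lift [simp]: "clinear (galois_map_lift A)"
  unfolding galois_map_lift_def by (intro lin clinear_acoact)

lemma galois_map_lift_tens:
  "galois_map_lift A (a \<otimes> a') = tlift (\<lambda>a0 h. amult A a a0 \<otimes> h) (acoact A a')"
  unfolding galois_map_lift_def by (subst tlift_tens) (intro lin clinear_acoact refl)+

lemma galois_map_lift_balance:
  assumes "n \<in> ext_balance A"
  shows "galois_map_lift A n = 0"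
proof -
  have gml: "galois_map_lift A (a \<otimes> (c \<otimes> g)) = sweedler2 \<Delta> (\<lambda>g1 g2. amult A a (c \<otimes> g1) \<otimes> g2) g" for a c g
    unfolding galois_map_lift_tens acoact_tens sweedler2_def
    by (subst tlift_compose[where L = "tlift _"], (intro lin)+, subst tlift_tens, (intro lin refl)+)
  have "galois_map_lift A (amult A a (e \<otimes> 1) \<otimes> a' - a \<otimes> amult A (e \<otimes> 1) a') = 0" for a e a'
  proof (induction a' rule: tensor_induct)
    case (tens c g)
    show ?case
      by (simp add: clinear_diff[OF clinear_galois_map_lift] gml amult_incl_left flip: amult_assoc)
  next
    case (add x y)
    then show ?case
      using cbilinear_amult by (simp add: clinear_iff[of "galois_map_lift A"] cbilinear_def clinear_iff
          clinear_diff[OF clinear_galois_map_lift] tens_add_right algebra_simps)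
        (simp add: clinear_add[OF clinear_galois_map_lift])
  next
    case (scale r x)
    then show ?case
      using bilinear_scaleC_right[OF cbilinear_amult]
      by (simp add: clinear_diff[OF clinear_galois_map_lift] tens_scaleC_right clinear_scaleC[OF clinear_galois_map_lift])
  qed
  \<comment> \<open>The span of the empty set is zero, so membership in it expresses vanishing on
    all relations.\<close>
  then have "galois_map_lift A n \<in> cspan {}"
    by (intro clinear_image_span[OF clinear_galois_map_lift _ assms[unfolded ext_balance_def aincl_eq]]) auto
  then show ?thesis by simp
qed

definition trans_lift :: "'h \<Rightarrow> ('b, 'h) smash_pair" where
  "trans_lift h = sweedler2 \<Delta> (\<lambda>h1 h2. (1 \<otimes> S h1) \<otimes> (1 \<otimes> h2)) h"

lemma clinear_trans_lift [simp]: "clinear trans_lift"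
  unfolding trans_lift_def sweedler2_def by (intro lin H.clinear_cop)

lemmas lin_trans_lift = clinear_trans_lift[THEN clinear_compose]

end

context coalgebra_points
begin

lemma trans_lift_point:
  assumes "point \<gamma>"
  shows "trans_lift \<circ> \<gamma> = (\<one> \<boxtimes> (S \<circ> \<gamma>)) \<boxtimes> (\<one> \<boxtimes> \<gamma>)"
proof -
  have b: "cbilinear (\<lambda>h1 h2. ((1 :: 'b) \<otimes> S h1) \<otimes> ((1 :: 'b) \<otimes> h2))" by (intro lin)
  show ?thesis
    using sweedler2_hom[OF assms b] assms
    by (simp add: trans_lift_def K.conv_kcst_left fun_eq_iff) (simp add: conv_def)
qed

text \<open>The canonical map takes the coaction of its right argument, so the arguments are swapped
  to apply \<open>conv_coact'\<close> and swapped back afterwards.\<close>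

lemma galois_conv:
  assumes "clinear X" "clinear F" "point \<eta>"
  shows "galois_map_lift A \<circ> (X \<boxtimes> (F \<boxtimes> \<eta>)) = K.kconv (amult A) X (F \<boxtimes> \<eta>) \<boxtimes> \<eta>"
proof -
  let ?g = "\<lambda>a' a. tlift (\<lambda>a0 h. amult A a a0 \<otimes> h) (acoact A a')"
  have b: "cbilinear ?g" "cbilinear (\<lambda>a a'. ?g a' a)" "cbilinear (\<lambda>h (z::('b,'h) tensor). z \<otimes> h)" "cbilinear (\<lambda>x y. amult A y x)"
    by (intro lin clinear_acoact)+
  have "galois_map_lift A \<circ> (X \<boxtimes> (F \<boxtimes> \<eta>)) = K.kconv (\<lambda>a a'. ?g a' a) X (F \<boxtimes> \<eta>)"
    unfolding galois_map_lift_def by (rule conv_tens[symmetric]) (use assms b in simp_all)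
  also have "\<dots> = K.kconv ?g (F \<boxtimes> \<eta>) X"
    by (rule K.conv_comm) (use assms b in simp_all)
  also have "\<dots> = K.kconv (\<lambda>h z. z \<otimes> h) \<eta> (K.kconv (\<lambda>x y. amult A y x) (F \<boxtimes> \<eta>) X)"
    by (rule K.conv_coact') (use assms b in \<open>simp_all add: acoact_point\<close>)
  also have "K.kconv (\<lambda>x y. amult A y x) (F \<boxtimes> \<eta>) X = K.kconv (amult A) X (F \<boxtimes> \<eta>)"
    by (rule K.conv_comm) (use assms b in simp_all)
  also have "K.kconv (\<lambda>h z. z \<otimes> h) \<eta> (K.kconv (amult A) X (F \<boxtimes> \<eta>)) = K.kconv (amult A) X (F \<boxtimes> \<eta>) \<boxtimes> \<eta>"
    by (rule K.conv_comm) (use assms b in simp_all)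
  finally show ?thesis .
qed

end

context central_crossed_product
begin

lemma galois_trans_lift: "galois_map_lift A (trans_lift h) = aone A \<otimes> h"
proof -
  interpret P: coalgebra_points \<Delta> \<epsilon> S "(\<triangleright>)" \<sigma> \<sigma>i \<Delta> \<epsilon> by (rule points_H)
  write P.ktens (infixr "\<boxtimes>" 76)
  have id: "P.point (\<lambda>x. x)" by (rule coalgebra_hom_id) simp
  note S = P.point_antipode[OF id] P.point_antipode_left[OF id]
  have "galois_map_lift A \<circ> (trans_lift \<circ> (\<lambda>x. x)) = H.kcst (1 \<otimes> 1) \<boxtimes> (\<lambda>x. x)"
    unfolding P.trans_lift_point[OF id]
    using id S by (simp add: P.galois_conv P.amult_point P.kact_one H.kmult_one_right H.conv_kcst_kcst)
  then show ?thesis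
    by (simp add: H.conv_kcst_left fun_eq_iff)
qed

text \<open>A left inverse modulo \<open>ext_balance A\<close> multiplies \<open>a\<close> from the
  left into the translation of \<open>h\<close>; this is \<open>\<theta>2\<close>. On the image of
  \<open>a \<otimes> (c # g)\<close> it gives \<open>a (c # 1) \<otimes> (1 # g)\<close>, which
  differs from the original by moving \<open>c\<close> across the balanced tensor.\<close>

lemma galois_map_lift_inj:
  assumes "galois_map_lift A x = galois_map_lift A y"
  shows "x - y \<in> ext_balance A"
proof -
  interpret P: coalgebra_points \<Delta> \<epsilon> S "(\<triangleright>)" \<sigma> \<sigma>i \<Delta> \<epsilon> by (rule points_H)
  write P.ktens (infixr "\<boxtimes>" 76)
  have id: "P.point (\<lambda>x. x)" by (rule coalgebra_hom_id) simp
  note S = P.point_antipode[OF id] P.point_antipode_right[OF id]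
  define \<theta>2 where "\<theta>2 = (\<lambda>a h. tlift (\<lambda>u v. amult A a u \<otimes> v) (trans_lift h))"
  let ?t = "\<lambda>a w. tlift (\<lambda>u (v :: ('b, 'h) tensor). amult A a u \<otimes> v) w"
  have b: "cbilinear \<theta>2" "cbilinear ?t"
    unfolding \<theta>2_def by (intro lin lin_trans_lift)+
  have gen: "tlift \<theta>2 (galois_map_lift A (a \<otimes> (c \<otimes> g))) = amult A a (c \<otimes> 1) \<otimes> (1 \<otimes> g)" for a c g
  proof -
    let ?Z = "H.kconv (amult A) (H.kcst a) (H.kcst c \<boxtimes> (\<lambda>x. x))"
    have "tlift \<theta>2 \<circ> (galois_map_lift A \<circ> (H.kcst a \<boxtimes> (H.kcst c \<boxtimes> (\<lambda>x. x)))) = H.kconv \<theta>2 ?Z (\<lambda>x. x)"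
      by (subst P.galois_conv) (use id b in \<open>simp_all add: conv_tens[of \<theta>2]\<close>)
    also have "\<dots> = H.kconv ?t ?Z (trans_lift \<circ> (\<lambda>x. x))"
      by (simp add: conv_def \<theta>2_def)
    also have "\<dots> = H.kconv (amult A) ?Z (H.kcst 1 \<boxtimes> (S \<circ> (\<lambda>x. x))) \<boxtimes> (H.kcst 1 \<boxtimes> (\<lambda>x. x))"
      unfolding P.trans_lift_point[OF id]
      by (rule H.conv_assoc) (use b in simp_all, subst tlift_tens, (intro lin refl)+)
    also have "H.kconv (amult A) ?Z (H.kcst 1 \<boxtimes> (S \<circ> (\<lambda>x. x)))
        = H.kconv (amult A) (H.kcst a) (H.kconv (amult A) (H.kcst c \<boxtimes> (\<lambda>x. x)) (H.kcst 1 \<boxtimes> (S \<circ> (\<lambda>x. x))))"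
      by (rule H.conv_assoc[symmetric]) (simp_all add: amult_assoc)
    also have "\<dots> = H.kcst (amult A a (c \<otimes> 1))"
      using id S by (simp add: P.amult_point P.kact_one H.kmult_one_right H.conv_kcst_kcst)
    finally show ?thesis
      by (simp add: H.conv_kcst_left fun_eq_iff)
  qed
  have "tlift \<theta>2 (galois_map_lift A (a \<otimes> (c \<otimes> g))) - a \<otimes> (c \<otimes> g) \<in> ext_balance A" for a c g
    using ext_balance_gen[of a c "1 \<otimes> g"] by (simp add: gen amult_incl_left)
  moreover have l: "clinear (\<lambda>w. tlift \<theta>2 (galois_map_lift A (f w)) - f w)" if "clinear f" for f :: "'z::complex_vector \<Rightarrow> _"
    by (intro lin that clinear_galois_map_lift[THEN clinear_compose] b(1)[unfolded cbilinear_def, THEN conjunct1, rule_format]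
        b(1)[unfolded cbilinear_def, THEN conjunct2, rule_format])
  ultimately have "tlift \<theta>2 (galois_map_lift A (a \<otimes> v)) - a \<otimes> v \<in> ext_balance A" for a v
    unfolding ext_balance_def
    by (rule clinear_tensor_in_span[where L = "\<lambda>v. tlift \<theta>2 (galois_map_lift A (a \<otimes> v)) - a \<otimes> v", rotated])
      (rule l clinear_tens_right)+
  then have inv: "tlift \<theta>2 (galois_map_lift A w) - w \<in> ext_balance A" for w
    unfolding ext_balance_def
    by (rule clinear_tensor_in_span[where L = "\<lambda>w. tlift \<theta>2 (galois_map_lift A w) - w", rotated])
      (rule l clinear_ident)+
  have "x - y = (tlift \<theta>2 (galois_map_lift A y) - y) - (tlift \<theta>2 (galois_map_lift A x) - x)"
    using assms by simp
  then show ?thesis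
    using inv[of x] inv[of y] unfolding ext_balance_def by (simp only: complex_vector.span_diff)
qed

lemma coset_ext_balance_eq_iff:
  "coset (ext_balance A) v = coset (ext_balance A) w \<longleftrightarrow> v - w \<in> ext_balance A"
  unfolding ext_balance_def by (rule coset_eq_iff)

lemma galois_map_coset: "galois_map A (coset (ext_balance A) x) = galois_map_lift A x"
proof -
  have "galois_map_lift A w = galois_map_lift A x" if "w \<in> coset (ext_balance A) x" for w
    using galois_map_lift_balance[of "w - x"] that
    by (simp add: coset_def clinear_diff[OF clinear_galois_map_lift])
  moreover have "x \<in> coset (ext_balance A) x"
    by (simp add: coset_def ext_balance_def complex_vector.span_zero)
  ultimately have "galois_map_lift A ` coset (ext_balance A) x = {galois_map_lift A x}"
    by blast
  then show ?thesis by (simp add: galois_map_def)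
qed

text \<open>Injectivity of the canonical map on cosets makes the value of \<open>inv_into\<close>
  unique, and the coset of \<open>trans_lift h\<close> has the required image.\<close>

lemma translation_map_eq: "translation_map A h = coset (ext_balance A) (trans_lift h)"
proof -
  have "inj_on (galois_map A) (range (coset (ext_balance A)))"
    by (auto simp: inj_on_def galois_map_coset coset_ext_balance_eq_iff intro: galois_map_lift_inj)
  then show ?thesis
    unfolding translation_map_def
    by (intro inv_into_f_eq) (simp_all add: galois_map_coset galois_trans_lift del: aone_eq)
qed

text \<open>The lift is chosen by \<open>SOME\<close>: a linear choice exists, witnessed by
  \<open>trans_lift\<close>, and any choice differs from it only by relations.\<close>

lemma translation_lift: "clinear (translation_lift A)"
    "translation_lift A h - trans_lift h \<in> ext_balance A"
proof -
  have "clinear trans_lift \<and> (\<forall>h. trans_lift h \<in> translation_map A h)"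
    by (simp add: translation_map_eq coset_def ext_balance_def complex_vector.span_zero)
  then have "clinear (translation_lift A) \<and> (\<forall>h. translation_lift A h \<in> translation_map A h)"
    unfolding translation_lift_def
    by (rule someI[where P = "\<lambda>T. clinear T \<and> (\<forall>h. T h \<in> translation_map A h)"])
  then show "clinear (translation_lift A)" "translation_lift A h - trans_lift h \<in> ext_balance A"
    by (simp_all add: translation_map_eq coset_def)
qed

end

section \<open>The Ehresmann--Schauenburg bialgebroid\<close>

context central_crossed_product
begin

text \<open>By associativity, right multiplication on the last factor respects the relations; needed
  to exchange lifts inside the coinvariance condition.\<close>

lemma ext_balance_mult_right:
  assumes "n \<in> ext_balance A"
  shows "tlift (\<lambda>u v. u \<otimes> amult A v c) n \<in> ext_balance A"
  unfolding ext_balance_def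
proof (rule clinear_image_span[OF _ _ assms[unfolded ext_balance_def]])
  let ?F = "\<lambda>u v. u \<otimes> amult A v c"
  have F: "cbilinear ?F" by (intro lin)
  show "clinear (tlift ?F)" by (rule clinear_tlift[OF F])
  fix x assume "x \<in> {amult A a (aincl A b) \<otimes> a' - a \<otimes> amult A (aincl A b) a' | a b a'. True}"
  then obtain a b a' where x: "x = amult A a (b \<otimes> 1) \<otimes> a' - a \<otimes> amult A (b \<otimes> 1) a'"
    by auto
  have "tlift ?F x = amult A a (b \<otimes> 1) \<otimes> amult A a' c - a \<otimes> amult A (b \<otimes> 1) (amult A a' c)"
    by (simp add: x clinear_diff[OF clinear_tlift[OF F]] tlift_tens[OF F] amult_assoc)
  then show "tlift ?F x \<in> cspan {amult A a (aincl A b) \<otimes> a' - a \<otimes> amult A (aincl A b) a' | a b a'. True}"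
    using ext_balance_gen[of a b "amult A a' c"] by (simp add: ext_balance_def)
qed

text \<open>The lift \<open>T\<close> is a parameter, so that the chosen lift can be compared with
  the explicit one modulo relations.\<close>

definition es_left ::
    "('h \<Rightarrow> ('b, 'h) smash_pair) \<Rightarrow> ('b, 'h) tensor \<Rightarrow> ('b, 'h) tensor
      \<Rightarrow> (('b, 'h) tensor, ('b, 'h) smash_pair) tensor" where
  "es_left T a c = tlift (\<lambda>a0 h. a0 \<otimes> tlift (\<lambda>u v. u \<otimes> amult A v c) (T h)) (acoact A a)"

definition es_right ::
    "('b, 'h) tensor \<Rightarrow> ('b, 'h) tensor \<Rightarrow> (('b, 'h) tensor, ('b, 'h) smash_pair) tensor" where
  "es_right a c = a \<otimes> (c \<otimes> aone A)"

definition es_relations :: "(('b, 'h) tensor, ('b, 'h) smash_pair) tensor set" where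
  "es_relations = cspan {a \<otimes> n | a n. n \<in> ext_balance A}"

definition es_coprod_lift ::
    "('h \<Rightarrow> ('b, 'h) smash_pair) \<Rightarrow> ('b, 'h) tensor \<Rightarrow> ('b, 'h) tensor
      \<Rightarrow> (('b, 'h) smash_pair, ('b, 'h) smash_pair) tensor" where
  "es_coprod_lift T a c = tlift (\<lambda>a0 h. tlift (\<lambda>u v. (a0 \<otimes> u) \<otimes> (v \<otimes> c)) (T h)) (acoact A a)"

lemma cbilinear_es_left: "clinear T \<Longrightarrow> cbilinear (es_left T)"
  unfolding es_left_def by (intro lin clinear_acoact | erule clinear_compose)+

lemma cbilinear_es_right: "cbilinear es_right"
  unfolding es_right_def by (intro lin)

lemma cbilinear_es_coprod_lift: "clinear T \<Longrightarrow> cbilinear (es_coprod_lift T)"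
  unfolding es_coprod_lift_def by (intro lin clinear_acoact | erule clinear_compose)+

lemma es_relations_gen: "n \<in> ext_balance A \<Longrightarrow> a \<otimes> n \<in> es_relations"
  unfolding es_relations_def by (rule complex_vector.span_base) blast

lemma es_left_translation_lift:
  "tlift (es_left (translation_lift A)) x - tlift (es_left trans_lift) x \<in> es_relations"
  unfolding es_relations_def
proof (rule tlift_diff_in_span[OF cbilinear_es_left cbilinear_es_left])
  note T = translation_lift(1)[THEN clinear_compose] clinear_trans_lift[THEN clinear_compose]
  fix a c
  show "es_left (translation_lift A) a c - es_left trans_lift a c \<in> cspan {a \<otimes> n | a n. n \<in> ext_balance A}"
    unfolding es_left_def
  proof (rule tlift_diff_in_span)
    fix a0 :: "('b, 'h) tensor" and h
    let ?L = "tlift (\<lambda>u v. u \<otimes> amult A v c)"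
    have L: "clinear ?L" by (intro lin)
    have "?L (translation_lift A h - trans_lift h) \<in> ext_balance A"
      by (rule ext_balance_mult_right[OF translation_lift(2)])
    then show "a0 \<otimes> ?L (translation_lift A h) - a0 \<otimes> ?L (trans_lift h) \<in> cspan {a \<otimes> n | a n. n \<in> ext_balance A}"
      using es_relations_gen[of "?L (translation_lift A h - trans_lift h)" a0]
      by (simp add: es_relations_def clinear_diff[OF L] clinear_diff[OF clinear_tens_right])
  qed (intro lin T)+
qed (rule translation_lift clinear_trans_lift)+

lemma es_coprod_lift_translation_lift:
  "tlift (es_coprod_lift (translation_lift A)) x - tlift (es_coprod_lift trans_lift) x \<in> es_middle_balance A"
  unfolding es_middle_balance_def
proof (rule tlift_diff_in_span[OF cbilinear_es_coprod_lift cbilinear_es_coprod_lift])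
  note T = translation_lift(1)[THEN clinear_compose] clinear_trans_lift[THEN clinear_compose]
  fix a c
  show "es_coprod_lift (translation_lift A) a c - es_coprod_lift trans_lift a c
    \<in> cspan {tlift (\<lambda>u v. (p \<otimes> u) \<otimes> v \<otimes> q) n |p q n. n \<in> ext_balance A}"
    unfolding es_coprod_lift_def
  proof (rule tlift_diff_in_span)
    fix a0 :: "('b, 'h) tensor" and h
    let ?L = "tlift (\<lambda>u v. (a0 \<otimes> u) \<otimes> (v \<otimes> c))"
    have L: "clinear ?L" by (intro lin)
    have "?L (translation_lift A h - trans_lift h)
      \<in> cspan {tlift (\<lambda>u v. (p \<otimes> u) \<otimes> v \<otimes> q) n |p q n. n \<in> ext_balance A}"
      using translation_lift(2)[of h] by (intro complex_vector.span_base) blast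
    then show "?L (translation_lift A h) - ?L (trans_lift h)
      \<in> cspan {tlift (\<lambda>u v. (p \<otimes> u) \<otimes> v \<otimes> q) n |p q n. n \<in> ext_balance A}"
      by (simp add: clinear_diff[OF L])
  qed (intro lin T)+
qed (rule translation_lift clinear_trans_lift)+

lemma es_carrier_iff: "x \<in> es_carrier A \<longleftrightarrow> tlift (es_left trans_lift) x - tlift es_right x \<in> es_relations"
proof -
  have "x \<in> es_carrier A \<longleftrightarrow> tlift (es_left (translation_lift A)) x - tlift es_right x \<in> es_relations"
    unfolding es_carrier_def es_left_def es_right_def es_relations_def by simp
  also have "tlift (es_left (translation_lift A)) x - tlift es_right x
    = (tlift (es_left (translation_lift A)) x - tlift (es_left trans_lift) x)
      + (tlift (es_left trans_lift) x - tlift es_right x)"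
    by simp
  also have "\<dots> \<in> es_relations \<longleftrightarrow> tlift (es_left trans_lift) x - tlift es_right x \<in> es_relations"
    using es_left_translation_lift[of x] unfolding es_relations_def by (rule complex_vector.span_add_eq)
  finally show ?thesis .
qed

text \<open>On the tensor square of A over B this is the identification with A \<otimes> H sending
  \<open>u \<otimes> (c # g)\<close> to \<open>u (c # 1) \<otimes> g\<close>, followed by
  \<open>base_part\<close> on the first factor.\<close>

definition act_mult :: "('b, 'h) tensor \<Rightarrow> ('b, 'h) tensor \<Rightarrow> ('b, 'h) tensor" where
  "act_mult u v = tlift (\<lambda>c g. twisted_act u c \<otimes> g) v"

lemma cbilinear_act_mult [simp]: "cbilinear act_mult"
  unfolding act_mult_def
  by (intro lin cbilinear_twisted_act[THEN cbilinear_left] cbilinear_twisted_act[THEN cbilinear_right])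

lemmas lin_act_mult = cbilinear_act_mult[THEN cbilinear_left] cbilinear_act_mult[THEN cbilinear_right]

lemma act_mult_tens: "act_mult u (c \<otimes> g) = twisted_act u c \<otimes> g"
  unfolding act_mult_def
  by (subst tlift_tens)
    (intro lin refl cbilinear_twisted_act[THEN cbilinear_left] cbilinear_twisted_act[THEN cbilinear_right])+

text \<open>An instance of the module law for B, supplied by the measuring condition; it makes
  \<open>act_mult\<close> balanced.\<close>

lemma twisted_act_amult: "twisted_act (amult A u (e \<otimes> 1)) c = twisted_act u (e * c)"
proof -
  note l = cbilinear_twisted_act[THEN cbilinear_left]
  have "twisted_act (amult A (b \<otimes> k) (e \<otimes> 1)) c = twisted_act (b \<otimes> k) (e * c)" for b k
  proof -
    have "twisted_act (amult A (b \<otimes> k) (e \<otimes> 1)) c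
        = sweedler2 \<Delta> (\<lambda>k1 k2. twisted_act ((b * (k1 \<triangleright> e)) \<otimes> (k2 * 1)) c) k"
      unfolding amult_tens sweedler2_def by (rule tlift_compose[where L = "\<lambda>u. twisted_act u c"]) (intro lin l)+
    also have "\<dots> = sweedler2 \<Delta> (\<lambda>k1 k2. b * ((k1 \<triangleright> e) * (k2 \<triangleright> c))) k"
      by (simp add: twisted_act_tens mult.assoc)
    also have "\<dots> = b * (k \<triangleright> (e * c))"
      unfolding measures_mult sweedler2_def by (rule tlift_compose[symmetric]) (intro lin)+
    finally show ?thesis by (simp add: twisted_act_tens)
  qed
  then show ?thesis
    using cbilinear_amult cbilinear_twisted_act
    by (induction u rule: tensor_induct) (simp_all add: clinear_iff cbilinear_def)
qed

lemma act_mult_balance: "n \<in> ext_balance A \<Longrightarrow> tlift act_mult n = 0"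
proof -
  assume n: "n \<in> ext_balance A"
  have "act_mult (amult A a (e \<otimes> 1)) v = act_mult a (amult A (e \<otimes> 1) v)" for a e v
    using cbilinear_amult cbilinear_act_mult
    by (induction v rule: tensor_induct)
      (simp_all add: act_mult_tens twisted_act_amult amult_incl_left clinear_iff cbilinear_def)
  then have "tlift act_mult n \<in> cspan {}"
    by (intro clinear_image_span[OF clinear_tlift[OF cbilinear_act_mult] _ n[unfolded ext_balance_def]])
      (auto simp: clinear_diff[OF clinear_tlift[OF cbilinear_act_mult]] tlift_tens)
  then show ?thesis by simp
qed

lemma twisted_act_one: "twisted_act v 1 = base_part v"
proof -
  have "clinear (\<lambda>v. twisted_act v 1)" using cbilinear_twisted_act by (simp add: cbilinear_def)
  then have "(\<lambda>v. twisted_act v 1) = base_part"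
    by (rule clinear_tensor_eqI) (simp_all add: twisted_act_tens base_part_tens measures_one scaleC_mult_right)
  then show ?thesis by (simp add: fun_eq_iff)
qed

definition group_mult :: "'h \<Rightarrow> ('b, 'h) tensor \<Rightarrow> ('b, 'h) tensor" where
  "group_mult h w = tlift (\<lambda>b g. b \<otimes> (h * g)) w"

lemma cbilinear_group_mult [simp]: "cbilinear group_mult"
  unfolding group_mult_def by (intro lin)

lemma group_mult_tens: "group_mult h (b \<otimes> g) = b \<otimes> (h * g)"
  unfolding group_mult_def by (subst tlift_tens) (intro lin refl)+

text \<open>Built to undo the left side of the coinvariance condition: the coaction on
  \<open>a\<close> is taken once more, and its antipode cancels the Hopf component introduced by the
  translation map. On the right side the same map produces \<open>proj\<close>.\<close>

definition unwind2 where
  "unwind2 a z = tlift (\<lambda>a0 h. a0 \<otimes> group_mult (S h) (tlift act_mult z)) (acoact A a)"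

lemmas lin_group_mult = cbilinear_group_mult[THEN cbilinear_left] cbilinear_group_mult[THEN cbilinear_right]

lemma cbilinear_unwind2: "cbilinear unwind2"
  unfolding unwind2_def by (intro lin lin_group_mult clinear_acoact lin_act_mult)

lemma unwind_relations: "n \<in> es_relations \<Longrightarrow> tlift unwind2 n = 0"
proof -
  assume n: "n \<in> es_relations"
  have "tlift unwind2 n \<in> cspan {}"
  proof (rule clinear_image_span[OF clinear_tlift[OF cbilinear_unwind2] _ n[unfolded es_relations_def]])
    fix x :: "(('b, 'h) tensor, ('b, 'h) smash_pair) tensor"
    assume "x \<in> {a \<otimes> n | a n. n \<in> ext_balance A}"
    then obtain a n where x: "x = a \<otimes> n" "n \<in> ext_balance A" by blast
    have "group_mult h 0 = 0" for h
      using cbilinear_group_mult by (intro clinear_zero) (simp add: cbilinear_def)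
    then have "tlift unwind2 x = tlift (\<lambda>a0 h. a0 \<otimes> 0) (acoact A a)"
      by (simp add: x tlift_tens cbilinear_unwind2 unwind2_def act_mult_balance)
    also have "\<dots> \<in> cspan {}"
      by (rule tlift_in_span) (intro lin clinearI, simp_all add: clinear_zero[OF clinear_tens_right])
    finally show "tlift unwind2 x \<in> cspan {}" .
  qed
  then show ?thesis by simp
qed

lemma unwind_es_right: "tlift unwind2 (tlift es_right x) = proj x"
proof -
  have l: "clinear (\<lambda>x. tlift unwind2 (tlift es_right x))"
    by (rule clinear_compose[OF clinear_tlift[OF cbilinear_unwind2] clinear_tlift[OF cbilinear_es_right]])
  have "(\<lambda>x. tlift unwind2 (tlift es_right x)) = proj"
    by (rule clinear_tensor_eqI[OF l clinear_proj])
      (simp add: tlift_tens cbilinear_unwind2 cbilinear_es_right es_right_def unwind2_def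
        act_mult_tens twisted_act_one group_mult_tens proj_tens proj2_def)
  then show ?thesis by (simp add: fun_eq_iff)
qed

end

context coalgebra_points
begin

lemma twisted_act_conv:
  assumes "clinear F" "clinear \<kappa>" "clinear G"
  shows "K.kconv twisted_act (F \<boxtimes> \<kappa>) G = F \<odot> (\<kappa> \<unrhd> G)"
  by (rule K.conv_assoc[symmetric]) (simp_all add: assms twisted_act_tens)

lemma act_mult_conv:
  assumes "clinear F" "clinear \<kappa>" "clinear G" "clinear \<eta>"
  shows "tlift act_mult \<circ> ((F \<boxtimes> \<kappa>) \<boxtimes> (G \<boxtimes> \<eta>)) = (F \<odot> (\<kappa> \<unrhd> G)) \<boxtimes> \<eta>"
proof -
  have "tlift act_mult \<circ> ((F \<boxtimes> \<kappa>) \<boxtimes> (G \<boxtimes> \<eta>)) = K.kconv act_mult (F \<boxtimes> \<kappa>) (G \<boxtimes> \<eta>)"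
    by (rule conv_tens[symmetric]) (simp_all add: assms)
  also have "\<dots> = K.kconv twisted_act (F \<boxtimes> \<kappa>) G \<boxtimes> \<eta>"
    by (rule K.conv_assoc) (simp_all add: assms act_mult_tens)
  finally show ?thesis by (simp add: twisted_act_conv assms)
qed

lemma es_left_conv:
  assumes "clinear F" "clinear Y" "point \<gamma>"
  shows "tlift (es_left trans_lift) \<circ> ((F \<boxtimes> \<gamma>) \<boxtimes> Y)
    = (F \<boxtimes> \<gamma>) \<boxtimes> ((\<one> \<boxtimes> (S \<circ> \<gamma>)) \<boxtimes> K.kconv (amult A) (\<one> \<boxtimes> \<gamma>) Y)"
proof -
  let ?h = "\<lambda>w c. tlift (\<lambda>(u :: ('b, 'h) tensor) v. u \<otimes> amult A v c) w"
  have b: "cbilinear ?h" "cbilinear (\<lambda>h c. ?h (trans_lift h) c)"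
    by (intro lin lin_trans_lift)+
  have "tlift (es_left trans_lift) \<circ> ((F \<boxtimes> \<gamma>) \<boxtimes> Y) = K.kconv (es_left trans_lift) (F \<boxtimes> \<gamma>) Y"
    by (rule conv_tens[symmetric]) (simp_all add: assms cbilinear_es_left)
  also have "\<dots> = (F \<boxtimes> \<gamma>) \<boxtimes> K.kconv (\<lambda>h c. ?h (trans_lift h) c) \<gamma> Y"
    unfolding es_left_def by (rule K.conv_coact) (simp_all add: assms b acoact_point)
  also have "K.kconv (\<lambda>h c. ?h (trans_lift h) c) \<gamma> Y = K.kconv ?h (trans_lift \<circ> \<gamma>) Y"
    by (simp add: conv_def)
  also have "\<dots> = (\<one> \<boxtimes> (S \<circ> \<gamma>)) \<boxtimes> K.kconv (amult A) (\<one> \<boxtimes> \<gamma>) Y"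
    unfolding trans_lift_point[OF assms(3)]
    by (rule K.conv_assoc[symmetric]) (simp_all add: assms b, subst tlift_tens, (intro lin refl)+)
  finally show ?thesis .
qed

lemma es_right_conv:
  assumes "clinear X" "clinear Y"
  shows "tlift es_right \<circ> (X \<boxtimes> Y) = X \<boxtimes> (Y \<boxtimes> K.kcst (1 \<otimes> 1))"
proof -
  have "tlift es_right \<circ> (X \<boxtimes> Y) = K.kconv es_right X Y"
    by (rule conv_tens[symmetric]) (simp_all add: assms cbilinear_es_right)
  also have "\<dots> = X \<boxtimes> ((\<lambda>c. c \<otimes> (1 \<otimes> 1)) \<circ> Y)"
    by (simp add: conv_def es_right_def)
  finally show ?thesis by (simp add: K.conv_kcst_right assms)
qed

lemma unwind_conv:
  assumes "clinear F" "clinear G" "clinear \<kappa>" "clinear F'" "clinear \<eta>" "point \<gamma>"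
  shows "tlift unwind2 \<circ> ((F \<boxtimes> \<gamma>) \<boxtimes> ((G \<boxtimes> \<kappa>) \<boxtimes> (F' \<boxtimes> \<eta>)))
    = (F \<boxtimes> \<gamma>) \<boxtimes> ((G \<odot> (\<kappa> \<unrhd> F')) \<boxtimes> ((S \<circ> \<gamma>) \<odot> \<eta>))"
proof -
  let ?f = "\<lambda>h z. group_mult (S h) (tlift act_mult z)"
  let ?Z = "(G \<boxtimes> \<kappa>) \<boxtimes> (F' \<boxtimes> \<eta>)"
  have b: "cbilinear ?f"
    by (intro lin lin_group_mult lin_act_mult)
  have "tlift unwind2 \<circ> ((F \<boxtimes> \<gamma>) \<boxtimes> ?Z) = K.kconv unwind2 (F \<boxtimes> \<gamma>) ?Z"
    by (rule conv_tens[symmetric]) (simp_all add: assms cbilinear_unwind2)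
  also have "\<dots> = (F \<boxtimes> \<gamma>) \<boxtimes> K.kconv ?f \<gamma> ?Z"
    unfolding unwind2_def by (rule K.conv_coact) (simp_all add: assms b acoact_point)
  also have "K.kconv ?f \<gamma> ?Z = K.kconv group_mult (S \<circ> \<gamma>) (tlift act_mult \<circ> ?Z)"
    by (simp add: conv_def)
  also have "\<dots> = K.kconv group_mult (S \<circ> \<gamma>) ((G \<odot> (\<kappa> \<unrhd> F')) \<boxtimes> \<eta>)"
    by (simp add: act_mult_conv assms)
  also have "\<dots> = K.kconv group_mult (S \<circ> \<gamma>) (K.kconv (\<lambda>g b. b \<otimes> g) \<eta> (G \<odot> (\<kappa> \<unrhd> F')))"
  proof -
    have "(G \<odot> (\<kappa> \<unrhd> F')) \<boxtimes> \<eta> = K.kconv (\<lambda>g b. b \<otimes> g) \<eta> (G \<odot> (\<kappa> \<unrhd> F'))"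
      by (rule K.conv_comm) (simp_all add: assms)
    then show ?thesis by simp
  qed
  also have "\<dots> = K.kconv (\<lambda>g b. b \<otimes> g) ((S \<circ> \<gamma>) \<odot> \<eta>) (G \<odot> (\<kappa> \<unrhd> F'))"
    by (rule K.conv_assoc) (simp_all add: assms group_mult_tens cbilinearI)
  also have "\<dots> = (G \<odot> (\<kappa> \<unrhd> F')) \<boxtimes> ((S \<circ> \<gamma>) \<odot> \<eta>)"
    by (rule K.conv_comm) (simp_all add: assms cbilinearI)
  finally show ?thesis .
qed

text \<open>For a point the translation map contributes the legs \<open>S \<circ> \<gamma>\<close>
  and \<open>\<gamma>\<close>, which join the outer legs. So the coefficient \<open>F\<close> stays
  in the left factor and \<open>G\<close> in the right one.\<close>

lemma es_coprod_lift_kelem: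
  assumes "clinear F" "clinear G" "point \<gamma>"
  shows "tlift (es_coprod_lift trans_lift) \<circ> kelem F G \<gamma> = kelem F \<one> \<gamma> \<boxtimes> kelem \<one> G \<gamma>"
proof -
  let ?Y = "G \<boxtimes> (S \<circ> \<gamma>)"
  \<comment> \<open>The expression with four legs is split into two nested bilinear maps, the shape
    required by \<open>conv_coact\<close>.\<close>
  let ?f1 = "\<lambda>(a0 :: ('b, 'h) tensor) w. tlift (\<lambda>(u :: ('b, 'h) tensor) (z :: ('b, 'h) smash_pair). (a0 \<otimes> u) \<otimes> z) w"
  let ?h = "\<lambda>w c. tlift (\<lambda>(u :: ('b, 'h) tensor) (v :: ('b, 'h) tensor). u \<otimes> (v \<otimes> (c :: ('b, 'h) tensor))) w"
  have b: "cbilinear ?f1" "cbilinear ?h" "cbilinear (\<lambda>h c. ?h (trans_lift h) c)"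
    by (intro lin lin_trans_lift)+
  have Y: "clinear ?Y" by (simp add: assms)
  have "?f1 a0 (?h w c) = tlift (\<lambda>u v. (a0 \<otimes> u) \<otimes> (v \<otimes> c)) w" for a0 w c
    by (subst tlift_compose[where L = "?f1 a0"], (intro lin)+, subst tlift_tens, (intro lin refl)+)
  then have eq: "es_coprod_lift trans_lift = (\<lambda>a c. tlift (\<lambda>a0 h. ?f1 a0 (?h (trans_lift h) c)) (acoact A a))"
    by (simp add: es_coprod_lift_def fun_eq_iff)
  have "tlift (es_coprod_lift trans_lift) \<circ> kelem F G \<gamma> = K.kconv (es_coprod_lift trans_lift) (F \<boxtimes> \<gamma>) ?Y"
    by (rule conv_tens[symmetric]) (simp_all add: assms cbilinear_es_coprod_lift)
  also have "\<dots> = K.kconv ?f1 (F \<boxtimes> \<gamma>) (K.kconv (\<lambda>h c. ?h (trans_lift h) c) \<gamma> ?Y)"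
    unfolding eq by (rule K.conv_coact) (rule Y b | simp add: assms acoact_point)+
  also have "K.kconv (\<lambda>h c. ?h (trans_lift h) c) \<gamma> ?Y = K.kconv ?h (trans_lift \<circ> \<gamma>) ?Y"
    by (simp add: conv_def)
  also have "\<dots> = (\<one> \<boxtimes> (S \<circ> \<gamma>)) \<boxtimes> ((\<one> \<boxtimes> \<gamma>) \<boxtimes> ?Y)"
    unfolding trans_lift_point[OF assms(3)]
    by (rule K.conv_assoc[symmetric]) (simp_all add: assms b, subst tlift_tens, (intro lin refl)+)
  also have "K.kconv ?f1 (F \<boxtimes> \<gamma>) \<dots> = kelem F \<one> \<gamma> \<boxtimes> kelem \<one> G \<gamma>"
    by (rule K.conv_assoc) (simp_all add: assms b, subst tlift_tens, (intro lin refl)+)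
  finally show ?thesis .
qed

text \<open>Evaluated pointwise, this puts all values of \<open>kelem\<close> into the image of
  \<open>proj\<close>.\<close>

lemma proj_kelem:
  assumes "clinear F" "clinear G" "point \<gamma>"
  shows "proj \<circ> kelem F G \<gamma> = kelem F G \<gamma>"
proof -
  have "proj \<circ> kelem F G \<gamma> = K.kconv proj2 (F \<boxtimes> \<gamma>) (G \<boxtimes> (S \<circ> \<gamma>))"
    unfolding proj_def by (rule conv_tens[symmetric]) (simp_all add: assms)
  also have "\<dots> = kelem F G \<gamma>"
    using assms by (intro proj_conv) (simp_all add: point_antipode point_counit)
  finally show ?thesis .
qed

lemma conv_amult_incl:
  assumes "clinear U" "clinear L"
  shows "K.kconv (\<lambda>u e. amult A u (e \<otimes> 1) \<otimes> z) U L = K.kconv (amult A) U (L \<boxtimes> \<one>) \<boxtimes> K.kcst z"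
proof -
  have m: "cbilinear (\<lambda>u e. amult A u (e \<otimes> 1))" by (intro lin)
  have "K.kconv (\<lambda>u e. amult A u (e \<otimes> 1) \<otimes> z) U L = (\<lambda>u. u \<otimes> z) \<circ> K.kconv (\<lambda>u e. amult A u (e \<otimes> 1)) U L"
    by (rule conv_compose[symmetric]) (simp_all add: m assms)
  also have "K.kconv (\<lambda>u e. amult A u (e \<otimes> 1)) U L = K.kconv (amult A) U ((\<lambda>e. e \<otimes> 1) \<circ> L)"
    by (simp add: conv_def)
  also have "(\<lambda>e. e \<otimes> 1) \<circ> L = L \<boxtimes> \<one>"
    by (rule K.conv_kcst_right[symmetric]) (simp_all add: assms)
  also have "(\<lambda>u. u \<otimes> z) \<circ> K.kconv (amult A) U (L \<boxtimes> \<one>) = K.kconv (amult A) U (L \<boxtimes> \<one>) \<boxtimes> K.kcst z"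
    by (rule K.conv_kcst_right[symmetric]) (simp_all add: assms)
  finally show ?thesis .
qed

end

section \<open>The carrier and the coproduct of the bialgebroid\<close>

context central_crossed_product
begin

abbreviation elem :: "'b \<Rightarrow> 'b \<Rightarrow> 'h \<Rightarrow> ('b, 'h) smash_pair" where
  "elem \<equiv> smash_elem \<Delta> S"

lemma lin_elem [lin]: "clinear f \<Longrightarrow> clinear (\<lambda>x. elem b b' (f x))"
  unfolding smash_elem_def sweedler2_def by (intro lin H.clinear_cop)

lemma id_point: "coalgebra_hom \<Delta> \<epsilon> \<Delta> \<epsilon> (\<lambda>x. x)"
  by (rule coalgebra_hom_id) simp

lemma elem_kelem: "coalgebra_points.kelem S \<Delta> (H.kcst b) (H.kcst b') (\<lambda>x. x) = elem b b'"
  using coalgebra_points.kelem_smash_elem[OF points_H id_point, of b b'] by (simp add: comp_def)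

definition elems where "elems = {elem b b' h | b b' h. True}"

lemma elems_I [simp]: "elem b b' h \<in> elems"
  unfolding elems_def by blast

lemma proj2_elem: "proj2 (b \<otimes> h) v = elem b (base_part v) h"
  unfolding proj2_def acoact_tens smash_elem_def sweedler2_def
  by (subst tlift_compose[where L = "tlift _"], (intro lin)+, subst tlift_tens, (intro lin refl)+)

lemma proj_in_span: "proj w \<in> cspan elems"
proof (rule clinear_tensor_in_span[OF clinear_proj])
  fix u v
  show "proj (u \<otimes> v) \<in> cspan elems"
    unfolding proj_tens
    by (rule clinear_tensor_in_span[where L = "\<lambda>u. proj2 u v"])
      (use cbilinear_proj2 in \<open>auto simp: cbilinear_def proj2_elem intro: complex_vector.span_base\<close>)
qed

text \<open>In group terms, the contraction turns the right leg \<open>c # g\<close> into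
  \<open>c # \<gamma>g\<close>, and multiplication by the inverse of \<gamma> restores
  \<open>g\<close>.\<close>

lemma unwind_es_left: "tlift unwind2 (tlift (es_left trans_lift) x) = x"
proof -
  interpret P: coalgebra_points \<Delta> \<epsilon> S "(\<triangleright>)" \<sigma> \<sigma>i \<Delta> \<epsilon> by (rule points_H)
  write P.ktens (infixr "\<boxtimes>" 76)
  note id = id_point
  note S = P.point_antipode[OF id] P.point_antipode_left[OF id]
  have c1: "clinear (tlift unwind2)" and c2: "clinear (tlift (es_left trans_lift))"
    by (simp_all add: clinear_tlift cbilinear_unwind2 cbilinear_es_left)
  have gen: "tlift unwind2 (tlift (es_left trans_lift) ((b \<otimes> h) \<otimes> (c \<otimes> g))) = (b \<otimes> h) \<otimes> (c \<otimes> g)" for b h c g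
  proof -
    let ?X = "H.kcst b \<boxtimes> (\<lambda>x. x)" and ?Y = "H.kcst c \<boxtimes> H.kcst g"
    have inv: "H.kconv (*) (S \<circ> (\<lambda>x. x)) (H.kconv (*) (\<lambda>x. x) (H.kcst g)) = H.kcst g"
      using id by (intro P.kmult_cancel_left) simp_all
    have "tlift unwind2 \<circ> (tlift (es_left trans_lift) \<circ> (?X \<boxtimes> ?Y)) = ?X \<boxtimes> ?Y"
      using id S inv by (simp add: P.es_left_conv P.amult_point P.unwind_conv P.kact_kact P.one_kact
          H.kmult_one_left)
    from fun_cong[OF this, of h] show ?thesis
      by (simp add: H.conv_kcst_kcst) (simp add: H.conv_kcst_left H.conv_kcst_right)
  qed
  let ?L = "\<lambda>x. tlift unwind2 (tlift (es_left trans_lift) x)"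
  have l: "clinear (\<lambda>x. ?L (f x))" if "clinear f" for f :: "'z::complex_vector \<Rightarrow> _"
    by (rule clinear_compose[OF c1 clinear_compose[OF c2 that]])
  have "(\<lambda>v. ?L ((b \<otimes> h) \<otimes> v)) = (\<lambda>v. (b \<otimes> h) \<otimes> v)" for b h
    by (rule clinear_tensor_eqI[OF l]) (simp_all add: gen)
  then have "(\<lambda>u. ?L (u \<otimes> v)) = (\<lambda>u. u \<otimes> v)" for v
    by (intro clinear_tensor_eqI[OF l]) (simp_all add: fun_eq_iff)
  then have "?L = (\<lambda>x. x)"
    by (intro clinear_tensor_eqI[OF l]) (simp_all add: fun_eq_iff)
  then show ?thesis by (simp add: fun_eq_iff)
qed

text \<open>Both sides of the coinvariance condition have the same first leg. For the identity point
  \<gamma> the other legs are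
  \<open>1 # S \<gamma> \<otimes> (\<gamma> \<triangleright> b') # 1\<close> and
  \<open>b' # S \<gamma> \<otimes> 1 # 1\<close>; they agree after moving
  \<open>\<gamma> \<triangleright> b'\<close> across the balanced tensor.\<close>

lemma elem_in_carrier: "elem b b' h \<in> es_carrier A"
proof -
  interpret P: coalgebra_points \<Delta> \<epsilon> S "(\<triangleright>)" \<sigma> \<sigma>i \<Delta> \<epsilon> by (rule points_H)
  write P.ktens (infixr "\<boxtimes>" 76) and P.kone ("\<one>") and P.kact (infixr "\<unrhd>" 74)
  note id = id_point
  note S = P.point_antipode[OF id] P.point_antipode_left[OF id]
  let ?i = "\<lambda>x :: 'h. x"
  let ?X = "H.kcst b \<boxtimes> ?i" and ?U = "\<one> \<boxtimes> (S \<circ> ?i)" and ?L = "?i \<unrhd> H.kcst b'"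
  \<comment> \<open>\<open>?b1\<close> and \<open>?b2\<close> put the base element \<open>e\<close>
    on the two sides of the balanced tensor, so their difference is a relation for all
    \<open>u\<close> and \<open>e\<close>.\<close>
  let ?b1 = "\<lambda>u e. u \<otimes> (e \<otimes> (1 :: 'h))" and ?b2 = "\<lambda>u e. amult A u (e \<otimes> 1) \<otimes> aone A"
  have b: "cbilinear ?b1" "cbilinear ?b2"
    by (intro lin)+
  have "tlift (es_left trans_lift) \<circ> P.kelem (H.kcst b) (H.kcst b') ?i = ?X \<boxtimes> (?U \<boxtimes> (?L \<boxtimes> \<one>))"
    using id S by (simp add: P.es_left_conv P.amult_point P.point_antipode_right H.kmult_one_left)
  also have "?U \<boxtimes> (?L \<boxtimes> \<one>) = H.kconv ?b1 ?U ?L"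
    by (subst H.conv_kcst_right) (simp_all, simp add: conv_def)
  finally have left: "tlift (es_left trans_lift) \<circ> P.kelem (H.kcst b) (H.kcst b') ?i = ?X \<boxtimes> H.kconv ?b1 ?U ?L" .
  have "H.kconv (amult A) ?U (?L \<boxtimes> \<one>) = H.kcst b' \<boxtimes> (S \<circ> ?i)"
    using id S by (simp add: P.amult_point P.kact_kact P.one_kact H.kmult_one_left H.kmult_one_right)
  moreover have "H.kconv ?b2 ?U ?L = H.kconv (amult A) ?U (?L \<boxtimes> \<one>) \<boxtimes> H.kcst (aone A)"
    by (rule P.conv_amult_incl) simp_all
  ultimately have right: "tlift es_right \<circ> P.kelem (H.kcst b) (H.kcst b') ?i = ?X \<boxtimes> H.kconv ?b2 ?U ?L"
    by (simp add: P.es_right_conv)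
  have "(?X \<boxtimes> H.kconv ?b1 ?U ?L) h - (?X \<boxtimes> H.kconv ?b2 ?U ?L) h \<in> es_relations"
    unfolding es_relations_def
  proof (rule conv_diff_in_span)
    fix a c
    have "H.kconv ?b1 ?U ?L c - H.kconv ?b2 ?U ?L c \<in> ext_balance A"
      unfolding ext_balance_def
    proof (rule conv_diff_in_span)
      fix k l
      have "- (?b1 (?U k) (?L l) - ?b2 (?U k) (?L l)) \<in> ext_balance A"
        using ext_balance_gen[of "?U k" "?L l" "1 \<otimes> 1"] by (simp add: amult_incl_left)
      then show "?b1 (?U k) (?L l) - ?b2 (?U k) (?L l)
        \<in> cspan {amult A a (aincl A b) \<otimes> a' - a \<otimes> amult A (aincl A b) a' | a b a'. True}"
        unfolding ext_balance_def using complex_vector.span_neg by fastforce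
    qed (simp_all add: b del: aone_eq)
    from es_relations_gen[OF this, of "?X a"]
    show "?X a \<otimes> H.kconv ?b1 ?U ?L c - ?X a \<otimes> H.kconv ?b2 ?U ?L c
      \<in> cspan {a \<otimes> n | a n. n \<in> ext_balance A}"
      by (simp only: clinear_diff[OF clinear_tens_right] es_relations_def)
  qed (simp_all add: b del: aone_eq)
  then show ?thesis
    using fun_cong[OF left, of h] fun_cong[OF right, of h]
    by (simp add: es_carrier_iff elem_kelem del: aone_eq)
qed

lemma carrier_eq: "es_carrier A = cspan elems"
proof
  show "es_carrier A \<subseteq> cspan elems"
  proof
    fix x assume "x \<in> es_carrier A"
    then have "tlift unwind2 (tlift (es_left trans_lift) x - tlift es_right x) = 0"
      by (simp add: es_carrier_iff unwind_relations)
    then have "x = proj x"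
      by (simp add: clinear_diff[OF clinear_tlift[OF cbilinear_unwind2]] unwind_es_left unwind_es_right)
    then show "x \<in> cspan elems" using proj_in_span[of x] by simp
  qed
  show "cspan elems \<subseteq> es_carrier A"
  proof
    fix x assume x: "x \<in> cspan elems"
    have l: "clinear (\<lambda>x. tlift (es_left trans_lift) x - tlift es_right x)"
      by (intro clinear_minus clinear_tlift cbilinear_es_left cbilinear_es_right clinear_trans_lift)
    have "tlift (es_left trans_lift) x - tlift es_right x \<in> es_relations"
      unfolding es_relations_def
      by (rule clinear_image_span[OF l _ x])
        (use elem_in_carrier in \<open>auto simp: elems_def es_carrier_iff es_relations_def\<close>)
    then show "x \<in> es_carrier A" by (simp add: es_carrier_iff)
  qed
qed

lemma lcarrier_eq: "lcarrier C = cspan elems"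
  by (simp add: ehresmann_schauenburg_def carrier_eq)

abbreviation cop where "cop \<equiv> tlift (es_coprod_lift trans_lift)"

lemma clinear_es_cop [simp]: "clinear cop"
  by (simp add: clinear_tlift cbilinear_es_coprod_lift)

text \<open>Exchanging the lift leaves the coset unchanged, so the coproduct is governed by the
  linear map \<open>cop\<close>. By \<open>cop_in_tensor_square\<close> its value on the carrier is
  itself a representative.\<close>

lemma lcoprod_iff: "w \<in> lcoprod C x \<longleftrightarrow> w \<in> tensor_square (cspan elems) \<and> w - cop x \<in> es_middle_balance A"
proof -
  let ?T = "tlift (es_coprod_lift (translation_lift A)) x"
  have "w - cop x = (w - ?T) + (?T - cop x)" by simp
  moreover have "(w - ?T) + (?T - cop x) \<in> es_middle_balance A \<longleftrightarrow> w - ?T \<in> es_middle_balance A"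
    using es_coprod_lift_translation_lift[of x] unfolding es_middle_balance_def by (rule complex_vector.span_add_eq2)
  ultimately show ?thesis
    by (simp add: ehresmann_schauenburg_def es_coprod_def carrier_eq coset_def es_coprod_lift_def[abs_def])
qed

lemma cop_elem: "cop (elem b b' h) = sweedler2 \<Delta> (\<lambda>h1 h2. elem b 1 h1 \<otimes> elem 1 b' h2) h"
proof -
  interpret P: coalgebra_points \<Delta> \<epsilon> S "(\<triangleright>)" \<sigma> \<sigma>i \<Delta> \<epsilon> by (rule points_H)
  have "cop \<circ> elem b b' = P.ktens (elem b 1) (elem 1 b')"
    unfolding elem_kelem[symmetric] by (rule P.es_coprod_lift_kelem) (simp_all add: id_point)
  then show ?thesis by (simp add: conv_def fun_eq_iff)
qed

lemma cop_in_tensor_square: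
  assumes "x \<in> cspan elems"
  shows "cop x \<in> tensor_square (cspan elems)"
  unfolding tensor_square_def
proof (rule clinear_image_span[OF clinear_es_cop _ assms])
  fix x assume "x \<in> elems"
  then obtain b b' h where "x = elem b b' h" by (auto simp: elems_def)
  moreover have "cop (elem b b' h) \<in> cspan {x \<otimes> y | x y. x \<in> cspan elems \<and> y \<in> cspan elems}"
    unfolding cop_elem sweedler2_def
    by (rule tlift_in_span, (intro lin)+, rule complex_vector.span_base,
        use elems_I complex_vector.span_base in blast)
  ultimately show "cop x \<in> cspan {x \<otimes> y | x y. x \<in> cspan elems \<and> y \<in> cspan elems}"
    by simp
qed

end

section \<open>Sweedler notation over the base algebra\<close>

context central_crossed_product
begin

definition act_left :: "'h \<Rightarrow> ('b, 'h) tensor \<Rightarrow> ('b, 'h) tensor" where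
  "act_left h w = tlift (\<lambda>b g. (h \<triangleright> b) \<otimes> g) w"

definition act_left2 ::
    "'h \<Rightarrow> ('b, 'h) smash_pair \<Rightarrow> ('b, 'h) smash_pair" where
  "act_left2 h z = tlift (\<lambda>w q. act_left h w \<otimes> q) z"

lemma cbilinear_act_left [simp]: "cbilinear act_left"
  unfolding act_left_def by (intro lin)

lemmas lin_act_left = cbilinear_act_left[THEN cbilinear_left] cbilinear_act_left[THEN cbilinear_right]

lemma act_left_tens: "act_left h (b \<otimes> g) = (h \<triangleright> b) \<otimes> g"
  unfolding act_left_def by (subst tlift_tens) (intro lin refl)+

lemma cbilinear_act_left2 [simp]: "cbilinear act_left2"
  unfolding act_left2_def by (intro lin lin_act_left)

lemmas lin_act_left2 = cbilinear_act_left2[THEN cbilinear_left] cbilinear_act_left2[THEN cbilinear_right]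

lemma act_left2_tens: "act_left2 h (w \<otimes> q) = act_left h w \<otimes> q"
  unfolding act_left2_def by (subst tlift_tens) (intro lin lin_act_left refl)+

text \<open>Absorbs the inner leg \<open>u\<close> of the left factor into the right factor; only
  the class of \<open>u \<otimes> v\<close> over B matters.\<close>

definition contract ::
    "('b, 'h) tensor \<Rightarrow> ('b, 'h) smash_pair \<Rightarrow> ('b, 'h) smash_pair" where
  "contract u y = tlift (\<lambda>v q. act_mult u v \<otimes> q) y"

lemma cbilinear_contract [simp]: "cbilinear contract"
  unfolding contract_def by (intro lin lin_act_mult)

lemmas lin_contract = cbilinear_contract[THEN cbilinear_left] cbilinear_contract[THEN cbilinear_right]

lemma contract_tens: "contract u (v \<otimes> q) = act_mult u v \<otimes> q"
  unfolding contract_def by (subst tlift_tens) (intro lin lin_act_mult refl)+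

text \<open>For generic elements the contraction leaves the coefficient
  \<open>G \<odot> ((S \<circ> \<gamma>) \<unrhd> F')\<close>; acting with the Hopf part of
  \<open>p\<close> makes it \<open>(\<gamma> \<unrhd> G) \<odot> F'\<close>. The projections put
  both factors into the carrier, the first one with trivial right coefficient.\<close>

definition reduce1 ::
    "('b, 'h) tensor \<Rightarrow> ('b, 'h) smash_pair
      \<Rightarrow> (('b, 'h) smash_pair, ('b, 'h) smash_pair) tensor" where
  "reduce1 p z = tlift (\<lambda>p0 h. proj (p0 \<otimes> (1 \<otimes> 1)) \<otimes> proj (act_left2 h z)) (acoact A p)"

lemma cbilinear_reduce1 [simp]: "cbilinear reduce1"
  unfolding reduce1_def by (intro lin lin_act_left2 clinear_acoact)

lemmas lin_reduce1 = cbilinear_reduce1[THEN cbilinear_left] cbilinear_reduce1[THEN cbilinear_right]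

text \<open>
  A normal form in \<open>L \<otimes>\<^sub>B L\<close> for \<open>L = C(A, H)\<close>: every class contains an element whose left factor
  is of the induced_form \<open>b # h\<^sub>(\<^sub>1\<^sub>) \<otimes> 1 # S(h\<^sub>(\<^sub>2\<^sub>))\<close>.
\<close>

definition reduce2 where
  "reduce2 x y = tlift (\<lambda>p u. reduce1 p (contract u y)) x"

lemma cbilinear_reduce2 [simp]: "cbilinear reduce2"
  unfolding reduce2_def by (intro lin lin_reduce1 lin_contract)

lemma reduce2_tens: "reduce2 (p \<otimes> u) y = reduce1 p (contract u y)"
  unfolding reduce2_def by (subst tlift_tens) (intro lin lin_reduce1 lin_contract refl)+

abbreviation reduce where "reduce \<equiv> tlift reduce2"

text \<open>The two inner legs enter only through \<open>act_mult\<close>, which is balanced. Hence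
  the normal form can be computed from the class in the larger space with four legs.\<close>

lemma reduce_middle_balance:
  assumes "n \<in> es_middle_balance A"
  shows "reduce n = 0"
proof -
  have "reduce n \<in> cspan {}"
  proof (rule clinear_image_span[OF clinear_tlift[OF cbilinear_reduce2] _ assms[unfolded es_middle_balance_def]])
    fix x :: "(('b, 'h) smash_pair, ('b, 'h) smash_pair) tensor"
    assume "x \<in> {tlift (\<lambda>u v. (p \<otimes> u) \<otimes> (v \<otimes> q)) n | p q n. n \<in> ext_balance A}"
    then obtain p q n where x: "x = tlift (\<lambda>u v. (p \<otimes> u) \<otimes> (v \<otimes> q)) n" and n: "n \<in> ext_balance A"
      by blast
    have l: "clinear (\<lambda>w. reduce1 p (w \<otimes> q))" by (intro lin lin_reduce1)
    have "reduce x = tlift (\<lambda>u v. reduce ((p \<otimes> u) \<otimes> (v \<otimes> q))) n"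
      unfolding x by (rule tlift_compose) (intro lin clinear_tlift cbilinear_reduce2)+
    also have "\<dots> = tlift (\<lambda>u v. reduce1 p (act_mult u v \<otimes> q)) n"
      by (simp add: tlift_tens reduce2_tens contract_tens)
    also have "\<dots> = reduce1 p (tlift act_mult n \<otimes> q)"
      by (rule tlift_compose[OF l, symmetric]) simp
    also have "\<dots> = 0"
      by (simp add: act_mult_balance[OF n] clinear_zero[OF l])
    finally show "reduce x \<in> cspan {}" by simp
  qed
  then show ?thesis by simp
qed

end

context coalgebra_points
begin

text \<open>The right coefficient \<open>G\<close> of the left factor is moved across the tensor
  product over B, where it appears as the left coefficient
  \<open>\<gamma> \<unrhd> G\<close>.\<close>

lemma reduce_kelem:
  assumes "clinear F" "clinear G" "clinear F'" "clinear G'" "point \<gamma>" "point \<eta>"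
  shows "reduce \<circ> (kelem F G \<gamma> \<boxtimes> kelem F' G' \<eta>) = kelem F \<one> \<gamma> \<boxtimes> kelem ((\<gamma> \<unrhd> G) \<odot> F') G' \<eta>"
proof -
  note [simp] = assms
  let ?f1 = "\<lambda>p0 (w :: ('b, 'h) smash_pair). proj (p0 \<otimes> (1 \<otimes> 1)) \<otimes> w"
  let ?f2 = "\<lambda>h z. proj (act_left2 h z)"
  let ?L = "G \<odot> ((S \<circ> \<gamma>) \<unrhd> F')"
  let ?Z = "(?L \<boxtimes> \<eta>) \<boxtimes> (G' \<boxtimes> (S \<circ> \<eta>))"
  have b: "cbilinear ?f1" "cbilinear ?f2" by (intro lin lin_act_left2)+
  have Z: "clinear ?Z" by simp
  have "reduce \<circ> (kelem F G \<gamma> \<boxtimes> kelem F' G' \<eta>) = K.kconv reduce2 (kelem F G \<gamma>) (kelem F' G' \<eta>)"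
    by (rule conv_tens[symmetric]) simp_all
  also have "\<dots> = K.kconv reduce1 (F \<boxtimes> \<gamma>) (K.kconv contract (G \<boxtimes> (S \<circ> \<gamma>)) (kelem F' G' \<eta>))"
    by (rule K.conv_assoc[symmetric]) (simp_all add: reduce2_tens)
  also have "K.kconv contract (G \<boxtimes> (S \<circ> \<gamma>)) (kelem F' G' \<eta>)
      = K.kconv act_mult (G \<boxtimes> (S \<circ> \<gamma>)) (F' \<boxtimes> \<eta>) \<boxtimes> (G' \<boxtimes> (S \<circ> \<eta>))"
    by (rule K.conv_assoc) (simp_all add: contract_tens)
  also have "K.kconv act_mult (G \<boxtimes> (S \<circ> \<gamma>)) (F' \<boxtimes> \<eta>) = ?L \<boxtimes> \<eta>"
    by (subst conv_tens) (simp_all add: act_mult_conv)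
  also have "K.kconv reduce1 (F \<boxtimes> \<gamma>) ?Z = K.kconv ?f1 (F \<boxtimes> \<gamma>) (K.kconv ?f2 \<gamma> ?Z)"
    unfolding reduce1_def by (rule K.conv_coact) (rule b Z | simp add: acoact_point)+
  also have "K.kconv ?f2 \<gamma> ?Z = proj \<circ> K.kconv act_left2 \<gamma> ?Z"
    by (rule conv_compose[OF clinear_proj cbilinear_act_left2 _ Z, symmetric]) simp
  also have "K.kconv act_left2 \<gamma> ?Z = K.kconv act_left \<gamma> (?L \<boxtimes> \<eta>) \<boxtimes> (G' \<boxtimes> (S \<circ> \<eta>))"
    by (rule K.conv_assoc) (simp_all add: act_left2_tens)
  also have "K.kconv act_left \<gamma> (?L \<boxtimes> \<eta>) = (\<gamma> \<unrhd> ?L) \<boxtimes> \<eta>"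
    by (rule K.conv_assoc) (simp_all add: act_left_tens)
  also have "\<gamma> \<unrhd> ?L = (\<gamma> \<unrhd> G) \<odot> F'"
    by (simp add: kact_mult kact_kact point_antipode_right one_kact)
  also have "proj \<circ> kelem ((\<gamma> \<unrhd> G) \<odot> F') G' \<eta> = kelem ((\<gamma> \<unrhd> G) \<odot> F') G' \<eta>"
    by (rule proj_kelem) simp_all
  also have "K.kconv ?f1 (F \<boxtimes> \<gamma>) (kelem ((\<gamma> \<unrhd> G) \<odot> F') G' \<eta>)
      = K.kconv (\<lambda>p0 q. proj (p0 \<otimes> q)) (F \<boxtimes> \<gamma>) (K.kcst (1 \<otimes> 1)) \<boxtimes> kelem ((\<gamma> \<unrhd> G) \<odot> F') G' \<eta>"
  proof -
    have "cbilinear (\<lambda>p0 q. proj (p0 \<otimes> q))" by (intro lin)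
    from K.conv_kcst_right[OF this, of "F \<boxtimes> \<gamma>" "1 \<otimes> 1"] show ?thesis
      by simp (simp add: conv_def)
  qed
  also have "K.kconv (\<lambda>p0 q. proj (p0 \<otimes> q)) (F \<boxtimes> \<gamma>) (K.kcst (1 \<otimes> 1)) = K.kconv proj2 (F \<boxtimes> \<gamma>) (\<one> \<boxtimes> \<one>)"
    by (simp add: proj_tens K.conv_kcst_kcst)
  also have "\<dots> = kelem F \<one> \<gamma>"
    by (rule proj_conv) (simp_all add: point_one point_counit)
  finally show ?thesis .
qed

lemma lmult_source_kelem:
  assumes "clinear F" "clinear G" "clinear L" "point \<gamma>"
  shows "K.kconv (lmult C) (lsource C \<circ> L) (kelem F G \<gamma>) = kelem (L \<odot> F) G \<gamma>"
  using assms by (simp add: source_kelem lmult_kelem point_one one_kact point_antipode kact_one kmult_one)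

text \<open>A right coefficient \<open>L\<close> is produced by the target of
  \<open>\<gamma> \<unrhd> L\<close>. This identifies what is moved across the tensor sign in
  \<open>balanced_reduce_elem\<close>.\<close>

lemma lmult_target_kelem:
  assumes "clinear F" "clinear L" "point \<gamma>"
  shows "K.kconv (lmult C) (ltarget C \<circ> (\<gamma> \<unrhd> L)) (kelem F \<one> \<gamma>) = kelem F L \<gamma>"
  using assms by (simp add: target_kelem lmult_kelem point_one one_kact kact_kact point_antipode
      point_antipode_left kact_one kmult_one)

end

context central_crossed_product
begin

text \<open>Balancing is imposed on the carrier only, which is where it can be verified for the
  forms that occur.\<close>

definition balanced :: "(('b, 'h) smash_pair \<Rightarrow> ('b, 'h) smash_pair \<Rightarrow> 'z::complex_vector) \<Rightarrow> bool" where
  "balanced F \<longleftrightarrow> cbilinear F \<and> (\<forall>x\<in>cspan elems. \<forall>y\<in>cspan elems. \<forall>e.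
     F (lmult C (ltarget C e) x) y = F x (lmult C (lsource C e) y))"

text \<open>A balanced form does not see the passage to the normal form: there \<open>?L\<close>
  acts as a source on the right factor, and by balancing as a target on the left factor, where it
  restores the coefficient \<open>b'\<close>.\<close>

lemma balanced_reduce_elem:
  assumes "balanced F"
  shows "tlift F (reduce (elem b b' h \<otimes> elem c c' g)) = F (elem b b' h) (elem c c' g)"
proof -
  interpret P: coalgebra_points \<Delta> \<epsilon> S "(\<triangleright>)" \<sigma> \<sigma>i HH.\<Delta>\<Delta> HH.\<epsilon>\<epsilon> by (rule points_HH)
  write P.ktens (infixr "\<boxtimes>" 76) and P.kone ("\<one>") and P.kact (infixr "\<unrhd>" 74) and P.kelem ("kelem")
  have F: "cbilinear F" using assms by (simp add: balanced_def)
  note [simp] = HH.hom_fst HH.hom_snd F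
  let ?X = "kelem (HHC.kcst b) (HHC.kcst b') HH.p1" and ?Y = "kelem (HHC.kcst c) (HHC.kcst c') HH.p2"
  let ?X1 = "kelem (HHC.kcst b) \<one> HH.p1" and ?L = "HH.p1 \<unrhd> HHC.kcst b'"
  let ?sl = "\<lambda>e y. lmult C (lsource C e) y" and ?tl = "\<lambda>x e. lmult C (ltarget C e) x"
  have b: "cbilinear ?sl" "cbilinear ?tl" "cbilinear (\<lambda>e x. ?tl x e)" by (simp_all, (intro lin)+)
  have X1: "?X1 k \<in> cspan elems" for k
    using fun_cong[OF P.kelem_smash_elem[OF HH.hom_fst, of b 1], of k]
    by (metis comp_apply complex_vector.span_base elems_I)
  have Y: "?Y k \<in> cspan elems" for k
    using fun_cong[OF P.kelem_smash_elem[OF HH.hom_snd, of c c'], of k]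
    by (metis comp_apply complex_vector.span_base elems_I)
  have "tlift F \<circ> (reduce \<circ> (?X \<boxtimes> ?Y)) = HHC.kconv F ?X1 (HHC.kconv (lmult C) (lsource C \<circ> ?L) ?Y)"
    by (simp add: P.reduce_kelem P.lmult_source_kelem del: lsource_eq) (rule conv_tens[symmetric], simp_all)
  also have "HHC.kconv (lmult C) (lsource C \<circ> ?L) ?Y = HHC.kconv ?sl ?L ?Y"
    by (simp add: conv_def)
  also have "HHC.kconv F ?X1 (HHC.kconv ?sl ?L ?Y) = HHC.kconv F (HHC.kconv ?tl ?X1 ?L) ?Y"
    by (rule HHC.conv_assoc) (use assms X1 Y in \<open>simp_all add: balanced_def b del: lsource_eq ltarget_eq\<close>)
  also have "HHC.kconv ?tl ?X1 ?L = HHC.kconv (\<lambda>e x. ?tl x e) ?L ?X1"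
    by (rule HHC.conv_comm) (simp_all add: b del: ltarget_eq)
  also have "\<dots> = HHC.kconv (lmult C) (ltarget C \<circ> ?L) ?X1"
    by (simp add: conv_def)
  also have "\<dots> = ?X"
    by (rule P.lmult_target_kelem) simp_all
  finally have eq: "tlift F \<circ> (reduce \<circ> (?X \<boxtimes> ?Y)) = HHC.kconv F ?X ?Y" .
  have X_eq: "?X = elem b b' \<circ> HH.p1" and Y_eq: "?Y = elem c c' \<circ> HH.p2"
    by (simp_all add: P.kelem_smash_elem)
  have l: "clinear (elem b b')" "clinear (elem c c')" by (intro lin)+
  have "((elem b b' \<circ> HH.p1) \<boxtimes> (elem c c' \<circ> HH.p2)) (h \<otimes> g) = elem b b' h \<otimes> elem c c' g"
    "HHC.kconv F (elem b b' \<circ> HH.p1) (elem c c' \<circ> HH.p2) (h \<otimes> g) = F (elem b b' h) (elem c c' g)"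
    by (rule HH.conv_fst_snd; simp add: l)+
  then show ?thesis
    using fun_cong[OF eq, of "h \<otimes> g"] unfolding X_eq Y_eq by (simp only: comp_apply[of "tlift F"] comp_apply[of reduce])
qed

end

context coalgebra_points
begin

text \<open>A pair of points of H is a point of H \<otimes> H, along which the invertibility of
  \<sigma> can be pulled back.\<close>

lemma point_pair:
  assumes "point \<gamma>" "point \<eta>"
  shows "coalgebra_hom \<Delta>\<^sub>K \<epsilon>\<^sub>K HH.\<Delta>\<Delta> HH.\<epsilon>\<epsilon> (\<gamma> \<boxtimes> \<eta>)"
  unfolding coalgebra_hom_def
proof (intro conjI)
  note [simp] = assms
  show "clinear (\<gamma> \<boxtimes> \<eta>)" by simp
  let ?m = "\<lambda>u w. tlift (\<lambda>(h1 :: 'h) (h2 :: 'h). tlift (\<lambda>(g1 :: 'h) (g2 :: 'h). (h1 \<otimes> g1) \<otimes> (h2 \<otimes> g2)) w) u"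
  have m: "cbilinear ?m" by (intro lin)
  have m_tens: "?m (h1 \<otimes> h2) (g1 \<otimes> g2) = (h1 \<otimes> g1) \<otimes> (h2 \<otimes> g2)" for h1 h2 g1 g2
    by (subst tlift_tens, (intro lin)+, subst tlift_tens, (intro lin refl)+)
  have b: "cbilinear (\<lambda>h g. ?m (\<Delta> h) (\<Delta> g))" by (intro lin H.clinear_cop)
  have "HH.\<Delta>\<Delta> \<circ> (\<gamma> \<boxtimes> \<eta>) = K.kconv (\<lambda>h g. ?m (\<Delta> h) (\<Delta> g)) \<gamma> \<eta>"
    unfolding tensor_coproduct_def sweedler2_def by (rule conv_tens[OF b, symmetric]) simp_all
  also have "\<dots> = K.kconv ?m (\<Delta> \<circ> \<gamma>) (\<Delta> \<circ> \<eta>)"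
    by (simp add: conv_def)
  also have "\<dots> = (\<gamma> \<boxtimes> \<eta>) \<boxtimes> (\<gamma> \<boxtimes> \<eta>)"
    unfolding point_coproduct[OF assms(1)] point_coproduct[OF assms(2)]
    by (rule K.conv_interchange) (rule m_tens, simp_all add: m)
  finally show "HH.\<Delta>\<Delta> \<circ> (\<gamma> \<boxtimes> \<eta>) = (\<gamma> \<boxtimes> \<eta>) \<boxtimes> (\<gamma> \<boxtimes> \<eta>)" .
  have e: "cbilinear (\<lambda>h g. \<epsilon> h * \<epsilon> g)" by (intro lin H.clinear_eps)
  have "HH.\<epsilon>\<epsilon> \<circ> (\<gamma> \<boxtimes> \<eta>) = K.kconv (\<lambda>h g. \<epsilon> h * \<epsilon> g) \<gamma> \<eta>"
    unfolding tensor_counit_def by (rule conv_tens[OF e, symmetric]) simp_all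
  also have "\<dots> = K.kconv (*) (\<epsilon> \<circ> \<gamma>) (\<epsilon> \<circ> \<eta>)"
    by (simp add: conv_def)
  also have "\<dots> = \<epsilon>\<^sub>K"
    unfolding point_counit[OF assms(1)] point_counit[OF assms(2)]
    by (subst counit_kcst) (simp add: K.kmult_one_left)
  finally show "HH.\<epsilon>\<epsilon> \<circ> (\<gamma> \<boxtimes> \<eta>) = \<epsilon>\<^sub>K" .
qed

lemma sigma_cancel:
  assumes "point \<gamma>" "point \<eta>" "clinear X"
  shows "(\<sigma> \<circ> (\<gamma> \<boxtimes> \<eta>)) \<odot> ((\<sigma>i \<circ> (\<gamma> \<boxtimes> \<eta>)) \<odot> X) = X"
    and "(\<sigma>i \<circ> (\<gamma> \<boxtimes> \<eta>)) \<odot> ((\<sigma> \<circ> (\<gamma> \<boxtimes> \<eta>)) \<odot> X) = X"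
proof -
  have c: "HHC.kcst 1 \<circ> (\<gamma> \<boxtimes> \<eta>) = \<one>"
    using point_pair[OF assms(1,2)] by (simp add: coalgebra_hom_def fun_eq_iff cst_def)
  have "(\<sigma> \<circ> (\<gamma> \<boxtimes> \<eta>)) \<odot> (\<sigma>i \<circ> (\<gamma> \<boxtimes> \<eta>)) = \<one>"
    by (subst conv_hom[OF point_pair[OF assms(1,2)]]) (simp_all add: sigma_conv_inv c)
  then show "(\<sigma> \<circ> (\<gamma> \<boxtimes> \<eta>)) \<odot> ((\<sigma>i \<circ> (\<gamma> \<boxtimes> \<eta>)) \<odot> X) = X"
    using assms by (simp add: kmult_one flip: K.kmult_assoc)
  have "(\<sigma>i \<circ> (\<gamma> \<boxtimes> \<eta>)) \<odot> (\<sigma> \<circ> (\<gamma> \<boxtimes> \<eta>)) = \<one>"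
    by (subst conv_hom[OF point_pair[OF assms(1,2)]]) (simp_all add: sigma_inv_conv c)
  then show "(\<sigma>i \<circ> (\<gamma> \<boxtimes> \<eta>)) \<odot> ((\<sigma> \<circ> (\<gamma> \<boxtimes> \<eta>)) \<odot> X) = X"
    using assms by (simp add: kmult_one flip: K.kmult_assoc)
qed

lemma kelem_in_span: "kelem F G \<gamma> k \<in> cspan elems" if "clinear F" "clinear G" "point \<gamma>"
  using fun_cong[OF proj_kelem[OF that], of k] proj_in_span[of "kelem F G \<gamma> k"] by simp

end

context central_crossed_product
begin

lemma amult_one_left: "amult A (1 \<otimes> 1) u = u"
  using cbilinear_amult
  by (induction u rule: tensor_induct) (simp_all add: amult_incl_left clinear_iff cbilinear_def)

lemma lmult_assoc: "lmult C x (lmult C y z) = lmult C (lmult C x y) z"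
proof -
  have "lmult C (a \<otimes> a') (lmult C (b \<otimes> b') (c \<otimes> c')) = lmult C (lmult C (a \<otimes> a') (b \<otimes> b')) (c \<otimes> c')"
    for a a' b b' c c' by (simp add: lmult_tens amult_assoc)
  then have "lmult C (a \<otimes> a') (lmult C (b \<otimes> b') z) = lmult C (lmult C (a \<otimes> a') (b \<otimes> b')) z" for a a' b b'
    using cbilinear_lmult by (induction z rule: tensor_induct) (simp_all add: clinear_iff cbilinear_def)
  then have "lmult C (a \<otimes> a') (lmult C y z) = lmult C (lmult C (a \<otimes> a') y) z" for a a'
    using cbilinear_lmult by (induction y rule: tensor_induct) (simp_all add: clinear_iff cbilinear_def)
  then show ?thesis
    using cbilinear_lmult by (induction x rule: tensor_induct) (simp_all add: clinear_iff cbilinear_def)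
qed

lemma elem_one: "elem e e' 1 = (e \<otimes> 1) \<otimes> (e' \<otimes> 1)"
  unfolding smash_elem_def sweedler2_def coproduct_one
  by (subst tlift_tens) (intro lin, simp add: antipode_one)

lemma lmult_source_target: "lmult C (lsource C e) (ltarget C e') = elem e e' 1"
  by (simp add: lmult_tens elem_one amult_one_right amult_incl_left)

lemma source_target_in_span: "lsource C e \<in> cspan elems" "ltarget C e \<in> cspan elems"
  using complex_vector.span_base[OF elems_I, of e 1 1] complex_vector.span_base[OF elems_I, of 1 e 1]
  by (simp_all add: elem_one)

lemma lmult_in_span:
  assumes "x \<in> cspan elems" "y \<in> cspan elems"
  shows "lmult C x y \<in> cspan elems"
proof -
  interpret P: coalgebra_points \<Delta> \<epsilon> S "(\<triangleright>)" \<sigma> \<sigma>i HH.\<Delta>\<Delta> HH.\<epsilon>\<epsilon> by (rule points_HH)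
  note [simp] = HH.hom_fst HH.hom_snd
  have gen: "lmult C (elem b b' h) (elem c c' g) \<in> cspan elems" for b b' h c c' g
  proof -
    have l: "clinear (elem b b')" "clinear (elem c c')" by (intro lin)+
    have "HHC.kconv (lmult C) (elem b b' \<circ> HH.p1) (elem c c' \<circ> HH.p2) (h \<otimes> g) \<in> cspan elems"
      unfolding P.kelem_smash_elem[OF HH.hom_fst] P.kelem_smash_elem[OF HH.hom_snd]
      by (subst P.lmult_kelem) (simp_all add: P.kelem_in_span P.point_mult P.point_antipode)
    then show ?thesis by (simp add: HH.conv_fst_snd l)
  qed
  have l: "clinear (\<lambda>x. lmult C x y)" "clinear (lmult C x)" for x y
    using cbilinear_lmult by (simp_all add: cbilinear_def)
  have "lmult C x y \<in> cspan elems" if "x \<in> elems" for x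
    by (rule clinear_image_span[OF l(2) _ assms(2)]) (use that gen in \<open>auto simp: elems_def\<close>)
  then show ?thesis
    by (rule clinear_image_span[OF l(1) _ assms(1)])
qed

lemma tlift_reduce_balanced:
  assumes "balanced F" "w \<in> tensor_square (cspan elems)"
  shows "tlift F (reduce w) = tlift F w"
proof -
  have F: "cbilinear F" using assms by (simp add: balanced_def)
  have red: "clinear reduce" by (simp add: clinear_tlift)
  have b: "cbilinear (\<lambda>x y. tlift F (reduce (x \<otimes> y)))"
    by (intro lin red[THEN clinear_compose] F[unfolded cbilinear_def, THEN conjunct1, rule_format]
      F[unfolded cbilinear_def, THEN conjunct2, rule_format])
  have gen: "tlift F (reduce (x \<otimes> y)) = F x y" if "x \<in> cspan elems" "y \<in> cspan elems" for x y
    by (rule cbilinear_eq_on_span[OF b F _ that])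
      (use balanced_reduce_elem[OF assms(1)] in \<open>auto simp: elems_def\<close>)
  show ?thesis
  proof (rule clinear_eq_on_span[OF clinear_compose[OF clinear_tlift[OF F] red] clinear_tlift[OF F] _
        assms(2)[unfolded tensor_square_def]])
    fix w assume "w \<in> {x \<otimes> y | x y. x \<in> cspan elems \<and> y \<in> cspan elems}"
    then obtain x y where "w = x \<otimes> y" "x \<in> cspan elems" "y \<in> cspan elems" by blast
    then show "tlift F (reduce w) = tlift F w"
      using gen[of x y] by (simp only: tlift_tens[OF F])
  qed
qed

text \<open>With \<open>reduce_middle_balance\<close> this applies to any two representatives of one
  coproduct.\<close>

lemma tlift_balanced_cong:
  assumes "balanced F" "v \<in> tensor_square (cspan elems)" "w \<in> tensor_square (cspan elems)" "reduce v = reduce w"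
  shows "tlift F v = tlift F w"
  using tlift_reduce_balanced[OF assms(1,2)] tlift_reduce_balanced[OF assms(1,3)] assms(4) by simp

text \<open>The coproduct lands in the Takeuchi product, expressed by equality of normal forms. Both
  sides reduce to a right factor whose left coefficient is \<open>\<gamma> \<unrhd> e\<close> for
  the identity point \<gamma> and the constant map \<open>e\<close>.\<close>

lemma takeuchi:
  assumes "x \<in> cspan elems"
  shows "reduce (tlift (\<lambda>x1 x2. lmult C x1 (ltarget C e) \<otimes> x2) (cop x))
    = reduce (tlift (\<lambda>x1 x2. x1 \<otimes> lmult C x2 (lsource C e)) (cop x))"
proof -
  interpret P: coalgebra_points \<Delta> \<epsilon> S "(\<triangleright>)" \<sigma> \<sigma>i \<Delta> \<epsilon> by (rule points_H)
  write P.ktens (infixr "\<boxtimes>" 76) and P.kone ("\<one>") and P.kact (infixr "\<unrhd>" 74) and P.kelem ("kelem")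
  note [simp] = id_point
  let ?t = "\<lambda>x1 x2. lmult C x1 (ltarget C e) \<otimes> x2" and ?s = "\<lambda>x1 x2. x1 \<otimes> lmult C x2 (lsource C e)"
  let ?i = "\<lambda>x :: 'h. x"
  have b: "cbilinear ?t" "cbilinear ?s" by (intro lin)+
  have red: "clinear reduce" by (simp add: clinear_tlift)
  have gen: "reduce (tlift ?t (cop (elem b b' h))) = reduce (tlift ?s (cop (elem b b' h)))" for b b' h
  proof -
    let ?X1 = "kelem (H.kcst b) \<one> ?i" and ?X2 = "kelem \<one> (H.kcst b') ?i"
    have cop: "cop \<circ> elem b b' = ?X1 \<boxtimes> ?X2"
      unfolding elem_kelem[symmetric] by (rule P.es_coprod_lift_kelem) simp_all
    have lt: "clinear (ltarget C)" "clinear (lsource C)" unfolding ltarget_eq[abs_def] lsource_eq[abs_def] by (intro lin)+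
    have "tlift ?t \<circ> (?X1 \<boxtimes> ?X2) = H.kconv (lmult C) ?X1 (ltarget C \<circ> H.kcst e) \<boxtimes> ?X2"
    proof -
      have "tlift ?t \<circ> (?X1 \<boxtimes> ?X2) = H.kconv ?t ?X1 ?X2"
        by (rule conv_tens[OF b(1), symmetric]) simp_all
      also have "\<dots> = ((\<lambda>x1. lmult C x1 (ltarget C e)) \<circ> ?X1) \<boxtimes> ?X2"
        by (simp add: conv_def)
      also have "(\<lambda>x1. lmult C x1 (ltarget C e)) \<circ> ?X1 = H.kconv (lmult C) ?X1 (ltarget C \<circ> H.kcst e)"
        unfolding H.conv_kcst_comp[OF lt(1)] by (rule H.conv_kcst_right[symmetric]) simp_all
      finally show ?thesis .
    qed
    also have "H.kconv (lmult C) ?X1 (ltarget C \<circ> H.kcst e) = kelem (H.kcst b) (H.kcst e) ?i"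
      by (simp add: P.target_kelem P.lmult_kelem P.point_one P.kact_one H.kmult_one_left H.kmult_one_right
          P.point_antipode P.one_kact del: ltarget_eq)
    finally have t': "tlift ?t \<circ> (?X1 \<boxtimes> ?X2) = kelem (H.kcst b) (H.kcst e) ?i \<boxtimes> ?X2" .
    have t: "reduce \<circ> (tlift ?t \<circ> (?X1 \<boxtimes> ?X2)) = ?X1 \<boxtimes> kelem (?i \<unrhd> H.kcst e) (H.kcst b') ?i"
      unfolding t' by (simp add: P.reduce_kelem H.kmult_one_right)
    have "tlift ?s \<circ> (?X1 \<boxtimes> ?X2) = ?X1 \<boxtimes> H.kconv (lmult C) ?X2 (lsource C \<circ> H.kcst e)"
    proof -
      have "tlift ?s \<circ> (?X1 \<boxtimes> ?X2) = H.kconv ?s ?X1 ?X2"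
        by (rule conv_tens[OF b(2), symmetric]) simp_all
      also have "\<dots> = ?X1 \<boxtimes> ((\<lambda>x1. lmult C x1 (lsource C e)) \<circ> ?X2)"
        by (simp add: conv_def)
      also have "(\<lambda>x1. lmult C x1 (lsource C e)) \<circ> ?X2 = H.kconv (lmult C) ?X2 (lsource C \<circ> H.kcst e)"
        unfolding H.conv_kcst_comp[OF lt(2)] by (rule H.conv_kcst_right[symmetric]) simp_all
      finally show ?thesis .
    qed
    also have "H.kconv (lmult C) ?X2 (lsource C \<circ> H.kcst e) = kelem (?i \<unrhd> H.kcst e) (H.kcst b') ?i"
      by (simp add: P.source_kelem P.lmult_kelem P.point_one H.kmult_one_left H.kmult_one_right del: lsource_eq)
        (simp add: P.antipode_kone P.one_kact)
    finally have s': "tlift ?s \<circ> (?X1 \<boxtimes> ?X2) = ?X1 \<boxtimes> kelem (?i \<unrhd> H.kcst e) (H.kcst b') ?i" .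
    have "reduce \<circ> (tlift ?s \<circ> (?X1 \<boxtimes> ?X2)) = ?X1 \<boxtimes> kelem (?i \<unrhd> H.kcst e) (H.kcst b') ?i"
      unfolding s' by (simp add: P.reduce_kelem H.kmult_one_left P.kact_one)
    with t have eq: "reduce \<circ> (tlift ?t \<circ> (cop \<circ> elem b b')) = reduce \<circ> (tlift ?s \<circ> (cop \<circ> elem b b'))"
      unfolding cop by simp
    show ?thesis using fun_cong[OF eq, of h] by (simp only: comp_apply)
  qed
  show ?thesis
    by (rule clinear_eq_on_span[OF clinear_compose[OF red clinear_compose[OF clinear_tlift[OF b(1)] clinear_es_cop]]
      clinear_compose[OF red clinear_compose[OF clinear_tlift[OF b(2)] clinear_es_cop]] _ assms])
      (use gen in \<open>auto simp: elems_def simp del: ltarget_eq lsource_eq\<close>)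
qed

section \<open>Independence of Sweedler sums from the representatives of the coproduct\<close>

definition lsweedler_lin where
  "lsweedler_lin F x y = tlift (\<lambda>x1 x2. tlift (\<lambda>y1 y2. F x1 x2 y1 y2) (cop y)) (cop x)"

text \<open>The balancing hypotheses allow the lists for \<open>x\<close> and \<open>y\<close> to be
  replaced in turn by \<open>cop\<close>. The map \<open>F\<close> is built from values on cosets,
  so it is compared on the carrier with an expression \<open>F0\<close> that is multilinear
  everywhere.\<close>

lemma lsweedler_eq:
  fixes F F0 :: "('b, 'h) smash_pair \<Rightarrow> ('b, 'h) smash_pair
    \<Rightarrow> ('b, 'h) smash_pair \<Rightarrow> ('b, 'h) smash_pair \<Rightarrow> 'z::complex_vector"
  assumes lin1: "\<And>y1 y2. cbilinear (\<lambda>x1 x2. F0 x1 x2 y1 y2)" and lin2: "\<And>x1 x2. cbilinear (F0 x1 x2)"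
    and eq: "\<And>x1 x2 y1 y2. x1 \<in> cspan elems \<Longrightarrow> x2 \<in> cspan elems \<Longrightarrow> y1 \<in> cspan elems \<Longrightarrow> y2 \<in> cspan elems
      \<Longrightarrow> F x1 x2 y1 y2 = F0 x1 x2 y1 y2"
    and bal_x: "\<And>x1 x2 y1 y2 e. x1 \<in> cspan elems \<Longrightarrow> x2 \<in> cspan elems \<Longrightarrow> y1 \<in> cspan elems \<Longrightarrow> y2 \<in> cspan elems
      \<Longrightarrow> F0 (lmult C (ltarget C e) x1) x2 y1 y2 = F0 x1 (lmult C (lsource C e) x2) y1 y2"
    and bal_t: "\<And>x1 x2 y1 y2 e. x1 \<in> cspan elems \<Longrightarrow> x2 \<in> cspan elems \<Longrightarrow> y1 \<in> cspan elems \<Longrightarrow> y2 \<in> cspan elems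
      \<Longrightarrow> F0 (lmult C x1 (ltarget C e)) x2 y1 y2 = F0 x1 x2 (lmult C (ltarget C e) y1) y2"
    and bal_s: "\<And>x1 x2 y1 y2 e. x1 \<in> cspan elems \<Longrightarrow> x2 \<in> cspan elems \<Longrightarrow> y1 \<in> cspan elems \<Longrightarrow> y2 \<in> cspan elems
      \<Longrightarrow> F0 x1 (lmult C x2 (lsource C e)) y1 y2 = F0 x1 x2 y1 (lmult C (lsource C e) y2)"
    and x: "x \<in> cspan elems" and y: "y \<in> cspan elems"
  shows "lsweedler C F x y = lsweedler_lin F0 x y"
proof -
  let ?T = "tensor_square (cspan elems)"
  have l: "clinear (\<lambda>x. F0 x x2 y1 y2)" "clinear (\<lambda>x. F0 x1 x y1 y2)" "clinear (\<lambda>x. F0 x1 x2 x y2)" "clinear (\<lambda>x. F0 x1 x2 y1 x)"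
    for x1 x2 y1 y2 using lin1 lin2 by (simp_all add: cbilinear_def)
  have red: "clinear reduce" by (simp add: clinear_tlift)
  have red_eq: "reduce w = reduce (cop z)" if "w - cop z \<in> es_middle_balance A" for w z
    using reduce_middle_balance[OF that] by (simp add: clinear_diff[OF red])
  \<comment> \<open>With the data for \<open>y\<close> fixed, the form in the factors of
    \<open>x\<close> is balanced by \<open>bal_x\<close> alone.\<close>
  have step1: "tlift (\<lambda>x1 x2. tlift (F0 x1 x2) v) w = tlift (\<lambda>x1 x2. tlift (F0 x1 x2) v) (cop x)"
    if v: "v \<in> ?T" and w: "w \<in> ?T" "reduce w = reduce (cop x)" for v w
  proof (rule tlift_balanced_cong[OF _ w(1) cop_in_tensor_square[OF x] w(2)])
    show "balanced (\<lambda>x1 x2. tlift (F0 x1 x2) v)"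
      unfolding balanced_def
    proof (intro conjI ballI allI)
      show "cbilinear (\<lambda>x1 x2. tlift (F0 x1 x2) v)" by (intro lin l)
      fix x1 x2 e assume "x1 \<in> cspan elems" "x2 \<in> cspan elems"
      then show "tlift (F0 (lmult C (ltarget C e) x1) x2) v = tlift (F0 x1 (lmult C (lsource C e) x2)) v"
        by (intro tlift_eq_on_tensor_square[OF lin2 lin2 _ v] bal_x)
    qed
  qed
  \<comment> \<open>A target in front of \<open>y1\<close> passes to the right of \<open>x1\<close>
    by \<open>bal_t\<close>, across to the right of \<open>x2\<close> by the Takeuchi condition, and
    from there to a source in front of \<open>y2\<close> by \<open>bal_s\<close>. This works because
    \<open>x\<close> is already represented by \<open>cop x\<close>.\<close>
  have step2: "tlift (\<lambda>y1 y2. tlift (\<lambda>x1 x2. F0 x1 x2 y1 y2) (cop x)) v = tlift (\<lambda>y1 y2. tlift (\<lambda>x1 x2. F0 x1 x2 y1 y2) (cop x)) (cop y)"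
    if v: "v \<in> ?T" "reduce v = reduce (cop y)" for v
  proof (rule tlift_balanced_cong[OF _ v(1) cop_in_tensor_square[OF y] v(2)])
    show "balanced (\<lambda>y1 y2. tlift (\<lambda>x1 x2. F0 x1 x2 y1 y2) (cop x))"
      unfolding balanced_def
    proof (intro conjI ballI allI)
      show "cbilinear (\<lambda>y1 y2. tlift (\<lambda>x1 x2. F0 x1 x2 y1 y2) (cop x))" by (intro lin l)
      fix y1 y2 e assume y12: "y1 \<in> cspan elems" "y2 \<in> cspan elems"
      let ?t = "\<lambda>x1 x2. lmult C x1 (ltarget C e) \<otimes> x2" and ?s = "\<lambda>x1 x2. x1 \<otimes> lmult C x2 (lsource C e)"
      let ?F = "\<lambda>x1 x2. F0 x1 x2 y1 y2"
      have b: "cbilinear ?t" "cbilinear ?s" by (intro lin)+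
      have T: "tlift f (cop x) \<in> ?T" if "cbilinear f"
        "\<And>x1 x2. x1 \<in> cspan elems \<Longrightarrow> x2 \<in> cspan elems \<Longrightarrow> f x1 x2 \<in> ?T" for f
        using that(2) unfolding tensor_square_def
        by (rule_tac clinear_image_span[OF clinear_tlift[OF that(1)] _ cop_in_tensor_square[OF x, unfolded tensor_square_def]])
          (auto simp: tlift_tens that(1))
      have "tlift (\<lambda>x1 x2. F0 x1 x2 (lmult C (ltarget C e) y1) y2) (cop x)
          = tlift (\<lambda>x1 x2. F0 (lmult C x1 (ltarget C e)) x2 y1 y2) (cop x)"
      proof (rule tlift_eq_on_tensor_square[OF lin1 _ _ cop_in_tensor_square[OF x]])
        show "cbilinear (\<lambda>x1 x2. F0 (lmult C x1 (ltarget C e)) x2 y1 y2)"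
          by (rule cbilinear_compose2[OF lin1]) (intro lin)+
      qed (use y12 bal_t in \<open>simp del: ltarget_eq\<close>)
      also have "\<dots> = tlift ?F (tlift ?t (cop x))"
        by (subst tlift_compose[OF clinear_tlift[OF lin1] b(1)]) (simp add: tlift_tens lin1)
      also have "\<dots> = tlift ?F (tlift ?s (cop x))"
      proof (rule tlift_balanced_cong)
        show "balanced ?F" using y12 by (simp add: balanced_def lin1 bal_x del: ltarget_eq lsource_eq)
        show "tlift ?t (cop x) \<in> ?T" "tlift ?s (cop x) \<in> ?T"
          by (rule T b tensor_square_tens lmult_in_span source_target_in_span | assumption)+
        show "reduce (tlift ?t (cop x)) = reduce (tlift ?s (cop x))" by (rule takeuchi[OF x])
      qed
      also have "\<dots> = tlift (\<lambda>x1 x2. F0 x1 (lmult C x2 (lsource C e)) y1 y2) (cop x)"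
        by (subst tlift_compose[OF clinear_tlift[OF lin1] b(2)]) (simp add: tlift_tens lin1)
      also have "\<dots> = tlift (\<lambda>x1 x2. F0 x1 x2 y1 (lmult C (lsource C e) y2)) (cop x)"
      proof (rule tlift_eq_on_tensor_square[OF _ lin1 _ cop_in_tensor_square[OF x]])
        show "cbilinear (\<lambda>x1 x2. F0 x1 (lmult C x2 (lsource C e)) y1 y2)"
          by (rule cbilinear_compose2[OF lin1]) (intro lin)+
      qed (use y12 bal_s in \<open>simp del: lsource_eq\<close>)
      finally show "tlift (\<lambda>x1 x2. F0 x1 x2 (lmult C (ltarget C e) y1) y2) (cop x)
        = tlift (\<lambda>x1 x2. F0 x1 x2 y1 (lmult C (lsource C e) y2)) (cop x)" .
    qed
  qed
  have val: "(\<Sum>(x1, x2)\<leftarrow>ps. \<Sum>(y1, y2)\<leftarrow>qs. F x1 x2 y1 y2) = lsweedler_lin F0 x y"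
    if ps: "represents_coprod C x ps" and qs: "represents_coprod C y qs" for ps qs
  proof -
    let ?w = "\<Sum>(x1, x2)\<leftarrow>ps. x1 \<otimes> x2" and ?v = "\<Sum>(x1, x2)\<leftarrow>qs. x1 \<otimes> x2"
    have P: "set ps \<subseteq> cspan elems \<times> cspan elems" "?w \<in> ?T" "reduce ?w = reduce (cop x)"
      and Q: "set qs \<subseteq> cspan elems \<times> cspan elems" "?v \<in> ?T" "reduce ?v = reduce (cop y)"
      using ps qs by (simp_all add: represents_coprod_def lcarrier_eq lcoprod_iff red_eq)
    have "(\<Sum>(x1, x2)\<leftarrow>ps. \<Sum>(y1, y2)\<leftarrow>qs. F x1 x2 y1 y2) = (\<Sum>(x1, x2)\<leftarrow>ps. \<Sum>(y1, y2)\<leftarrow>qs. F0 x1 x2 y1 y2)"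
      using P(1) Q(1) by (intro arg_cong[where f = sum_list] map_cong refl) (auto intro!: eq arg_cong[where f = sum_list] map_cong)
    also have "\<dots> = tlift (\<lambda>x1 x2. tlift (F0 x1 x2) ?v) ?w"
      by (subst tlift_sum_list) (intro lin l, simp add: tlift_sum_list lin2)
    also have "\<dots> = tlift (\<lambda>x1 x2. tlift (F0 x1 x2) ?v) (cop x)"
      by (rule step1) (rule P Q)+
    also have "\<dots> = tlift (\<lambda>y1 y2. tlift (\<lambda>x1 x2. F0 x1 x2 y1 y2) (cop x)) ?v"
      by (rule tlift_swap) (rule lin1 lin2)+
    also have "\<dots> = tlift (\<lambda>y1 y2. tlift (\<lambda>x1 x2. F0 x1 x2 y1 y2) (cop x)) (cop y)"
      by (rule step2) (rule Q)+
    also have "\<dots> = lsweedler_lin F0 x y"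
      unfolding lsweedler_lin_def by (rule tlift_swap) (rule lin1 lin2)+
    finally show ?thesis .
  qed
  \<comment> \<open>The definite description needs some representing list; \<open>cop z\<close>
    provides one.\<close>
  have ex: "\<exists>ps. represents_coprod C z ps" if z: "z \<in> cspan elems" for z
  proof -
    obtain ps where "set ps \<subseteq> cspan elems \<times> cspan elems" "(\<Sum>(x, y)\<leftarrow>ps. x \<otimes> y) = cop z"
      by (rule tensor_square_list[OF _ cop_in_tensor_square[OF z]]) (rule complex_vector.span_scale)
    then show ?thesis
      using cop_in_tensor_square[OF z]
      by (intro exI[of _ ps]) (simp add: represents_coprod_def lcarrier_eq lcoprod_iff es_middle_balance_def
          complex_vector.span_zero)
  qed
  obtain ps qs where r: "represents_coprod C x ps" "represents_coprod C y qs"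
    using ex[OF x] ex[OF y] by blast
  show ?thesis
    unfolding lsweedler_def
  proof (rule the_equality)
    show "\<exists>ps qs. represents_coprod C x ps \<and> represents_coprod C y qs \<and>
        lsweedler_lin F0 x y = (\<Sum>(x1, x2)\<leftarrow>ps. \<Sum>(y1, y2)\<leftarrow>qs. F x1 x2 y1 y2)"
      by (intro exI[of _ ps] exI[of _ qs] conjI r val[OF r, symmetric])
  qed (elim exE conjE, simp only: val)
qed

end

section \<open>The cocycle\<close>

context coalgebra_points
begin

text \<open>Products of a source and a target are generic elements at the trivial point, so
  multiplication by them is covered by \<open>lmult_kelem\<close>.\<close>

lemma kcst_elem: "K.kcst (elem e e' 1) = kelem (K.kcst e) (K.kcst e') \<one>"
proof -
  have "clinear (elem e e')" by (intro lin)
  then show ?thesis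
    using kelem_smash_elem[OF point_one, of e e'] by (simp add: K.conv_kcst_comp)
qed

lemma lmult_kelem_unit_left:
  assumes "clinear E" "clinear E'" "clinear F" "clinear G" "point \<gamma>"
  shows "K.kconv (lmult C) (kelem E E' \<one>) (kelem F G \<gamma>) = kelem (E \<odot> F) (G \<odot> ((S \<circ> \<gamma>) \<unrhd> E')) \<gamma>"
  using assms by (simp add: lmult_kelem point_one one_kact kmult_one)

lemma lmult_kelem_unit_right:
  assumes "clinear E" "clinear E'" "clinear F" "clinear G" "point \<gamma>"
  shows "K.kconv (lmult C) (kelem F G \<gamma>) (kelem E E' \<one>) = kelem (F \<odot> (\<gamma> \<unrhd> E)) (E' \<odot> G) \<gamma>"
  using assms by (simp add: lmult_kelem point_one kmult_one) (simp add: antipode_kone one_kact)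

text \<open>\<open>E'\<close> ends up on the far right because it enters as
  \<open>(S \<circ> \<gamma>) \<unrhd> E'\<close> in the coefficient on which
  \<open>\<gamma>\<close> acts.\<close>

lemma twist_form_bimodule_kelem:
  assumes "clinear \<tau>" "range \<tau> \<subseteq> centre" "clinear E" "clinear E'" "clinear F" "clinear G"
    "clinear F'" "clinear G'" "point \<gamma>" "point \<eta>"
  shows "K.kconv (twist_form \<tau>) (K.kconv (lmult C) (kelem E E' \<one>) (kelem F G \<gamma>)) (kelem F' G' \<eta>)
    = E \<odot> (K.kconv (twist_form \<tau>) (kelem F G \<gamma>) (kelem F' G' \<eta>) \<odot> E')"
  using assms by (simp add: lmult_kelem_unit_left twist_form_kelem point_antipode kact_mult kact_kact
      point_antipode_right one_kact K.kmult_assoc)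

text \<open>On both sides the additional factors are \<open>\<gamma> \<unrhd> E\<close> directly
  after \<open>F\<close> and \<open>\<gamma> \<unrhd> E'\<close> directly before
  \<open>\<gamma> \<unrhd> G\<close>.\<close>

lemma twist_form_balance_kelem:
  assumes "clinear \<tau>" "range \<tau> \<subseteq> centre" "clinear E" "clinear E'" "clinear F" "clinear G"
    "clinear F'" "clinear G'" "point \<gamma>" "point \<eta>"
  shows "K.kconv (twist_form \<tau>) (K.kconv (lmult C) (kelem F G \<gamma>) (kelem E E' \<one>)) (kelem F' G' \<eta>)
    = K.kconv (twist_form \<tau>) (kelem F G \<gamma>) (K.kconv (lmult C) (kelem E E' \<one>) (kelem F' G' \<eta>))"
  using assms by (simp add: lmult_kelem_unit_left lmult_kelem_unit_right twist_form_kelem point_antipode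
      point_mult kact_mult kact_kact point_antipode_right kmult_one K.kmult_assoc)

lemma sigma_one_conv:
  assumes "point \<gamma>"
  shows "\<sigma> \<circ> (\<one> \<boxtimes> \<gamma>) = \<one>" "\<sigma> \<circ> (\<gamma> \<boxtimes> \<one>) = \<one>"
proof -
  have e: "\<epsilon> (\<gamma> k) = \<epsilon>\<^sub>K k" for k using point_counit[OF assms] by (simp add: fun_eq_iff)
  show "\<sigma> \<circ> (\<one> \<boxtimes> \<gamma>) = \<one>" "\<sigma> \<circ> (\<gamma> \<boxtimes> \<one>) = \<one>"
    using assms by (simp_all add: K.conv_kcst_left K.conv_kcst_right fun_eq_iff sigma_one_left sigma_one_right e)
      (simp_all add: cst_def)
qed

lemma twist_form_one_kelem:
  assumes "clinear F" "clinear G" "point \<gamma>"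
  shows "K.kconv (twist_form \<sigma>) (kelem \<one> \<one> \<one>) (kelem F G \<gamma>) = counit_lin \<circ> kelem F G \<gamma>"
    and "K.kconv (twist_form \<sigma>) (kelem F G \<gamma>) (kelem \<one> \<one> \<one>) = counit_lin \<circ> kelem F G \<gamma>"
  using assms by (simp_all add: twist_form_kelem central_sigma point_one counit_kelem sigma_one_conv one_kact
      kact_one kmult_one)

text \<open>When both coproducts split into tensor products of maps, a Sweedler sum with separated
  arguments is a convolution of convolutions by the interchange law.\<close>

lemma lsweedler_lin_conv:
  assumes "cbilinear p" "cbilinear f" "cbilinear g" "clinear X1" "clinear X2" "clinear Y1" "clinear Y2"
    and "cop \<circ> X = X1 \<boxtimes> X2" "cop \<circ> Y = Y1 \<boxtimes> Y2"
  shows "K.kconv (lsweedler_lin (\<lambda>x1 x2 y1 y2. p (f x1 y1) (g x2 y2))) X Y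
    = K.kconv p (K.kconv f X1 Y1) (K.kconv g X2 Y2)"
proof -
  note l = assms(1-3)[THEN cbilinear_left] assms(1-3)[THEN cbilinear_right] clinear_ident
  let ?Q = "\<lambda>u v. tlift (\<lambda>x1 x2. tlift (\<lambda>y1 y2. p (f x1 y1) (g x2 y2)) v) u"
  have "K.kconv (lsweedler_lin (\<lambda>x1 x2 y1 y2. p (f x1 y1) (g x2 y2))) X Y = K.kconv ?Q (cop \<circ> X) (cop \<circ> Y)"
    by (simp add: conv_def lsweedler_lin_def)
  also have "\<dots> = K.kconv p (K.kconv f X1 Y1) (K.kconv g X2 Y2)"
    unfolding assms(8,9)
  proof (rule K.conv_interchange)
    show "?Q (X1 a \<otimes> X2 b) (Y1 c \<otimes> Y2 d) = p (f (X1 a) (Y1 c)) (g (X2 b) (Y2 d))" for a b c d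
      by (subst tlift_tens, (intro lin l)+, subst tlift_tens, (intro lin l refl)+)
    show "cbilinear ?Q" by (intro lin l)
  qed (simp_all add: assms)
  finally show ?thesis .
qed

text \<open>The coproduct separates the left coefficients from the right ones. In the product of the
  two forms \<tau> therefore stands next to \<open>\<tau>'\<close> and cancels, and what remains is
  the counit of the product.\<close>

lemma convolution_kelem:
  assumes "(\<tau>, \<tau>') = (\<sigma>, \<sigma>i) \<or> (\<tau>, \<tau>') = (\<sigma>i, \<sigma>)"
    and "clinear F" "clinear G" "clinear F'" "clinear G'" "point \<gamma>" "point \<eta>"
  shows "K.kconv (lsweedler_lin (\<lambda>x1 x2 y1 y2. twist_form \<tau> x1 y1 * twist_form \<tau>' x2 y2))
      (kelem F G \<gamma>) (kelem F' G' \<eta>) = counit_lin \<circ> K.kconv (lmult C) (kelem F G \<gamma>) (kelem F' G' \<eta>)"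
proof -
  have sig: "(\<tau> \<circ> (\<gamma> \<boxtimes> \<eta>)) \<odot> ((\<tau>' \<circ> (\<gamma> \<boxtimes> \<eta>)) \<odot> X) = X" if "clinear X" for X
    using assms that sigma_cancel by auto
  have \<tau>: "clinear \<tau>" "clinear \<tau>'" "range \<tau> \<subseteq> centre" "range \<tau>' \<subseteq> centre"
    using assms(1) central_sigma central_sigma_inv by auto
  have cancel: "(\<gamma> \<odot> \<eta>) \<odot> (S \<circ> \<eta>) = \<gamma>"
    using assms by (simp add: K.kmult_assoc point_antipode_right kmult_one)
  have "K.kconv (lsweedler_lin (\<lambda>x1 x2 y1 y2. twist_form \<tau> x1 y1 * twist_form \<tau>' x2 y2))
      (kelem F G \<gamma>) (kelem F' G' \<eta>)
    = K.kconv (twist_form \<tau>) (kelem F \<one> \<gamma>) (kelem F' \<one> \<eta>)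
      \<odot> K.kconv (twist_form \<tau>') (kelem \<one> G \<gamma>) (kelem \<one> G' \<eta>)"
    by (rule lsweedler_lin_conv) (use assms \<tau> in \<open>simp_all add: es_coprod_lift_kelem del: comp_apply\<close>)
  also have "\<dots> = F \<odot> ((\<gamma> \<unrhd> F') \<odot> (((\<gamma> \<odot> \<eta>) \<unrhd> G') \<odot> (\<gamma> \<unrhd> G)))"
    using assms(2-) \<tau> sig by (simp add: twist_form_kelem kact_one kmult_one K.kmult_assoc point_mult)
  also have "\<dots> = counit_lin \<circ> K.kconv (lmult C) (kelem F G \<gamma>) (kelem F' G' \<eta>)"
    using assms(2-) by (simp add: lmult_kelem counit_kelem point_mult point_antipode kact_mult kact_kact cancel K.kmult_assoc)
  finally show ?thesis .
qed

end

context central_crossed_product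
begin

text \<open>The linear counterpart of \<open>left_twist\<close>, with the product bracketed to the
  right to fit \<open>lsweedler_lin_conv\<close>.\<close>

definition twist_left ::
    "('b, 'h) smash_pair \<Rightarrow> ('b, 'h) smash_pair
      \<Rightarrow> ('b, 'h) smash_pair" where
  "twist_left = lsweedler_lin (\<lambda>x1 x2 y1 y2. lmult C (lsource C (twist_form \<sigma> x1 y1)) (lmult C x2 y2))"

lemma clinear_lsource [simp]: "clinear (lsource C)" and clinear_ltarget [simp]: "clinear (ltarget C)"
  unfolding lsource_eq[abs_def] ltarget_eq[abs_def] by (intro lin)+

lemma cbilinear_lsweedler_lin:
  assumes "\<And>y1 y2. cbilinear (\<lambda>x1 x2. F x1 x2 y1 y2)" "\<And>x1 x2. cbilinear (F x1 x2)"
  shows "cbilinear (lsweedler_lin F)"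
proof -
  have l: "clinear (\<lambda>x. F x x2 y1 y2)" "clinear (\<lambda>x. F x1 x y1 y2)" "clinear (\<lambda>x. F x1 x2 x y2)" "clinear (\<lambda>x. F x1 x2 y1 x)"
    for x1 x2 y1 y2 using assms by (simp_all add: cbilinear_def)
  show ?thesis
    unfolding lsweedler_lin_def by (intro lin l clinear_es_cop[THEN clinear_compose])
qed

lemmas lin_twist = cbilinear_twist_form[THEN cbilinear_left] cbilinear_twist_form[THEN cbilinear_right]
  clinear_lsource[THEN clinear_compose] clinear_ltarget[THEN clinear_compose]

lemma cbilinear_twist_left [simp]: "cbilinear twist_left"
  unfolding twist_left_def by (intro cbilinear_lsweedler_lin; intro lin lin_twist linear_sigma)

end

context coalgebra_points
begin

text \<open>A product as in a crossed product: \<open>lmult_kelem\<close> with the value of \<sigma>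
  at the two points as an additional factor of the left coefficient.\<close>

lemma twist_left_kelem:
  assumes "clinear F" "clinear G" "clinear F'" "clinear G'" "point \<gamma>" "point \<eta>"
  shows "K.kconv twist_left (kelem F G \<gamma>) (kelem F' G' \<eta>)
    = kelem (F \<odot> ((\<gamma> \<unrhd> F') \<odot> (\<sigma> \<circ> (\<gamma> \<boxtimes> \<eta>)))) (G' \<odot> ((S \<circ> \<eta>) \<unrhd> G)) (\<gamma> \<odot> \<eta>)"
proof -
  let ?L = "F \<odot> ((\<gamma> \<unrhd> F') \<odot> (\<sigma> \<circ> (\<gamma> \<boxtimes> \<eta>)))"
  let ?p = "\<lambda>e z. lmult C (lsource C e) z"
  have p: "cbilinear ?p" by (intro lin lin_twist)
  have "K.kconv twist_left (kelem F G \<gamma>) (kelem F' G' \<eta>)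
    = K.kconv ?p (K.kconv (twist_form \<sigma>) (kelem F \<one> \<gamma>) (kelem F' \<one> \<eta>))
        (K.kconv (lmult C) (kelem \<one> G \<gamma>) (kelem \<one> G' \<eta>))"
    unfolding twist_left_def
    by (rule lsweedler_lin_conv) (use assms p in \<open>simp_all add: es_coprod_lift_kelem del: lsource_eq comp_apply\<close>)
  also have "\<dots> = K.kconv ?p ?L (kelem \<one> (G' \<odot> ((S \<circ> \<eta>) \<unrhd> G)) (\<gamma> \<odot> \<eta>))"
    using assms by (simp add: twist_form_kelem central_sigma lmult_kelem kact_one kmult_one point_mult del: lsource_eq)
  also have "\<dots> = K.kconv (lmult C) (lsource C \<circ> ?L) (kelem \<one> (G' \<odot> ((S \<circ> \<eta>) \<unrhd> G)) (\<gamma> \<odot> \<eta>))"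
    by (simp add: conv_def)
  also have "\<dots> = kelem ?L (G' \<odot> ((S \<circ> \<eta>) \<unrhd> G)) (\<gamma> \<odot> \<eta>)"
    using assms by (simp add: lmult_source_kelem point_mult point_antipode kmult_one del: lsource_eq)
  finally show ?thesis .
qed

text \<open>After expansion both sides have the same factors apart from two values of \<sigma> each,
  which \<open>cocycle\<close> matches. For this, \<open>swap\<close> moves a central value past the
  action on \<open>F''\<close>.\<close>

lemma cocycle_kelem:
  assumes "clinear F" "clinear G" "clinear F'" "clinear G'" "clinear F''" "clinear G''"
    and "point \<gamma>" "point \<eta>" "point \<mu>"
    and cocycle: "(\<gamma> \<unrhd> (\<sigma> \<circ> (\<eta> \<boxtimes> \<mu>))) \<odot> (\<sigma> \<circ> (\<gamma> \<boxtimes> (\<eta> \<odot> \<mu>))) = (\<sigma> \<circ> (\<gamma> \<boxtimes> \<eta>)) \<odot> (\<sigma> \<circ> ((\<gamma> \<odot> \<eta>) \<boxtimes> \<mu>))"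
  shows "K.kconv (twist_form \<sigma>) (kelem F G \<gamma>) (K.kconv twist_left (kelem F' G' \<eta>) (kelem F'' G'' \<mu>))
    = K.kconv (twist_form \<sigma>) (K.kconv twist_left (kelem F G \<gamma>) (kelem F' G' \<eta>)) (kelem F'' G'' \<mu>)"
proof -
  note [simp] = assms(1-9)
  have cocycle': "(\<gamma> \<unrhd> (\<sigma> \<circ> (\<eta> \<boxtimes> \<mu>))) \<odot> ((\<sigma> \<circ> (\<gamma> \<boxtimes> (\<eta> \<odot> \<mu>))) \<odot> X)
      = (\<sigma> \<circ> (\<gamma> \<boxtimes> \<eta>)) \<odot> ((\<sigma> \<circ> ((\<gamma> \<odot> \<eta>) \<boxtimes> \<mu>)) \<odot> X)" if "clinear X" for X
    using that cocycle by (simp flip: K.kmult_assoc)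
  have \<sigma>: "range (\<sigma> \<circ> (\<gamma> \<boxtimes> \<eta>)) \<subseteq> centre" using central_sigma by auto
  have swap: "(\<sigma> \<circ> (\<gamma> \<boxtimes> \<eta>)) \<odot> (((\<gamma> \<odot> \<eta>) \<unrhd> F'') \<odot> X) = ((\<gamma> \<odot> \<eta>) \<unrhd> F'') \<odot> ((\<sigma> \<circ> (\<gamma> \<boxtimes> \<eta>)) \<odot> X)"
    if "clinear X" for X
    using K.kmult_central[OF \<sigma>, of "(\<gamma> \<odot> \<eta>) \<unrhd> F''"] that by (simp flip: K.kmult_assoc)
  show ?thesis
    by (simp add: twist_left_kelem twist_form_kelem central_sigma point_mult point_antipode kact_mult kact_kact
        K.kmult_assoc cocycle' swap point_antipode_right kmult_one)
qed

end

section \<open>From generic points to all elements of the carrier\<close>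

context central_crossed_product
begin

text \<open>The cocycle condition of \<sigma> at the three projections, as
  \<open>cocycle_kelem\<close> requires it.\<close>

lemma sigma_cocycle_q:
  "HHHC.kconv (*) (HHHC.kconv (\<triangleright>) q1 (\<sigma> \<circ> HHHC.kconv (\<otimes>) q2 q3)) (\<sigma> \<circ> HHHC.kconv (\<otimes>) q1 (HHHC.kconv (*) q2 q3))
    = HHHC.kconv (*) (\<sigma> \<circ> HHHC.kconv (\<otimes>) q1 q2) (\<sigma> \<circ> HHHC.kconv (\<otimes>) (HHHC.kconv (*) q1 q2) q3)"
  (is "HHHC.kconv (*) ?X ?Y = HHHC.kconv (*) ?X' ?Y'")
proof (rule clinear_tensor_eqI)
  let ?s = "\<lambda>x y. \<sigma> (x \<otimes> y)"
  have s: "cbilinear ?s" by (intro lin)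
  have ident_comp: "(\<lambda>x. x) \<circ> f = f" for f :: "'x \<Rightarrow> 'y" by (rule ext) simp
  have [simp]: "clinear q1" "clinear q2" "clinear q3" by simp_all
  have X: "?X ((h \<otimes> k) \<otimes> m) = h \<triangleright> \<sigma> (k \<otimes> m)" for h k m
    using conv_q_right[OF bilinear_act s clinear_ident clinear_ident clinear_ident, of h k m]
    by (subst conv_compose) (simp_all add: ident_comp del: comp_apply)
  have Y: "?Y ((h \<otimes> k) \<otimes> m) = \<sigma> (h \<otimes> (k * m))" for h k m
    using conv_q_right[OF s cbilinear_mult clinear_ident clinear_ident clinear_ident, of h k m]
    by (subst conv_compose) (simp_all add: ident_comp del: comp_apply)
  have Y': "?Y' ((h \<otimes> k) \<otimes> m) = \<sigma> ((h * k) \<otimes> m)" for h k m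
    using conv_q_left[OF s cbilinear_mult clinear_ident clinear_ident clinear_ident, of h k m]
    by (subst conv_compose) (simp_all add: ident_comp del: comp_apply)
  \<comment> \<open>This factor does not involve the third variable, which is why no sum over
    \<open>m\<close> remains on the right side of \<open>sigma_cocycle\<close>.\<close>
  have X': "?X' = \<sigma> \<circ> HHH.p1"
  proof -
    have "HHHC.kconv (\<otimes>) q1 q2 = HHC.kconv (\<otimes>) HH.p1 HH.p2 \<circ> HHH.p1"
      by (rule conv_hom[OF HHH.hom_fst cbilinear_tens]) simp_all
    then show ?thesis by (simp add: HH.tens_fst_snd comp_def)
  qed
  have l: "clinear ?X" "clinear ?Y" "clinear ?X'" "clinear ?Y'" by simp_all
  note lc = l[THEN clinear_compose]
  show "clinear (HHHC.kconv (*) ?X ?Y)" "clinear (HHHC.kconv (*) ?X' ?Y')" using l by simp_all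
  fix w m
  have "(\<lambda>w. HHHC.kconv (*) ?X ?Y (w \<otimes> m)) = (\<lambda>w. HHHC.kconv (*) ?X' ?Y' (w \<otimes> m))"
  proof (rule clinear_tensor_eqI)
    show "clinear (\<lambda>w. HHHC.kconv (*) ?X ?Y (w \<otimes> m))" "clinear (\<lambda>w. HHHC.kconv (*) ?X' ?Y' (w \<otimes> m))"
      using l by (simp_all add: clinear_compose[OF HHHC.clinear_kconv clinear_tens_left])
    fix h k
    have "HHHC.kconv (*) ?X ?Y ((h \<otimes> k) \<otimes> m)
        = sweedler2 HH.\<Delta>\<Delta> (\<lambda>a b. sweedler2 \<Delta> (\<lambda>m1 m2. ?X (a \<otimes> m1) * ?Y (b \<otimes> m2)) m) (h \<otimes> k)"
      unfolding conv_def[of HHH.\<Delta>\<Delta> "(*) :: 'b \<Rightarrow> _"] by (rule HHH.sweedler2_tens) (intro lin lc)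
    also have "\<dots> = sweedler2 \<Delta> (\<lambda>h1 h2. sweedler2 \<Delta> (\<lambda>k1 k2. sweedler2 \<Delta> (\<lambda>m1 m2.
        ?X ((h1 \<otimes> k1) \<otimes> m1) * ?Y ((h2 \<otimes> k2) \<otimes> m2)) m) k) h"
      by (rule HH.sweedler2_tens) (unfold sweedler2_def, intro lin lc)
    also have "\<dots> = sweedler2 \<Delta> (\<lambda>h1 h2. sweedler2 \<Delta> (\<lambda>k1 k2. \<sigma> (h1 \<otimes> k1) * \<sigma> ((h2 * k2) \<otimes> m)) k) h"
      unfolding X Y by (rule sigma_cocycle)
    also have "\<dots> = sweedler2 HH.\<Delta>\<Delta> (\<lambda>a b. \<sigma> a * ?Y' (b \<otimes> m)) (h \<otimes> k)"
      unfolding Y'[symmetric] by (rule HH.sweedler2_tens[symmetric]) (intro lin lc)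
    also have "\<dots> = HHHC.kconv (*) ?X' ?Y' ((h \<otimes> k) \<otimes> m)"
      unfolding X' by (rule HHH.conv_fst_left[symmetric]) (simp_all add: l del: comp_apply)
    finally show "HHHC.kconv (*) ?X ?Y ((h \<otimes> k) \<otimes> m) = HHHC.kconv (*) ?X' ?Y' ((h \<otimes> k) \<otimes> m)" .
  qed
  then show "HHHC.kconv (*) ?X ?Y (w \<otimes> m) = HHHC.kconv (*) ?X' ?Y' (w \<otimes> m)"
    by (simp only: fun_eq_iff)
qed

lemma twist_form_cocycle:
  assumes "x \<in> cspan elems" "y \<in> cspan elems" "z \<in> cspan elems"
  shows "twist_form \<sigma> x (twist_left y z) = twist_form \<sigma> (twist_left x y) z"
proof -
  interpret P: coalgebra_points \<Delta> \<epsilon> S "(\<triangleright>)" \<sigma> \<sigma>i HHH.\<Delta>\<Delta> HHH.\<epsilon>\<epsilon> by (rule points_HHH)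
  note [simp] = hom_q
  let ?t = "twist_form \<sigma>"
  have gen: "?t (elem b b' h) (twist_left (elem c c' g) (elem d d' m)) = ?t (twist_left (elem b b' h) (elem c c' g)) (elem d d' m)"
    for b b' h c c' g d d' m
  proof -
    have l: "clinear (elem b b')" for b b' by (intro lin)
    have "HHHC.kconv ?t (elem b b' \<circ> q1) (HHHC.kconv twist_left (elem c c' \<circ> q2) (elem d d' \<circ> q3))
      = HHHC.kconv ?t (HHHC.kconv twist_left (elem b b' \<circ> q1) (elem c c' \<circ> q2)) (elem d d' \<circ> q3)"
      unfolding P.kelem_smash_elem[OF hom_q(1)] P.kelem_smash_elem[OF hom_q(2)] P.kelem_smash_elem[OF hom_q(3)]
      by (rule P.cocycle_kelem) (simp_all add: sigma_cocycle_q)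
    from fun_cong[OF this, of "(h \<otimes> g) \<otimes> m"] show ?thesis
      by (simp only: conv_q_left conv_q_right cbilinear_twist_form linear_sigma cbilinear_twist_left l)
  qed
  note lt = cbilinear_twist_left[THEN cbilinear_left] cbilinear_twist_left[THEN cbilinear_right]
  have "?t (elem b b' h) (twist_left y z) = ?t (twist_left (elem b b' h) y) z" for b b' h
    by (rule cbilinear_eq_on_span[OF _ _ _ assms(2,3)])
      (intro lin lin_twist linear_sigma lt | use gen in \<open>auto simp: elems_def\<close>)+
  then show ?thesis
    by (intro clinear_eq_on_span[OF _ _ _ assms(1), of "\<lambda>x. ?t x (twist_left y z)" "\<lambda>x. ?t (twist_left x y) z"])
      (intro lin lin_twist linear_sigma lt | auto simp: elems_def)+
qed

lemma env_balance_eq: "env_balance C = cspan {lmult C x (elem b b' 1) \<otimes> y - x \<otimes> lmult C (elem b b' 1) y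
    | x y b b'. x \<in> cspan elems \<and> y \<in> cspan elems}"
  unfolding env_balance_def lmult_source_target lcarrier_eq ..

lemma twist_form_bimodule:
  assumes \<tau>: "clinear \<tau>" "range \<tau> \<subseteq> centre" and xy: "x \<in> cspan elems" "y \<in> cspan elems"
  shows "twist_form \<tau> (lmult C (elem e e' 1) x) y = e * twist_form \<tau> x y * e'"
proof -
  interpret P: coalgebra_points \<Delta> \<epsilon> S "(\<triangleright>)" \<sigma> \<sigma>i HH.\<Delta>\<Delta> HH.\<epsilon>\<epsilon> by (rule points_HH)
  note [simp] = HH.hom_fst HH.hom_snd \<tau>
  let ?t = "twist_form \<tau>"
  have t: "cbilinear ?t" by simp
  note lt = t[THEN cbilinear_left] t[THEN cbilinear_right]
  have gen: "?t (lmult C (elem e e' 1) (elem b b' h)) (elem c c' g) = e * ?t (elem b b' h) (elem c c' g) * e'" for b b' h c c' g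
  proof -
    have l: "clinear (elem b b')" for b b' by (intro lin)
    have m: "clinear (lmult C x)" for x using cbilinear_lmult by (simp add: cbilinear_def)
    have e: "clinear (\<lambda>w. w * e')" by (intro lin)
    let ?X = "elem b b' \<circ> HH.p1" and ?Y = "elem c c' \<circ> HH.p2"
    have X: "clinear ?X" and Y: "clinear ?Y" using l by simp_all
    have "HHC.kconv ?t (HHC.kconv (lmult C) (HHC.kcst (elem e e' 1)) ?X) ?Y
      = HHC.kconv (*) (HHC.kcst e) (HHC.kconv (*) (HHC.kconv ?t ?X ?Y) (HHC.kcst e'))"
      unfolding P.kcst_elem P.kelem_smash_elem[OF HH.hom_fst] P.kelem_smash_elem[OF HH.hom_snd]
      by (rule P.twist_form_bimodule_kelem) simp_all
    then have "HHC.kconv ?t ((lmult C (elem e e' 1) \<circ> elem b b') \<circ> HH.p1) ?Y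
      = (*) e \<circ> ((\<lambda>w. w * e') \<circ> HHC.kconv ?t ?X ?Y)"
      using X Y e by (simp add: HHC.conv_kcst_left HHC.conv_kcst_right comp_assoc del: comp_apply)
    from fun_cong[OF this, of "h \<otimes> g"] show ?thesis
      by (simp add: HH.conv_fst_snd l m t mult.assoc)
  qed
  show ?thesis
    by (rule cbilinear_eq_on_span[OF _ _ _ xy]) (intro lin lt | use gen in \<open>auto simp: elems_def\<close>)+
qed

lemma twist_form_balance:
  assumes \<tau>: "clinear \<tau>" "range \<tau> \<subseteq> centre" and xy: "x \<in> cspan elems" "y \<in> cspan elems"
  shows "twist_form \<tau> (lmult C x (elem e e' 1)) y = twist_form \<tau> x (lmult C (elem e e' 1) y)"
proof -
  interpret P: coalgebra_points \<Delta> \<epsilon> S "(\<triangleright>)" \<sigma> \<sigma>i HH.\<Delta>\<Delta> HH.\<epsilon>\<epsilon> by (rule points_HH)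
  note [simp] = HH.hom_fst HH.hom_snd \<tau>
  let ?t = "twist_form \<tau>"
  have t: "cbilinear ?t" by simp
  note lt = t[THEN cbilinear_left] t[THEN cbilinear_right]
  have gen: "?t (lmult C (elem b b' h) (elem e e' 1)) (elem c c' g) = ?t (elem b b' h) (lmult C (elem e e' 1) (elem c c' g))"
    for b b' h c c' g
  proof -
    have l: "clinear (elem b b')" for b b' by (intro lin)
    have m: "clinear (lmult C x)" "clinear (\<lambda>u. lmult C u x)" for x using cbilinear_lmult by (simp_all add: cbilinear_def)
    let ?X = "elem b b' \<circ> HH.p1" and ?Y = "elem c c' \<circ> HH.p2"
    have X: "clinear ?X" and Y: "clinear ?Y" using l by simp_all
    have "HHC.kconv ?t (HHC.kconv (lmult C) ?X (HHC.kcst (elem e e' 1))) ?Y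
      = HHC.kconv ?t ?X (HHC.kconv (lmult C) (HHC.kcst (elem e e' 1)) ?Y)"
      unfolding P.kcst_elem P.kelem_smash_elem[OF HH.hom_fst] P.kelem_smash_elem[OF HH.hom_snd]
      by (rule P.twist_form_balance_kelem) simp_all
    then have "HHC.kconv ?t (((\<lambda>u. lmult C u (elem e e' 1)) \<circ> elem b b') \<circ> HH.p1) ?Y
      = HHC.kconv ?t ?X ((lmult C (elem e e' 1) \<circ> elem c c') \<circ> HH.p2)"
      using X Y by (simp add: HHC.conv_kcst_left HHC.conv_kcst_right comp_assoc del: comp_apply)
    from fun_cong[OF this, of "h \<otimes> g"] show ?thesis
      by (simp add: HH.conv_fst_snd l m t)
  qed
  show ?thesis
    by (rule cbilinear_eq_on_span[OF _ _ _ xy]) (intro lin lt | use gen in \<open>auto simp: elems_def\<close>)+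
qed

lemma lmult_source_target_elem: "lsource C e = elem e 1 1" "ltarget C e = elem 1 e 1"
  by (simp_all add: elem_one)

lemma twist_form_one:
  assumes x: "x \<in> cspan elems"
  shows "twist_form \<sigma> (lone C) x = counit_lin x" "twist_form \<sigma> x (lone C) = counit_lin x"
proof -
  interpret P: coalgebra_points \<Delta> \<epsilon> S "(\<triangleright>)" \<sigma> \<sigma>i \<Delta> \<epsilon> by (rule points_H)
  note [simp] = id_point
  let ?t = "twist_form \<sigma>"
  have t: "cbilinear ?t" by simp
  have one: "lone C = elem 1 1 1" by (simp add: elem_one)
  have l: "clinear (elem b b')" for b b' by (intro lin)
  have "H.kconv ?t (H.kcst (lone C)) (elem b b') = counit_lin \<circ> elem b b'"
    "H.kconv ?t (elem b b') (H.kcst (lone C)) = counit_lin \<circ> elem b b'" for b b'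
    unfolding one unfolding P.kcst_elem unfolding elem_kelem[symmetric]
    by (rule P.twist_form_one_kelem; simp)+
  then have "?t (lone C) (elem b b' h) = counit_lin (elem b b' h)" "?t (elem b b' h) (lone C) = counit_lin (elem b b' h)" for b b' h
    using t l by (simp_all add: H.conv_kcst_left H.conv_kcst_right fun_eq_iff del: lone_eq)
  then show "?t (lone C) x = counit_lin x" "?t x (lone C) = counit_lin x"
    using t by (intro clinear_eq_on_span[OF _ clinear_counit_lin _ x]; force simp: cbilinear_def elems_def simp del: lone_eq)+
qed

text \<open>On the carrier the Hopf parts of the two legs cancel in their product, so
  \<open>inv (aincl A)\<close> is applied to an element of the image of B.\<close>

lemma lcounit_eq:
  assumes x: "x \<in> cspan elems"
  shows "lcounit C x = counit_lin x"
proof -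
  interpret P: coalgebra_points \<Delta> \<epsilon> S "(\<triangleright>)" \<sigma> \<sigma>i \<Delta> \<epsilon> by (rule points_H)
  write P.ktens (infixr "\<boxtimes>" 76) and P.kone ("\<one>") and P.kelem ("kelem")
  note [simp] = id_point
  have inj: "inj (aincl A)"
  proof (rule injI)
    fix b b' assume "aincl A b = aincl A b'"
    then have "base_part (b \<otimes> 1) = base_part (b' \<otimes> 1)" by simp
    then show "b = b'" by (simp add: base_part_tens counit_one scaleC_one)
  qed
  have am: "clinear (tlift (amult A))" by (simp add: clinear_tlift)
  have l: "clinear (\<lambda>x. counit_lin x \<otimes> (1 :: 'h))" by (intro lin)
  have gen: "tlift (amult A) (elem b b' h) = counit_lin (elem b b' h) \<otimes> 1" for b b' h
  proof -
    let ?i = "\<lambda>x :: 'h. x"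
    have "tlift (amult A) \<circ> kelem (H.kcst b) (H.kcst b') ?i = H.kconv (amult A) (H.kcst b \<boxtimes> ?i) (H.kcst b' \<boxtimes> (S \<circ> ?i))"
      by (rule conv_tens[symmetric]) (simp_all del: comp_apply)
    also have "\<dots> = (counit_lin \<circ> kelem (H.kcst b) (H.kcst b') ?i) \<boxtimes> \<one>"
      by (subst P.amult_point) (simp_all add: P.counit_kelem P.point_antipode_right del: comp_apply)
    also have "\<dots> = (\<lambda>u. u \<otimes> 1) \<circ> (counit_lin \<circ> kelem (H.kcst b) (H.kcst b') ?i)"
      by (rule H.conv_kcst_right) (simp_all del: comp_apply)
    finally show ?thesis by (simp add: elem_kelem fun_eq_iff)
  qed
  have "tlift (amult A) x = aincl A (counit_lin x)"
    unfolding aincl_eq by (rule clinear_eq_on_span[OF am l _ x]) (auto simp: elems_def gen)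
  then show ?thesis
    by (simp add: ehresmann_schauenburg_def inv_f_f[OF inj] del: aincl_eq)
qed

text \<open>\<open>twist_form_kelem\<close> at the two projections, unfolded one convolution at a
  time. The factors with \<open>c\<close> and \<open>b'\<close> are pulled back from
  \<open>h\<close> alone and contribute no sum over \<open>g\<close>; hence four indices for
  \<open>h\<close> and two for \<open>g\<close>.\<close>

lemma twist_form_formula:
  "twist_form \<sigma> (elem b b' h) (elem c c' g) = sweedler4 \<Delta> (\<lambda>h1 h2 h3 h4. sweedler2 \<Delta> (\<lambda>g1 g2.
     b * (h1 \<triangleright> c) * \<sigma> (h2 \<otimes> g1) * ((h3 * g2) \<triangleright> c') * (h4 \<triangleright> b')) g) h"
proof -
  interpret P: coalgebra_points \<Delta> \<epsilon> S "(\<triangleright>)" \<sigma> \<sigma>i HH.\<Delta>\<Delta> HH.\<epsilon>\<epsilon> by (rule points_HH)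
  note [simp] = HH.hom_fst HH.hom_snd
  let ?m = "HHC.kconv (*) :: (_ \<Rightarrow> 'b) \<Rightarrow> _" and ?a = "HHC.kconv (\<triangleright>)"
  let ?A1 = "(\<lambda>u. u \<triangleright> c) \<circ> HH.p1" and ?A3 = "(\<lambda>u. u \<triangleright> b') \<circ> HH.p1"
  let ?M = "(\<lambda>u. u \<triangleright> c') \<circ> HHC.kconv (*) HH.p1 HH.p2"
  have l: "clinear (elem b b')" "clinear (elem c c')" "clinear (\<lambda>u. u \<triangleright> c)" "clinear (\<lambda>u. u \<triangleright> c')" "clinear (\<lambda>u. u \<triangleright> b')"
    by (intro lin)+
  have M: "?M (h \<otimes> g) = (h * g) \<triangleright> c'" for h g
    using HH.conv_fst_snd[OF cbilinear_mult clinear_ident clinear_ident, of h g] by (simp add: comp_def)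
  have lM: "clinear ?M" using l by simp
  have "HHC.kconv (twist_form \<sigma>) (elem b b' \<circ> HH.p1) (elem c c' \<circ> HH.p2)
    = ?m (HHC.kcst b) (?m (?a HH.p1 (HHC.kcst c)) (?m (\<sigma> \<circ> HHC.kconv (\<otimes>) HH.p1 HH.p2)
        (?m (?a (HHC.kconv (*) HH.p1 HH.p2) (HHC.kcst c')) (?a HH.p1 (HHC.kcst b')))))"
    unfolding P.kelem_smash_elem[OF HH.hom_fst] P.kelem_smash_elem[OF HH.hom_snd]
    by (rule P.twist_form_kelem) (simp_all add: central_sigma)
  also have "\<dots> = (*) b \<circ> ?m ?A1 (?m \<sigma> (?m ?M ?A3))"
  proof -
    have "\<sigma> \<circ> HHC.kconv (\<otimes>) HH.p1 HH.p2 = \<sigma>" by (simp add: HH.tens_fst_snd fun_eq_iff)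
    then show ?thesis
      using l by (simp add: HHC.conv_kcst_left HHC.conv_kcst_right del: comp_apply)
  qed
  finally have "twist_form \<sigma> (elem b b' h) (elem c c' g) = b * ?m ?A1 (?m \<sigma> (?m ?M ?A3)) (h \<otimes> g)"
    using fun_cong[of _ _ "h \<otimes> g"] HH.conv_fst_snd[OF cbilinear_twist_form[OF linear_sigma] l(1,2), of h g]
    by (metis comp_apply)
  also have "?m ?A1 (?m \<sigma> (?m ?M ?A3)) (h \<otimes> g)
    = sweedler2 \<Delta> (\<lambda>h1 k. (h1 \<triangleright> c) * ?m \<sigma> (?m ?M ?A3) (k \<otimes> g)) h"
    by (rule HH.conv_fst_left) (use l lM in \<open>simp_all del: comp_apply\<close>)
  also have "(\<lambda>k. ?m \<sigma> (?m ?M ?A3) (k \<otimes> g)) = (\<lambda>k. sweedler2 \<Delta> (\<lambda>h2 k'. sweedler2 \<Delta> (\<lambda>g1 g2.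
      \<sigma> (h2 \<otimes> g1) * ?m ?M ?A3 (k' \<otimes> g2)) g) k)"
    unfolding conv_def[of HH.\<Delta>\<Delta> "(*) :: 'b \<Rightarrow> _" \<sigma>] fun_eq_iff
    by (intro allI HH.sweedler2_tens)
      (intro lin clinear_compose[OF HHC.clinear_kconv[OF cbilinear_mult lM]], use l in \<open>simp del: comp_apply\<close>)
  also have "(\<lambda>k' g2. ?m ?M ?A3 (k' \<otimes> g2)) = (\<lambda>k' g2. sweedler2 \<Delta> (\<lambda>h3 h4. ((h3 * g2) \<triangleright> c') * (h4 \<triangleright> b')) k')"
    using l lM by (simp add: HH.conv_fst_right M fun_eq_iff del: comp_apply)
  also have "b * sweedler2 \<Delta> (\<lambda>h1 k. (h1 \<triangleright> c) * sweedler2 \<Delta> (\<lambda>h2 k'. sweedler2 \<Delta> (\<lambda>g1 g2.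
      \<sigma> (h2 \<otimes> g1) * sweedler2 \<Delta> (\<lambda>h3 h4. ((h3 * g2) \<triangleright> c') * (h4 \<triangleright> b')) k') g) k) h
    = sweedler2 \<Delta> (\<lambda>h1 k. sweedler2 \<Delta> (\<lambda>h2 k'. sweedler2 \<Delta> (\<lambda>g1 g2. sweedler2 \<Delta> (\<lambda>h3 h4.
      b * ((h1 \<triangleright> c) * (\<sigma> (h2 \<otimes> g1) * (((h3 * g2) \<triangleright> c') * (h4 \<triangleright> b'))))) k') g) k) h"
    unfolding sweedler2_def
    by (subst tlift_compose[where L = "(*) _"], (intro lin H.clinear_cop)+)+ (rule refl)
  \<comment> \<open>In \<open>sweedler4\<close> all sums over \<open>h\<close> precede the sum over
    \<open>g\<close>.\<close>
  also have "\<dots> = sweedler2 \<Delta> (\<lambda>h1 k. sweedler2 \<Delta> (\<lambda>h2 k'. sweedler2 \<Delta> (\<lambda>h3 h4. sweedler2 \<Delta> (\<lambda>g1 g2. 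
      b * ((h1 \<triangleright> c) * (\<sigma> (h2 \<otimes> g1) * (((h3 * g2) \<triangleright> c') * (h4 \<triangleright> b'))))) g) k') k) h"
    by (subst HH.sweedler_swap) (unfold sweedler2_def, (intro lin refl)+)
  finally show ?thesis
    by (simp add: sweedler4_def sweedler3_def mult.assoc)
qed

text \<open>A coset is evaluated at some representative in the tensor square;
  \<open>restrict\<close> makes the map extensional, as \<open>bimodule_homs\<close>
  demands.\<close>

definition induced_form :: "(('h, 'h) tensor \<Rightarrow> 'b)
    \<Rightarrow> (('b, 'h) smash_pair, ('b, 'h) smash_pair) tensor set \<Rightarrow> 'b" where
  "induced_form \<tau> = restrict (\<lambda>X. tlift (twist_form \<tau>)
     (SOME v. v \<in> tensor_square (cspan elems) \<and> coset (env_balance C) v = X)) (env_tensor C)"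

definition central_form where
  "central_form \<tau> \<longleftrightarrow> clinear \<tau> \<and> range \<tau> \<subseteq> (centre :: 'b set)"

lemma central_form_sigma: "central_form \<sigma>" "central_form \<sigma>i"
  by (simp_all add: central_form_def central_sigma central_sigma_inv)

lemma elem_in_span: "elem b b' h \<in> cspan elems"
  by (rule complex_vector.span_base) simp

text \<open>The choice made by \<open>SOME\<close> is immaterial because the form vanishes on
  \<open>env_balance\<close> by \<open>twist_form_balance\<close>.\<close>

lemma induced_form_coset:
  assumes \<tau>: "central_form \<tau>" and v: "v \<in> tensor_square (cspan elems)"
  shows "induced_form \<tau> (coset (env_balance C) v) = tlift (twist_form \<tau>) v"
proof -
  have t: "cbilinear (twist_form \<tau>)" using \<tau> by (simp add: central_form_def)
  have zero: "tlift (twist_form \<tau>) n = 0" if n: "n \<in> env_balance C" for n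
  proof -
    have "tlift (twist_form \<tau>) n \<in> cspan {}"
      by (rule clinear_image_span[OF clinear_tlift[OF t] _ n[unfolded env_balance_eq]])
        (use \<tau> in \<open>auto simp: clinear_diff[OF clinear_tlift[OF t]] tlift_tens t central_form_def twist_form_balance\<close>)
    then show ?thesis by simp
  qed
  let ?w = "SOME w. w \<in> tensor_square (cspan elems) \<and> coset (env_balance C) w = coset (env_balance C) v"
  have "?w \<in> tensor_square (cspan elems) \<and> coset (env_balance C) ?w = coset (env_balance C) v"
    by (rule someI[of _ v]) (simp add: v)
  then have "?w - v \<in> env_balance C"
    by (simp add: env_balance_eq coset_eq_iff)
  then have "tlift (twist_form \<tau>) ?w = tlift (twist_form \<tau>) v"
    using zero[of "?w - v"] by (simp add: clinear_diff[OF clinear_tlift[OF t]])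
  then show ?thesis
    using v by (simp add: induced_form_def env_tensor_def lcarrier_eq)
qed

lemma env_eval_form:
  "central_form \<tau> \<Longrightarrow> x \<in> cspan elems \<Longrightarrow> y \<in> cspan elems \<Longrightarrow> env_eval C (induced_form \<tau>) x y = twist_form \<tau> x y"
  by (simp add: env_eval_def induced_form_coset tensor_square_tens tlift_tens central_form_def)

lemma induced_form_bimodule_hom:
  assumes \<tau>: "central_form \<tau>"
  shows "induced_form \<tau> \<in> bimodule_homs C"
proof -
  have t: "clinear (tlift (twist_form \<tau>))" using \<tau> by (simp add: central_form_def clinear_tlift)
  have "v + w \<in> tensor_square (cspan elems)" "c *\<^sub>C v \<in> tensor_square (cspan elems)"
    if "v \<in> tensor_square (cspan elems)" "w \<in> tensor_square (cspan elems)" for v w c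
    using that by (simp_all add: tensor_square_def complex_vector.span_add complex_vector.span_scale)
  then show ?thesis
    using \<tau> by (auto simp: bimodule_homs_def lcarrier_eq induced_form_coset clinear_add[OF t] clinear_scaleC[OF t]
      env_eval_form lmult_source_target lmult_in_span elem_in_span twist_form_bimodule central_form_def[of \<tau>]
      simp del: lsource_eq ltarget_eq) (simp add: induced_form_def)
qed

text \<open>Additivity of \<open>f\<close> is known only for cosets of elements of the tensor
  square. The extension from spanning elements therefore carries membership along in every
  induction.\<close>

lemma bimodule_hom_eqI:
  assumes f: "f \<in> bimodule_homs C"
    and eq: "\<And>b b' h c c' g. env_eval C f (elem b b' h) (elem c c' g) = twist_form \<sigma> (elem b b' h) (elem c c' g)"
  shows "f = induced_form \<sigma>"
proof -
  let ?c = "coset (env_balance C)" and ?T = "tensor_square (cspan elems)"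
  have t: "cbilinear (twist_form \<sigma>)" by simp
  have add: "f (?c (v + w)) = f (?c v) + f (?c w)" if "v \<in> ?T" "w \<in> ?T" for v w
    using f that by (simp add: bimodule_homs_def lcarrier_eq)
  have scale: "f (?c (r *\<^sub>C v)) = r *\<^sub>C f (?c v)" if "v \<in> ?T" for v r
    using f that by (simp add: bimodule_homs_def lcarrier_eq)
  have T: "0 \<in> ?T" "v \<in> ?T \<Longrightarrow> w \<in> ?T \<Longrightarrow> v + w \<in> ?T" "v \<in> ?T \<Longrightarrow> r *\<^sub>C v \<in> ?T" for v w r
    by (simp_all add: tensor_square_def complex_vector.span_zero complex_vector.span_add complex_vector.span_scale)
  have zero: "f (?c 0) = 0" using scale[OF T(1), of 0] by simp
  have simple: "f (?c (x \<otimes> y)) = twist_form \<sigma> x y" if x: "x \<in> cspan elems" and y: "y \<in> cspan elems" for x y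
  proof -
    have tl: "twist_form \<sigma> u (r *\<^sub>C z + y) = r *\<^sub>C twist_form \<sigma> u z + twist_form \<sigma> u y"
      "twist_form \<sigma> (r *\<^sub>C z + y) u = r *\<^sub>C twist_form \<sigma> z u + twist_form \<sigma> y u"
      "twist_form \<sigma> u 0 = 0" "twist_form \<sigma> 0 u = 0" for u r z y
      using t clinear_zero[of "twist_form \<sigma> u"] clinear_zero[of "\<lambda>x. twist_form \<sigma> x u"]
      by (simp_all add: cbilinear_def clinear_iff)
    have fl: "f (?c (u \<otimes> (r *\<^sub>C z + y))) = r *\<^sub>C f (?c (u \<otimes> z)) + f (?c (u \<otimes> y))"
      "f (?c ((r *\<^sub>C z + y) \<otimes> u)) = r *\<^sub>C f (?c (z \<otimes> u)) + f (?c (y \<otimes> u))"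
      if "u \<in> cspan elems" "z \<in> cspan elems" "y \<in> cspan elems" for u r z y
      using that by (simp_all add: tens_add_right tens_add_left tens_scaleC_left tens_scaleC_right add scale T
          tensor_square_tens)
    have gen: "y \<in> cspan elems \<and> f (?c (u \<otimes> y)) = twist_form \<sigma> u y" if u: "u \<in> elems" for u
      using y
    proof (induction rule: complex_vector.span_induct_alt)
      case base
      show ?case
        by (simp add: clinear_zero[OF clinear_tens_right] zero tl complex_vector.span_zero)
    next
      case (step r z y)
      then have z: "z \<in> cspan elems" "f (?c (u \<otimes> z)) = twist_form \<sigma> u z"
        using u eq by (auto simp: elems_def env_eval_def intro: complex_vector.span_base)
      show ?case
        using step(2) z complex_vector.span_base[OF u]
        by (simp add: fl tl complex_vector.span_add complex_vector.span_scale)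
    qed
    have "x \<in> cspan elems \<and> f (?c (x \<otimes> y)) = twist_form \<sigma> x y"
      using x
    proof (induction rule: complex_vector.span_induct_alt)
      case base
      show ?case
        by (simp add: clinear_zero[OF clinear_tens_left] zero tl complex_vector.span_zero)
    next
      case (step r z x)
      show ?case
        using step(2) gen[OF step(1)] y complex_vector.span_base[OF step(1)]
        by (simp add: fl tl complex_vector.span_add complex_vector.span_scale)
    qed
    then show ?thesis ..
  qed
  have val: "f (?c v) = tlift (twist_form \<sigma>) v" if v: "v \<in> ?T" for v
  proof -
    have "v \<in> ?T \<and> f (?c v) = tlift (twist_form \<sigma>) v"
      using v[unfolded tensor_square_def]
    proof (induction rule: complex_vector.span_induct_alt)
      case base
      show ?case using T zero by (simp add: clinear_zero[OF clinear_tlift[OF t]])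
    next
      case (step r z w)
      then obtain x y where "z = x \<otimes> y" "x \<in> cspan elems" "y \<in> cspan elems" by blast
      then show ?case
        using step(2) by (simp add: add scale simple T tensor_square_tens tlift_add tlift_scaleC tlift_tens t)
    qed
    then show ?thesis ..
  qed
  show ?thesis
  proof (rule extensionalityI[where A = "env_tensor C"])
    show "f \<in> extensional (env_tensor C)" using f by (simp add: bimodule_homs_def)
    show "induced_form \<sigma> \<in> extensional (env_tensor C)" by (simp add: induced_form_def)
    fix X assume "X \<in> env_tensor C"
    then obtain v where "v \<in> ?T" "X = ?c v" by (auto simp: env_tensor_def lcarrier_eq)
    then show "f X = induced_form \<sigma> X" by (simp add: val induced_form_coset central_form_sigma)
  qed
qed

lemma twist_form_source_target:
  assumes "central_form \<tau>" "x \<in> cspan elems" "y \<in> cspan elems"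
  shows "twist_form \<tau> (lmult C (lsource C e) x) y = e * twist_form \<tau> x y"
    and "twist_form \<tau> (lmult C (ltarget C e) x) y = twist_form \<tau> x y * e"
    and "twist_form \<tau> (lmult C x (lsource C e)) y = twist_form \<tau> x (lmult C (lsource C e) y)"
    and "twist_form \<tau> (lmult C x (ltarget C e)) y = twist_form \<tau> x (lmult C (ltarget C e) y)"
  using assms unfolding lmult_source_target_elem
  by (simp_all add: central_form_def twist_form_bimodule twist_form_balance)

text \<open>Balancing in the factors of \<open>x\<close> holds since a target in front of
  \<open>x1\<close> comes out on the right of the first value and a source in front of
  \<open>x2\<close> on the left of the second one.\<close>

lemma convolution_form:
  assumes \<tau>: "(\<tau>, \<tau>') = (\<sigma>, \<sigma>i) \<or> (\<tau>, \<tau>') = (\<sigma>i, \<sigma>)" and xy: "x \<in> cspan elems" "y \<in> cspan elems"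
  shows "convolution C (induced_form \<tau>) (induced_form \<tau>') x y = lcounit C (lmult C x y)"
proof -
  interpret P: coalgebra_points \<Delta> \<epsilon> S "(\<triangleright>)" \<sigma> \<sigma>i HH.\<Delta>\<Delta> HH.\<epsilon>\<epsilon> by (rule points_HH)
  note [simp] = HH.hom_fst HH.hom_snd
  have g: "central_form \<tau>" "central_form \<tau>'" using \<tau> central_form_sigma by auto
  have c: "clinear \<tau>" "clinear \<tau>'" using g by (simp_all add: central_form_def)
  let ?F = "\<lambda>x1 x2 y1 y2. twist_form \<tau> x1 y1 * twist_form \<tau>' x2 y2"
  note lt = cbilinear_twist_form[OF c(1), THEN cbilinear_left] cbilinear_twist_form[OF c(1), THEN cbilinear_right]
    cbilinear_twist_form[OF c(2), THEN cbilinear_left] cbilinear_twist_form[OF c(2), THEN cbilinear_right]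
  have b: "cbilinear (\<lambda>x1 x2. ?F x1 x2 y1 y2)" "cbilinear (?F x1 x2)" for x1 x2 y1 y2
    by (intro lin lt)+
  have "convolution C (induced_form \<tau>) (induced_form \<tau>') x y = lsweedler_lin ?F x y"
    unfolding convolution_def
    by (rule lsweedler_eq[OF b _ _ _ _ xy])
      (simp_all add: env_eval_form g twist_form_source_target mult.assoc del: lsource_eq ltarget_eq)
  also have "\<dots> = counit_lin (lmult C x y)"
  proof (rule cbilinear_eq_on_span[OF _ _ _ xy])
    have lF: "cbilinear (lsweedler_lin ?F)" by (rule cbilinear_lsweedler_lin[OF b])
    then show "cbilinear (lsweedler_lin ?F)" .
    show lC: "cbilinear (\<lambda>x y. counit_lin (lmult C x y))" by (intro lin)
    fix x y assume "x \<in> elems" "y \<in> elems"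
    then obtain b b' h c c' g where xy: "x = elem b b' h" "y = elem c c' g" by (auto simp: elems_def)
    have l: "clinear (elem b b')" for b b' by (intro lin)
    have "HHC.kconv (lsweedler_lin ?F) (elem b b' \<circ> HH.p1) (elem c c' \<circ> HH.p2)
        = counit_lin \<circ> HHC.kconv (lmult C) (elem b b' \<circ> HH.p1) (elem c c' \<circ> HH.p2)"
      unfolding P.kelem_smash_elem[OF HH.hom_fst] P.kelem_smash_elem[OF HH.hom_snd]
      by (rule P.convolution_kelem[OF \<tau>]) simp_all
    from fun_cong[OF this, of "h \<otimes> g"] show "lsweedler_lin ?F x y = counit_lin (lmult C x y)"
      by (simp add: HH.conv_fst_snd l lF xy)
  qed
  also have "\<dots> = lcounit C (lmult C x y)"
    by (simp add: lcounit_eq lmult_in_span xy)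
  finally show ?thesis .
qed

lemma lsource_mult: "lsource C (e * e') = lmult C (lsource C e) (lsource C e')"
  by (simp add: lmult_tens amult_incl_left)

text \<open>Here a factor \<open>e\<close> on the right of the value of the form becomes
  \<open>lsource C e\<close> in front of \<open>x2\<close>, because the source map is
  multiplicative.\<close>

lemma left_twist_form:
  assumes xy: "x \<in> cspan elems" "y \<in> cspan elems"
  shows "left_twist C (induced_form \<sigma>) x y = twist_left x y"
proof -
  let ?F = "\<lambda>x1 x2 y1 y2. lmult C (lsource C (twist_form \<sigma> x1 y1)) (lmult C x2 y2)"
  have b: "cbilinear (\<lambda>x1 x2. ?F x1 x2 y1 y2)" "cbilinear (?F x1 x2)" for x1 x2 y1 y2
    by (intro lin lin_twist linear_sigma)+
  show ?thesis
    unfolding left_twist_def twist_left_def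
    by (rule lsweedler_eq[OF b _ _ _ _ xy])
      (simp_all add: env_eval_form central_form_sigma twist_form_source_target lsource_mult lmult_assoc
        del: lsource_eq ltarget_eq)
qed

lemma twist_left_in_span:
  assumes xy: "x \<in> cspan elems" "y \<in> cspan elems"
  shows "twist_left x y \<in> cspan elems"
proof -
  have l: "cbilinear (\<lambda>y1 y2. lmult C (lsource C (twist_form \<sigma> x1 y1)) (lmult C x2 y2))"
    "cbilinear (\<lambda>x1 x2. tlift (\<lambda>y1 y2. lmult C (lsource C (twist_form \<sigma> x1 y1)) (lmult C x2 y2)) w)" for x1 x2 w
    by (intro lin lin_twist linear_sigma)+
  have T: "tlift f (cop z) \<in> cspan elems" if z: "z \<in> cspan elems" and f: "cbilinear f"
      "\<And>x1 x2. x1 \<in> cspan elems \<Longrightarrow> x2 \<in> cspan elems \<Longrightarrow> f x1 x2 \<in> cspan elems" for f z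
    by (rule clinear_image_span[OF clinear_tlift[OF f(1)] _ cop_in_tensor_square[OF z, unfolded tensor_square_def]])
      (auto simp: tlift_tens f)
  show ?thesis
    unfolding twist_left_def lsweedler_lin_def
    by (intro T[OF xy(1)] T[OF xy(2)] l lmult_in_span source_target_in_span)
qed

lemma induced_form_2cocycle: "invertible_normalised_2cocycle C (induced_form \<sigma>)"
  unfolding invertible_normalised_2cocycle_def
proof (intro conjI ballI allI)
  note gs = central_form_sigma
  \<comment> \<open>The inverse is the form induced by \<open>\<sigma>i\<close>, whose values are
    central as well.\<close>
  show "convolution_invertible C (induced_form \<sigma>)"
    unfolding convolution_invertible_def lcarrier_eq
    by (intro conjI bexI[of _ "induced_form \<sigma>i"] ballI induced_form_bimodule_hom gs convolution_form) simp_all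
  fix x assume "x \<in> lcarrier C"
  then have x: "x \<in> cspan elems" by (simp add: lcarrier_eq)
  have one: "lone C \<in> cspan elems"
    using source_target_in_span(1)[of 1] by simp
  show "env_eval C (induced_form \<sigma>) (lone C) x = lcounit C x" "env_eval C (induced_form \<sigma>) x (lone C) = lcounit C x"
    using x one by (simp_all add: env_eval_form gs twist_form_one lcounit_eq del: lone_eq)
  fix y assume "y \<in> lcarrier C"
  then have y: "y \<in> cspan elems" by (simp add: lcarrier_eq)
  show "env_eval C (induced_form \<sigma>) (lmult C (lmult C (lsource C b) (ltarget C b')) x) y
      = b * env_eval C (induced_form \<sigma>) x y * b'" for b b'
    unfolding lmult_source_target
    using x y gs(1) by (simp add: env_eval_form lmult_in_span elem_in_span twist_form_bimodule central_form_def)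
  fix z assume "z \<in> lcarrier C"
  then have z: "z \<in> cspan elems" by (simp add: lcarrier_eq)
  show "env_eval C (induced_form \<sigma>) x (left_twist C (induced_form \<sigma>) y z)
      = env_eval C (induced_form \<sigma>) (left_twist C (induced_form \<sigma>) x y) z"
    by (simp add: left_twist_form env_eval_form gs x y z twist_left_in_span twist_form_cocycle)
qed

end

text \<open>The equivalence says that the formula has exactly one solution among the bimodule maps;
  taking \<open>f = \<sigma>t\<close> shows that \<open>\<sigma>t\<close> satisfies it.\<close>

theorem lemma3p2:
  fixes \<Delta> :: "'h::complex_algebra_1 \<Rightarrow> ('h, 'h) tensor"
    and \<epsilon> :: "'h \<Rightarrow> complex"
    and S :: "'h \<Rightarrow> 'h"
    and act :: "'h \<Rightarrow> 'b::complex_algebra_1 \<Rightarrow> 'b" (infixr "\<triangleright>" 74)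
    and \<sigma> \<sigma>i :: "('h, 'h) tensor \<Rightarrow> 'b"
  assumes "crossed_product \<Delta> \<epsilon> S (\<triangleright>) \<sigma> \<sigma>i"
    and "cocommutative \<Delta>"
    and "range \<sigma> \<subseteq> centre"
  shows "let C = ehresmann_schauenburg (smash_product \<Delta> (\<triangleright>)) in
    \<exists>\<sigma>t\<in>bimodule_homs C.
      (\<forall>f\<in>bimodule_homs C. f = \<sigma>t \<longleftrightarrow>
        (\<forall>b b' c c' h g.
          env_eval C f (smash_elem \<Delta> S b b' h) (smash_elem \<Delta> S c c' g)
          = sweedler4 \<Delta> (\<lambda>h1 h2 h3 h4. sweedler2 \<Delta> (\<lambda>g1 g2.
              b * (h1 \<triangleright> c) * \<sigma> (h2 \<otimes> g1) * ((h3 * g2) \<triangleright> c') * (h4 \<triangleright> b')) g) h)) \<and>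
      invertible_normalised_2cocycle C \<sigma>t"
proof -
  interpret central_crossed_product \<Delta> \<epsilon> S "(\<triangleright>)" \<sigma> \<sigma>i
    by (rule central_crossed_product.intro[OF assms(1)]) (unfold_locales; fact assms)
  have "f = induced_form \<sigma> \<longleftrightarrow> (\<forall>b b' c c' h g.
      env_eval C f (elem b b' h) (elem c c' g) = twist_form \<sigma> (elem b b' h) (elem c c' g))"
    if "f \<in> bimodule_homs C" for f
    using bimodule_hom_eqI[OF that] by (auto simp: env_eval_form central_form_sigma elem_in_span)
  then show ?thesis
    unfolding Let_def twist_form_formula[symmetric]
    using induced_form_2cocycle induced_form_bimodule_hom[OF central_form_sigma(1)] by blast
qed

end
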